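(* For every integers $p,k\geq1$ such that $p\leq\sqrt k$ and $\sqrt k+k\leq n$, let $\widehat R_{p,n}$ denote the leave-$p$-out risk estimator of the $k$NN classifier $\hat f_k=\mathcal{A}_k^{\mathcal{D}_n}(\cdot)$. Then $$\big|\mathbb{E}[\widehat R_{p,n}]-R(\hat f_k)\big|\leq\frac4{\sqrt{2\pi}}\frac{p\sqrt k}n,$$ and $$\mathbb{E}\big[(\widehat R_{p,n}-R(\hat f_k))^2\big]\leq\frac{128\kappa\gamma_d}{\sqrt{2\pi}}\frac{k^{3/2}}{n-p+1}+\frac{16}{2\pi}\frac{p^2k}{n^2}.$$ Moreover, $$\mathbb{E}\big[(\widehat R_{p,n}-L(\hat f_k))^2\big]\leq\frac{2\sqrt2}{\sqrt\pi}\frac{(2p+3)\sqrt k}n+\frac1n.$$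
   Context: Let $\mathcal{X}\subset\mathbb{R}^d$ and let $\mathcal{D}_n=\{Z_1,\ldots,Z_n\}$, $Z_i=(X_i,Y_i)\in\mathcal{X}\times\{0,1\}$, be i.i.d. copies of a pair $(X,Y)$ with arbitrary distribution, with $(X,Y)$ independent of $\mathcal{D}_n$. For a classifier $\hat f$ built from $\mathcal{D}_n$, the classification error is $L(\hat f)=\mathbb{P}(\hat f(X)\neq Y\mid\mathcal{D}_n)$ and the risk is $R(\hat f)=\mathbb{E}[L(\hat f)]$. $k$NN rule: for a sample $\mathcal{D}$ of at least $k$ labelled points and $x\in\mathbb{R}^d$, let $Y_{(1)}(x),\ldots,Y_{(k)}(x)$ be the labels of the $k$ points of the sample closest to $x$ in Euclidean norm (distance ties are broken by smallest index). Then $\mathcal{A}_k^{\mathcal{D}}(x)=1$ if $\frac1k\sum_{i=1}^kY_{(i)}(x)>\frac12$, $\mathcal{A}_k^{\mathcal{D}}(x)=0$ if $\frac1k\sum_{i=1}^kY_{(i)}(x)<\frac12$, and $\mathcal{A}_k^{\mathcal{D}}(x)$ is a Bernoulli$(1/2)$ variable otherwise (independent of the data and of the other such variables). Leave-$p$-out estimator: with $\mathcal{E}_{n-p}$ the set of subsets of $\{1,\ldots,n\}$ of cardinality $n-p$, $\bar e=\{1,\ldots,n\}\setminus e$ and $\mathcal{D}^e=\{Z_i\mid i\in e\}$, $$\widehat R_{p,n}=\binom np^{-1}\sum_{e\in\mathcal{E}_{n-p}}\Big(\frac1p\sum_{i\in\bar e}\mathbf{1}_{\{\mathcal{A}_k^{\mathcal{D}^e}(X_i)\neq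 Y_i\}}\Big).$$ $\gamma_d$ is the constant of Stone's lemma, depending only on $d$ (and growing exponentially with $d$): given finitely many points in $\mathbb{R}^d$ and $k\ge1$, any of these points belongs to the $k$ nearest neighbors of at most $k\gamma_d$ of the other points. It is a standing convention that this property holds almost surely, under the tie-breaking in use, for all finite families of points drawn from the $X_i$'s and independent copies of them. $\kappa\leq1.271$ is a universal constant such that for every $q\geq2$, all independent $U_1,\ldots,U_N$ with independent copies $U_1',\ldots,U_N'$, and every measurable real function $f$, setting $\zeta=f(U_1,\ldots,U_N)$ and $\zeta_i'=f(U_1,\ldots,U_i',\ldots,U_N)$, one has $\|\zeta-\mathbb{E}\zeta\|_q\leq\sqrt{2\kappa q}\,\sqrt{\|\sum_{i=1}^N(\zeta-\zeta_i')^2\|_{q/2}}$, where $\|U\|_q=(\mathbb{E}|U|^q)^{1/q}$. *)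

theory Defs
  imports "HOL-Probability.Probability"
begin

section \<open>The kNN classifier\<close>

text \<open>A sample is given by a finite index set \<open>e\<close> together with an indexed family of points.
  The neighbours of \<open>y\<close> are the indices of the \<open>k\<close> smallest elements of the sample
  for the lexicographic order on (distance to \<open>y\<close>, index); if the sample has fewer than \<open>k\<close>
  points, they are all neighbours.\<close>

definition neighbours ::
  "nat \<Rightarrow> nat set \<Rightarrow> (nat \<Rightarrow> real ^ 'd) \<Rightarrow> real ^ 'd \<Rightarrow> nat set" where
  "neighbours k e x y =
     {i \<in> e. card {j \<in> e. dist (x j) y < dist (x i) y \<or>
                          (dist (x j) y = dist (x i) y \<and> j < i)} < k}"

text \<open>The argument \<open>b\<close> is the value of the Bernoulli variable consulted when the vote is tied.\<close>

definition knn ::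
  "nat \<Rightarrow> nat set \<Rightarrow> (nat \<Rightarrow> (real ^ 'd) \<times> nat) \<Rightarrow> bool \<Rightarrow> real ^ 'd \<Rightarrow> nat" where
  "knn k e z b y =
     (let s = 1 / real k * (\<Sum>i\<in>neighbours k e (\<lambda>i. fst (z i)) y. real (snd (z i)))
      in if s > 1/2 then 1 else if s < 1/2 then 0 else of_bool b)"

text \<open>\<open>c (e, i)\<close> is the tie-breaking Bernoulli variable of the classifier trained on the
  observations with index in \<open>e\<close> when it is evaluated at the \<open>i\<close>-th point.\<close>

definition lpo_risk ::
  "nat \<Rightarrow> nat \<Rightarrow> nat \<Rightarrow> (nat \<Rightarrow> (real ^ 'd) \<times> nat) \<Rightarrow> (nat set \<times> nat \<Rightarrow> bool) \<Rightarrow> real" where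
  "lpo_risk k p n z c =
     1 / real (n choose p) *
     (\<Sum>e\<in>{e. e \<subseteq> {1..n} \<and> card e = n - p}.
        1 / real p *
        (\<Sum>i\<in>{1..n} - e. of_bool (knn k e z (c (e, i)) (fst (z i)) \<noteq> snd (z i))))"


section \<open>Classification error and risk\<close>

definition obs_space :: "(real ^ 'd) set \<Rightarrow> ((real ^ 'd) \<times> nat) measure" where
  "obs_space S = restrict_space borel S \<Otimes>\<^sub>M count_space {0, 1}"

text \<open>The data are \<open>Z 1, \<dots>, Z n\<close>; the new pair is \<open>Z 0\<close>. Tie-breaking variables \<open>c (e, i)\<close>
  are indexed by a training set \<open>e\<close> and a point \<open>i\<close> outside of it, possibly the new one.\<close>

definition tie_index :: "nat \<Rightarrow> (nat set \<times> nat) set" where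
  "tie_index n = {(e, i). e \<subseteq> {1..n} \<and> i \<in> {0..n} - e}"

definition generated_algebra ::
  "'w measure \<Rightarrow> 'v measure \<Rightarrow> ('i \<Rightarrow> 'w \<Rightarrow> 'v) \<Rightarrow> 'i set \<Rightarrow> 'w measure" where
  "generated_algebra M N V I =
     vimage_algebra (space M) (\<lambda>\<omega>. \<lambda>i\<in>I. V i \<omega>) (\<Pi>\<^sub>M i\<in>I. N)"

text \<open>\<open>f \<omega>\<close> is a (random) classifier; its error is the conditional probability
  of misclassifying the new pair given the data.\<close>

definition class_error ::
  "'w measure \<Rightarrow> (real ^ 'd) set \<Rightarrow> (nat \<Rightarrow> 'w \<Rightarrow> (real ^ 'd) \<times> nat) \<Rightarrow> nat \<Rightarrow>
   ('w \<Rightarrow> real ^ 'd \<Rightarrow> nat) \<Rightarrow> 'w \<Rightarrow> real" where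
  "class_error M S Z n f =
     real_cond_exp M (generated_algebra M (obs_space S) Z {1..n})
       (\<lambda>\<omega>. of_bool (f \<omega> (fst (Z 0 \<omega>)) \<noteq> snd (Z 0 \<omega>)))"

definition class_risk ::
  "'w measure \<Rightarrow> (real ^ 'd) set \<Rightarrow> (nat \<Rightarrow> 'w \<Rightarrow> (real ^ 'd) \<times> nat) \<Rightarrow> nat \<Rightarrow>
   ('w \<Rightarrow> real ^ 'd \<Rightarrow> nat) \<Rightarrow> real" where
  "class_risk M S Z n f = integral\<^sup>L M (class_error M S Z n f)"

text \<open>The classifier is only ever evaluated at the new point, so it uses the tie-breaking
  variable attached to that point.\<close>

definition knn_classifier ::
  "nat \<Rightarrow> nat \<Rightarrow> (nat \<Rightarrow> 'w \<Rightarrow> (real ^ 'd) \<times> nat) \<Rightarrow> (nat set \<times> nat \<Rightarrow> 'w \<Rightarrow> bool) \<Rightarrow>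
   'w \<Rightarrow> real ^ 'd \<Rightarrow> nat" where
  "knn_classifier k n Z c \<omega> = knn k {1..n} (\<lambda>i. Z i \<omega>) (c ({1..n}, 0) \<omega>)"


section \<open>The two constants\<close>

text \<open>Stone's property, required almost surely for every finite family of independent points
  with law \<open>\<mu>\<close>, under the index tie-breaking of \<^const>\<open>neighbours\<close>.\<close>

definition stone_constant :: "(real ^ 'd) measure \<Rightarrow> real \<Rightarrow> bool" where
  "stone_constant \<mu> \<gamma> \<longleftrightarrow>
     (\<forall>m. AE x in (\<Pi>\<^sub>M i\<in>{1..m}. \<mu>).
        \<forall>k\<ge>1. \<forall>j\<in>{1..m}.
          real (card {i \<in> {1..m} - {j}. j \<in> neighbours k ({1..m} - {i}) x (x i)}) \<le> real k * \<gamma>)"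

definition lq_norm :: "real \<Rightarrow> 'a measure \<Rightarrow> ('a \<Rightarrow> real) \<Rightarrow> real" where
  "lq_norm q M U = (\<integral>\<omega>. \<bar>U \<omega>\<bar> powr q \<partial>M) powr (1 / q)"

text \<open>The generalized Efron-Stein moment inequality with constant \<open>\<kappa>\<close>. The independent variables
  \<open>U\<^sub>1, \<dots>, U\<^sub>N\<close> have arbitrary laws \<open>D 1, \<dots>, D N\<close> and are realised, together with their
  independent copies, on the canonical product space. Type quantification inside a
  proposition being impossible, the type of their values is a parameter. The moment
  assumption keeps the Bochner integrals meaningful.\<close>

definition moment_constant :: "'u itself \<Rightarrow> real \<Rightarrow> bool" where
  "moment_constant _ \<kappa> \<longleftrightarrow> \<kappa> \<le> 1.271 \<and>
     (\<forall>q\<ge>2. \<forall>N. \<forall>(D :: nat \<Rightarrow> 'u measure) f.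
        (\<forall>i. prob_space (D i)) \<longrightarrow>
        (let P = \<Pi>\<^sub>M i\<in>{1..N}. D i in
           f \<in> borel_measurable P \<longrightarrow> integrable P (\<lambda>u. \<bar>f u\<bar> powr q) \<longrightarrow>
           lq_norm q P (\<lambda>u. f u - integral\<^sup>L P f) \<le>
             sqrt (2 * \<kappa> * q) *
             sqrt (lq_norm (q / 2) (P \<Otimes>\<^sub>M P)
                     (\<lambda>(u, u'). \<Sum>i\<in>{1..N}. (f u - f (u(i := u' i)))\<^sup>2))))"

end

theory Submission imports Defs begin

text \<open>Everything rests on the stability of the vote: summed over the points \<open>i\<close> of a training set,
  the expected effect of deleting \<open>i\<close> on the vote at an independent point is at most \<open>sqrt k\<close>.
  Deleting \<open>i\<close> matters only if \<open>i\<close> is one of the \<open>k\<close> nearest points, and then its label is replaced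
  by that of the next nearest one. Given that next point, the \<open>k\<close> labels are i.i.d., so their sum is
  a mixture of binomials, and the expected number of influential points is \<open>k\<close> times the expected
  increment of the majority vote under a binomial law, which central binomial coefficients bound.
  This conditioning needs distances without ties; as the law of the sum of the labels is the same for
  every order used to break ties, the indices may be replaced by independent uniform variables.

  Deleting \<open>p\<close> points one at a time bounds the bias. The estimator is an average of leave-one-out
  estimators on samples of size \<open>n - p + 1\<close>, so its variance is at most that of one of them,
  to which the moment inequality applies. The estimator is compared with \<open>L\<close>
  through the leave-one-out estimator on the whole sample: once \<open>i\<close> and \<open>j\<close> are deleted from all
  training sets, the centred errors at \<open>Z i\<close> and \<open>Z j\<close> are uncorrelated. The tie-breaking variables
  only add a variance of at most \<open>1 / (4 n)\<close>.\<close>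

section \<open>Nearest points with ties broken by a priority\<close>

text \<open>Ties obstruct the conditioning on the next nearest point \<open>b\<close>: with ties
  broken by index, a point at exactly the distance of \<open>b\<close> comes before it or not
  according to its index, so the points before \<open>b\<close> need not be identically distributed.
  If the priority is itself a coordinate of the random point, all of them are confined to one and
  the same set. This is why the order has the priority as a parameter, and why cylinder sets and
  homogeneous bounds in \<open>(a + b) ^ k\<close> occur later. The order \<open>sqrt k\<close>
  arises as \<open>k\<close> influential positions times a jump probability of order
  \<open>1 / sqrt k\<close>. In the variance the effect of one observation is squared: one factor is
  bounded by a multiple of \<open>k * \<gamma>\<close> through Stone's property, the other is
  controlled in mean by \<open>sqrt k\<close>, whence the power 3/2. The stability constant is 1,
  whereas the claim allows \<open>4 / sqrt (2 * pi)\<close>, about 1.59. This margin pays for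
  replacing \<open>n - p + 1\<close> by \<open>n\<close>, which costs at most a factor 1.25.\<close>

definition before :: "(nat \<Rightarrow> 'p::linorder) \<Rightarrow> (nat \<Rightarrow> real) \<Rightarrow> nat \<Rightarrow> nat \<Rightarrow> bool" where
  "before \<pi> r j i \<longleftrightarrow> r j < r i \<or> (r j = r i \<and> \<pi> j < \<pi> i)"

definition nearest :: "(nat \<Rightarrow> 'p::linorder) \<Rightarrow> nat \<Rightarrow> nat set \<Rightarrow> (nat \<Rightarrow> real) \<Rightarrow> nat set" where
  "nearest \<pi> k e r = {i \<in> e. card {j \<in> e. before \<pi> r j i} < k}"

lemma neighbours_eq_nearest:
  "neighbours k e x y = nearest (\<lambda>i. i) k e (\<lambda>i. dist (x i) y)"
  by (simp add: neighbours_def nearest_def before_def)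

lemma before_irrefl: "\<not> before \<pi> r i i"
  by (simp add: before_def)

lemma before_trans: "before \<pi> r i j \<Longrightarrow> before \<pi> r j l \<Longrightarrow> before \<pi> r i l"
  by (auto simp: before_def)

lemma before_total:
  "inj_on \<pi> e \<Longrightarrow> i \<in> e \<Longrightarrow> j \<in> e \<Longrightarrow> i \<noteq> j \<Longrightarrow> before \<pi> r i j \<or> before \<pi> r j i"
  unfolding before_def inj_on_def by (meson linorder_neqE)

lemma nearest_subset: "nearest \<pi> k e r \<subseteq> e"
  by (auto simp: nearest_def)

lemma finite_nearest: "finite e \<Longrightarrow> finite (nearest \<pi> k e r)"
  using nearest_subset finite_subset by metis

lemma rank_mono:
  assumes "finite e" "i \<in> e" "before \<pi> r i j"
  shows "card {l \<in> e. before \<pi> r l i} < card {l \<in> e. before \<pi> r l j}"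
proof (rule psubset_card_mono)
  show "{l \<in> e. before \<pi> r l i} \<subset> {l \<in> e. before \<pi> r l j}"
    using assms before_trans[of \<pi> r _ i j] before_irrefl[of \<pi> r i] by blast
qed (use assms in auto)

text \<open>Totality makes the ranks distinct and irreflexivity keeps them below
  \<open>card e\<close>, so by counting they exhaust \<open>{..<card e}\<close>. In particular every
  rank is taken, which later supplies the pivot.\<close>

lemma rank_bij:
  assumes "finite e" "inj_on \<pi> e"
  shows "bij_betw (\<lambda>i. card {l \<in> e. before \<pi> r l i}) e {..<card e}"
proof -
  have inj: "inj_on (\<lambda>i. card {l \<in> e. before \<pi> r l i}) e"
  proof (rule inj_onI, rule ccontr)
    fix i j assume ij: "i \<in> e" "j \<in> e" "i \<noteq> j"
      and eq: "card {l \<in> e. before \<pi> r l i} = card {l \<in> e. before \<pi> r l j}"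
    from before_total[OF assms(2) ij] consider "before \<pi> r i j" | "before \<pi> r j i" by blast
    then show False
    proof cases
      case 1 then show False using rank_mono[OF assms(1) ij(1), of \<pi> r j] eq by simp
    next
      case 2 then show False using rank_mono[OF assms(1) ij(2), of \<pi> r i] eq by simp
    qed
  qed
  have "(\<lambda>i. card {l \<in> e. before \<pi> r l i}) ` e \<subseteq> {..<card e}"
  proof
    fix x assume "x \<in> (\<lambda>i. card {l \<in> e. before \<pi> r l i}) ` e"
    then obtain i where i: "i \<in> e" "x = card {l \<in> e. before \<pi> r l i}" by blast
    have "{l \<in> e. before \<pi> r l i} \<subset> e" using i before_irrefl[of \<pi> r i] by blast
    then show "x \<in> {..<card e}" using i assms(1) by (simp add: psubset_card_mono)
  qed
  moreover have "card ((\<lambda>i. card {l \<in> e. before \<pi> r l i}) ` e) = card {..<card e}"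
    using card_image[OF inj] by simp
  ultimately have "(\<lambda>i. card {l \<in> e. before \<pi> r l i}) ` e = {..<card e}"
    by (intro card_subset_eq) auto
  then show ?thesis using inj by (simp add: bij_betw_def)
qed

lemma card_nearest:
  assumes "finite e" "inj_on \<pi> e" "k \<le> card e"
  shows "card (nearest \<pi> k e r) = k"
proof -
  have "bij_betw (\<lambda>i. card {l \<in> e. before \<pi> r l i}) (nearest \<pi> k e r) {..<k}"
  proof -
    let ?f = "\<lambda>i. card {l \<in> e. before \<pi> r l i}"
    have b: "inj_on ?f e" "?f ` e = {..<card e}"
      using rank_bij[OF assms(1,2), of r] by (auto simp: bij_betw_def)
    have "?f ` {i \<in> e. ?f i < k} = ?f ` e \<inter> {..<k}" by blast
    also have "\<dots> = {..<k}" unfolding b(2) using assms(3) by auto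
    finally show ?thesis
      using inj_on_subset[OF b(1), of "{i \<in> e. ?f i < k}"] by (auto simp: bij_betw_def nearest_def)
  qed
  from bij_betw_same_card[OF this] show ?thesis by simp
qed

text \<open>A point of the difference has rank exactly \<open>k\<close>, and ranks are distinct.
  \<open>B\<close> is empty when the sample has no further point.\<close>

lemma nearest_Suc:
  assumes "finite e" "inj_on \<pi> e"
  shows "\<exists>B. B \<subseteq> e \<and> card B \<le> 1 \<and> finite B \<and> nearest \<pi> k e r \<inter> B = {} \<and> nearest \<pi> (Suc k) e r = nearest \<pi> k e r \<union> B"
proof (intro exI[of _ "nearest \<pi> (Suc k) e r - nearest \<pi> k e r"] conjI)
  let ?B = "nearest \<pi> (Suc k) e r - nearest \<pi> k e r"
  show "finite ?B" using finite_nearest[OF assms(1)] by blast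
  have "i = j" if "i \<in> ?B" "j \<in> ?B" for i j
  proof -
    have "card {l \<in> e. before \<pi> r l i} = k" "card {l \<in> e. before \<pi> r l j} = k" "i \<in> e" "j \<in> e"
      using that by (auto simp: nearest_def)
    then show ?thesis using rank_bij[OF assms, of r] by (auto simp: bij_betw_def inj_on_def)
  qed
  then show "card ?B \<le> 1" using \<open>finite ?B\<close> by (simp add: card_le_Suc0_iff_eq)
qed (auto simp: nearest_def)

text \<open>Deleting \<open>i\<close> lowers only the ranks of later points, and these exceed the
  rank of \<open>i\<close>, which is at least \<open>k\<close>; a drop by one cannot bring them
  below \<open>k\<close>.\<close>

lemma nearest_remove_far:
  assumes "finite e" "inj_on \<pi> e" "i \<in> e" "i \<notin> nearest \<pi> k e r"
  shows "nearest \<pi> k (e - {i}) r = nearest \<pi> k e r"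
proof -
  have ri: "k \<le> card {l \<in> e. before \<pi> r l i}" using assms by (auto simp: nearest_def)
  have *: "card {l \<in> e - {i}. before \<pi> r l j} < k \<longleftrightarrow> card {l \<in> e. before \<pi> r l j} < k" if "j \<in> e" "j \<noteq> i" for j
  proof (cases "before \<pi> r i j")
    case True
    have "{l \<in> e - {i}. before \<pi> r l j} = {l \<in> e. before \<pi> r l j} - {i}" by auto
    moreover have "i \<in> {l \<in> e. before \<pi> r l j}" using True assms by auto
    ultimately have "card {l \<in> e - {i}. before \<pi> r l j} = card {l \<in> e. before \<pi> r l j} - 1"
      by (simp add: assms(1))
    then show ?thesis using rank_mono[OF assms(1,3) True] ri by linarith
  next
    case False
    then have "{l \<in> e - {i}. before \<pi> r l j} = {l \<in> e. before \<pi> r l j}" by auto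
    then show ?thesis by simp
  qed
  show ?thesis using * assms(4) unfolding nearest_def by auto
qed

text \<open>Points after \<open>i\<close> move up by one, which shifts the threshold from
  \<open>k\<close> to \<open>Suc k\<close>; points before \<open>i\<close> have rank below
  \<open>k\<close> and pass both thresholds.\<close>

lemma nearest_remove_near:
  assumes "finite e" "inj_on \<pi> e" "i \<in> nearest \<pi> k e r"
  shows "nearest \<pi> k (e - {i}) r = nearest \<pi> (Suc k) e r - {i}"
proof -
  have i: "i \<in> e" and ri: "card {l \<in> e. before \<pi> r l i} < k" using assms by (auto simp: nearest_def)
  have *: "card {l \<in> e - {i}. before \<pi> r l j} < k \<longleftrightarrow> card {l \<in> e. before \<pi> r l j} < Suc k" if j: "j \<in> e" "j \<noteq> i" for j
  proof (cases "before \<pi> r i j")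
    case True
    have "{l \<in> e - {i}. before \<pi> r l j} = {l \<in> e. before \<pi> r l j} - {i}" by auto
    moreover have "i \<in> {l \<in> e. before \<pi> r l j}" using True i by auto
    ultimately have "card {l \<in> e - {i}. before \<pi> r l j} = card {l \<in> e. before \<pi> r l j} - 1"
      by (simp add: assms(1))
    then show ?thesis using rank_mono[OF assms(1) i True] by linarith
  next
    case False
    then have "before \<pi> r j i" using before_total[OF assms(2)] i j by metis
    then have "card {l \<in> e. before \<pi> r l j} < k" using rank_mono[OF assms(1) j(1)] ri by fastforce
    moreover have "{l \<in> e - {i}. before \<pi> r l j} = {l \<in> e. before \<pi> r l j}" using False by auto
    ultimately show ?thesis by simp
  qed
  show ?thesis using * unfolding nearest_def by auto
qed

text \<open>Only the order of the priorities enters, not their values or their type. This allows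
  passing between indices and random real priorities.\<close>

lemma nearest_reindex:
  fixes f :: "nat \<Rightarrow> nat"
  assumes "inj_on f e" and "\<And>i j. i \<in> e \<Longrightarrow> j \<in> e \<Longrightarrow> \<pi> (f i) < \<pi> (f j) \<longleftrightarrow> \<rho> i < \<rho> j"
  shows "nearest \<pi> k (f ` e) r = f ` nearest \<rho> k e (\<lambda>i. r (f i))"
proof -
  have b: "before \<pi> r (f j) (f i) \<longleftrightarrow> before \<rho> (\<lambda>i. r (f i)) j i" if "i \<in> e" "j \<in> e" for i j
    using assms(2)[of j i] that by (auto simp: before_def)
  have "card {l \<in> f ` e. before \<pi> r l (f i)} = card {l \<in> e. before \<rho> (\<lambda>i. r (f i)) l i}" if "i \<in> e" for i
  proof -
    have "{l \<in> f ` e. before \<pi> r l (f i)} = f ` {l \<in> e. before \<rho> (\<lambda>i. r (f i)) l i}"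
      using b that by auto
    moreover have "inj_on f {l \<in> e. before \<rho> (\<lambda>i. r (f i)) l i}"
      using assms(1) by (rule inj_on_subset) auto
    ultimately show ?thesis by (simp add: card_image)
  qed
  then show ?thesis unfolding nearest_def by auto
qed

text \<open>The set \<open>A\<close> consists of the \<open>k\<close> nearest points of \<open>e\<close> and \<open>b\<close> is the next one.\<close>

definition pivot_split :: "(nat \<Rightarrow> 'p::linorder) \<Rightarrow> (nat \<Rightarrow> real) \<Rightarrow> nat set \<Rightarrow> nat \<Rightarrow> nat set \<Rightarrow> bool" where
  "pivot_split \<pi> r e b A \<longleftrightarrow>
     (\<forall>a\<in>A. before \<pi> r a b) \<and> (\<forall>c\<in>e - A - {b}. before \<pi> r b c)"

text \<open>The pivot is the point of rank exactly \<open>k\<close>, which exists as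
  \<open>k < card e\<close>.\<close>

lemma pivot_split_exists:
  assumes "finite e" "inj_on \<pi> e" "k < card e"
  shows "\<exists>b\<in>e. pivot_split \<pi> r e b (nearest \<pi> k e r) \<and> b \<notin> nearest \<pi> k e r"
proof -
  obtain b where b: "b \<in> e" "card {l \<in> e. before \<pi> r l b} = k"
    using rank_bij[OF assms(1,2), of r] assms(3)
    by (metis (no_types, lifting) bij_betw_imp_surj_on imageE lessThan_iff)
  have "before \<pi> r a b" if "a \<in> nearest \<pi> k e r" for a
  proof (rule ccontr)
    assume "\<not> before \<pi> r a b"
    moreover have "a \<noteq> b" "a \<in> e" using that b by (auto simp: nearest_def)
    ultimately have "before \<pi> r b a" using before_total[OF assms(2)] b by metis
    then show False using rank_mono[OF assms(1) b(1)] b that by (fastforce simp: nearest_def)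
  qed
  moreover have "before \<pi> r b c" if "c \<in> e" "c \<notin> nearest \<pi> k e r" "c \<noteq> b" for c
  proof (rule ccontr)
    assume "\<not> before \<pi> r b c"
    then have "before \<pi> r c b" using before_total[OF assms(2)] b that by metis
    then show False using rank_mono[OF assms(1) that(1)] b that by (fastforce simp: nearest_def)
  qed
  ultimately show ?thesis using b unfolding pivot_split_def by (auto simp: nearest_def)
qed

text \<open>By transitivity \<open>A\<close> is precisely the set of predecessors of
  \<open>b\<close>, so \<open>b\<close> has rank \<open>k\<close> and the points outside
  \<open>A\<close> have rank at least \<open>k\<close>. Hence the events indexed by pairs
  \<open>(b, A)\<close> exclude each other.\<close>

lemma pivot_split_unique:
  assumes "finite e" "inj_on \<pi> e" "b \<in> e" "A \<subseteq> e - {b}" "card A = k" "pivot_split \<pi> r e b A"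
  shows "A = nearest \<pi> k e r" "card {l \<in> e. before \<pi> r l b} = k"
proof -
  have A: "{l \<in> e. before \<pi> r l b} = A"
    using assms(3,4,6) before_trans[of \<pi> r] before_irrefl[of \<pi> r] unfolding pivot_split_def by blast
  then show rb: "card {l \<in> e. before \<pi> r l b} = k" using assms by simp
  have "card {l \<in> e. before \<pi> r l i} < k \<longleftrightarrow> i \<in> A" if "i \<in> e" for i
  proof -
    consider "i = b" | "i \<in> A" | "i \<in> e - A - {b}" using \<open>i \<in> e\<close> by blast
    then show ?thesis
    proof cases
      case 1 then show ?thesis using rb assms by auto
    next
      case 2
      then have "before \<pi> r i b" using assms unfolding pivot_split_def by blast
      then show ?thesis using rank_mono[OF assms(1) that] 2 rb by fastforce
    next
      case 3
      then have "before \<pi> r b i" using assms unfolding pivot_split_def by blast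
      then show ?thesis using rank_mono[OF assms(1,3)] 3 rb by fastforce
    qed
  qed
  then show "A = nearest \<pi> k e r" using assms(4) unfolding nearest_def by auto
qed

text \<open>The value 1/2 at a tied vote is the mean of the tie-breaking variable. The argument is
  an integer because it is also evaluated at \<open>s - 1\<close> with \<open>s = 0\<close>.\<close>

definition majority :: "nat \<Rightarrow> int \<Rightarrow> real" where
  "majority k s = (if 2 * s > int k then 1 else if 2 * s < int k then 0 else 1/2)"

text \<open>Removing one of the \<open>k\<close> nearest points replaces its label by the label of the next
  point, so it matters only for points whose label differs from that one.\<close>

definition sensitivity :: "nat \<Rightarrow> nat \<Rightarrow> real" where
  "sensitivity k s = real s * (majority k (int s) - majority k (int s - 1)) +
     (real k - real s) * (majority k (int s + 1) - majority k (int s))"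

lemma majority_mono: "s \<le> t \<Longrightarrow> majority k s \<le> majority k t"
  by (auto simp: majority_def)

lemma majority_bounds: "0 \<le> majority k s" "majority k s \<le> 1"
  by (auto simp: majority_def)

definition votes :: "(nat \<Rightarrow> 'p::linorder) \<Rightarrow> nat \<Rightarrow> nat set \<Rightarrow> (nat \<Rightarrow> real) \<Rightarrow> (nat \<Rightarrow> nat) \<Rightarrow> nat" where
  "votes \<pi> k e r y = (\<Sum>i\<in>nearest \<pi> k e r. y i)"

lemma sum_labels_le:
  assumes "finite A" "\<And>i. i \<in> A \<Longrightarrow> y i \<in> {0, 1::nat}"
  shows "sum y A \<le> card A"
  using sum_bounded_above[of A y 1] assms by fastforce

text \<open>Let \<open>t\<close> be the label of the next point. Deleting a near point
  \<open>i\<close> changes the count \<open>s\<close> by \<open>t - y i\<close>: for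
  \<open>t = 0\<close> only the \<open>s\<close> near points labelled 1 matter, for
  \<open>t = 1\<close> only the \<open>k - s\<close> labelled 0. Each case is one summand of
  \<open>sensitivity\<close>, and the other summand is nonnegative. Keeping both removes
  \<open>t\<close>, so that only a function of the count has to be integrated.\<close>

lemma sum_vote_changes_le:
  assumes fin: "finite e" and inj: "inj_on \<pi> e" and k: "k \<le> card e" and y: "\<And>i. i \<in> e \<Longrightarrow> y i \<in> {0, 1}"
  shows "(\<Sum>i\<in>e. \<bar>majority k (votes \<pi> k e r y) - majority k (votes \<pi> k (e - {i}) r y)\<bar>)
           \<le> sensitivity k (votes \<pi> k e r y)"
proof -
  let ?V = "nearest \<pi> k e r" and ?s = "votes \<pi> k e r y"
  obtain B where B: "B \<subseteq> e" "card B \<le> 1" "finite B" "?V \<inter> B = {}" "nearest \<pi> (Suc k) e r = ?V \<union> B"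
    using nearest_Suc[OF fin inj] by blast
  \<comment> \<open>When the \<open>k\<close> nearest points exhaust \<open>e\<close>, nothing
    replaces a deleted label; then \<open>B\<close> is empty and \<open>t = 0\<close> describes this
    correctly.\<close>
  define t where "t = sum y B"
  have t: "t \<in> {0, 1}"
  proof -
    have "t \<le> 1" using sum_labels_le[of B y] B y unfolding t_def by force
    then show ?thesis by auto
  qed
  have V: "?V \<subseteq> e" "finite ?V" "card ?V = k"
    by (rule nearest_subset, rule finite_nearest[OF fin], rule card_nearest[OF fin inj k])
  have far: "votes \<pi> k (e - {i}) r y = ?s" if "i \<in> e - ?V" for i
    using nearest_remove_far[OF fin inj, of i k r] that by (simp add: votes_def)
  have near: "int (votes \<pi> k (e - {i}) r y) = int ?s + int t - int (y i)" if i: "i \<in> ?V" for i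
  proof -
    have "votes \<pi> k (e - {i}) r y = sum y ((?V \<union> B) - {i})"
      using nearest_remove_near[OF fin inj i] B(5) by (simp add: votes_def)
    moreover have "sum y (?V \<union> B) = ?s + t"
      unfolding votes_def t_def using V B by (intro sum.union_disjoint) auto
    moreover have "sum y (?V \<union> B) = y i + sum y ((?V \<union> B) - {i})"
      using i V B by (intro sum.remove) auto
    ultimately show ?thesis by linarith
  qed
  define V1 where "V1 = {i \<in> ?V. y i = 1}"
  have y1: "?s = card V1"
  proof -
    have "?s = (\<Sum>i\<in>?V. if y i = 1 then 1 else 0)"
      unfolding votes_def using V y by (intro sum.cong) auto
    also have "\<dots> = card V1" unfolding V1_def card_eq_sum by (rule sum.inter_filter[symmetric, OF V(2)])
    finally show ?thesis .
  qed
  have V1: "V1 \<subseteq> ?V" "finite V1" using V(2) by (auto simp: V1_def)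
  have sk: "?s \<le> k" using y1 V V1 card_mono by metis
  have c0: "card (?V - V1) = k - ?s" using V1 V y1 by (simp add: card_Diff_subset)
  have "(\<Sum>i\<in>e. \<bar>majority k ?s - majority k (votes \<pi> k (e - {i}) r y)\<bar>)
      = (\<Sum>i\<in>?V. \<bar>majority k ?s - majority k (votes \<pi> k (e - {i}) r y)\<bar>)"
    using far V(1) fin by (intro sum.mono_neutral_right) auto
  also have "\<dots> = (\<Sum>i\<in>?V. \<bar>majority k ?s - majority k (int ?s + int t - int (y i))\<bar>)"
    using near by simp
  also have "\<dots> = (\<Sum>i\<in>V1. \<bar>majority k ?s - majority k (int ?s + int t - int (y i))\<bar>)
      + (\<Sum>i\<in>?V - V1. \<bar>majority k ?s - majority k (int ?s + int t - int (y i))\<bar>)"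
    using V(2) V1 by (subst sum.subset_diff[of V1]) auto
  also have "(\<Sum>i\<in>V1. \<bar>majority k ?s - majority k (int ?s + int t - int (y i))\<bar>) = (\<Sum>i\<in>V1. \<bar>majority k ?s - majority k (int ?s + int t - 1)\<bar>)"
    by (intro sum.cong) (auto simp: V1_def)
  also have "(\<Sum>i\<in>?V - V1. \<bar>majority k ?s - majority k (int ?s + int t - int (y i))\<bar>) = (\<Sum>i\<in>?V-V1. \<bar>majority k ?s - majority k (int ?s + int t)\<bar>)"
  proof (intro sum.cong refl)
    fix i assume "i \<in> ?V - V1"
    then have "y i = 0" using y[of i] V(1) by (auto simp: V1_def)
    then show "\<bar>majority k ?s - majority k (int ?s + int t - int (y i))\<bar> = \<bar>majority k ?s - majority k (int ?s + int t)\<bar>"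
      by simp
  qed
  also have "(\<Sum>i\<in>V1. \<bar>majority k ?s - majority k (int ?s + int t - 1)\<bar>) + (\<Sum>i\<in>?V-V1. \<bar>majority k ?s - majority k (int ?s + int t)\<bar>)
     = real ?s * \<bar>majority k ?s - majority k (int ?s + int t - 1)\<bar> + (real k - real ?s) * \<bar>majority k ?s - majority k (int ?s + int t)\<bar>"
    using y1 c0 sk by (simp add: of_nat_diff)
  also have "\<dots> \<le> sensitivity k ?s"
  proof -
    have m: "majority k (int ?s - 1) \<le> majority k (int ?s)" "majority k (int ?s) \<le> majority k (int ?s + 1)"
      by (auto intro: majority_mono)
    from t consider "t = 0" | "t = 1" by blast
    then show ?thesis
    proof cases
      case 1
      have "\<bar>majority k ?s - majority k (int ?s - 1)\<bar> = majority k ?s - majority k (int ?s - 1)"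
        using m by simp
      moreover have "0 \<le> (real k - real ?s) * (majority k (int ?s + 1) - majority k (int ?s))"
        using m sk by (intro mult_nonneg_nonneg) auto
      ultimately show ?thesis by (simp add: 1 sensitivity_def)
    next
      case 2
      have "\<bar>majority k ?s - majority k (int ?s + 1)\<bar> = majority k (int ?s + 1) - majority k ?s"
        using m by simp
      moreover have "0 \<le> real ?s * (majority k (int ?s) - majority k (int ?s - 1))"
        using m by (intro mult_nonneg_nonneg) auto
      ultimately show ?thesis by (simp add: 2 sensitivity_def)
    qed
  qed
  finally show ?thesis .
qed

section \<open>A binomial bound for the sensitivity of the majority vote\<close>

lemma central_binomial_Suc:
  "real (Suc l) * real ((2 * l + 2) choose (Suc l)) = 2 * (2 * real l + 1) * real ((2 * l) choose l)"
proof -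
  have a: "Suc l * ((2*l+2) choose Suc l) = (2*l+2) * ((2*l+1) choose l)"
    using Suc_times_binomial_eq[of "2*l+1" l] by (simp add: mult.commute)
  have b: "Suc l * ((2*l+1) choose Suc l) = (2*l+1) * ((2*l) choose l)"
    using Suc_times_binomial_eq[of "2*l" l] by (simp add: mult.commute)
  have c: "(2*l+1) choose l = (2*l+1) choose Suc l"
    using binomial_symmetric[of l "2*l+1"] by simp
  have "real (Suc l * ((2*l+2) choose Suc l)) = 2 * real (Suc l * ((2*l+1) choose Suc l))"
    unfolding a c by (simp add: algebra_simps)
  then show ?thesis unfolding b by (simp only: of_nat_mult) (simp add: algebra_simps)
qed

text \<open>Squared, the claim passes from \<open>l\<close> to \<open>l + 1\<close> because
  \<open>(2 * l + 1) * (2 * l + 3)\<close> is one less than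
  \<open>(2 * l + 2)\<^sup>2\<close>.\<close>

lemma central_binomial_le: "real ((2 * l) choose l) * sqrt (2 * real l + 1) \<le> 4 ^ l"
proof -
  have "(real ((2 * l) choose l))\<^sup>2 * (2 * real l + 1) \<le> (4 ^ l)\<^sup>2"
  proof (induction l)
    case (Suc l)
    let ?c = "real ((2 * l) choose l)" and ?d = "real ((2 * Suc l) choose Suc l)"
    have d: "real (Suc l) * ?d = 2 * (2 * real l + 1) * ?c" using central_binomial_Suc[of l] by simp
    have "(real (Suc l))\<^sup>2 * (?d\<^sup>2 * (2 * real (Suc l) + 1)) = (real (Suc l) * ?d)\<^sup>2 * (2 * real l + 3)"
      by (simp add: power_mult_distrib)
    also have "\<dots> = (4 * (2 * real l + 1) * (2 * real l + 3)) * (?c\<^sup>2 * (2 * real l + 1))"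
      unfolding d by (simp add: power2_eq_square algebra_simps)
    also have "\<dots> \<le> (16 * (real (Suc l))\<^sup>2) * (4 ^ l)\<^sup>2"
    proof (rule mult_mono)
      show "4 * (2 * real l + 1) * (2 * real l + 3) \<le> 16 * (real (Suc l))\<^sup>2"
        by (simp add: power2_eq_square algebra_simps)
    qed (use Suc.IH in auto)
    also have "\<dots> = (real (Suc l))\<^sup>2 * (4 ^ Suc l)\<^sup>2" by (simp add: power2_eq_square)
    finally show ?case by (simp del: of_nat_Suc)
  qed simp
  then have "(real ((2 * l) choose l) * sqrt (2 * real l + 1))\<^sup>2 \<le> (4 ^ l)\<^sup>2"
    by (simp add: power_mult_distrib)
  then show ?thesis by (rule power2_le_imp_le) simp
qed

lemma mult_le_quarter_square: "4 * (a * b) \<le> (a + b)\<^sup>2" for a b :: real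
  using zero_le_power2[of "a - b"] by (simp add: power2_eq_square algebra_simps)

text \<open>For \<open>a + b = 1\<close> the sum is the expected increment of the vote under a
  binomial law with \<open>j\<close> trials. The vote jumps only in the middle, so one or two
  central terms survive, and \<open>4 * (a * b) \<le> (a + b)\<^sup>2\<close> reduces them to a
  central binomial coefficient.\<close>

lemma majority_step_sum_le:
  fixes a b :: real
  assumes "a \<ge> 0" "b \<ge> 0"
  shows "real (Suc j) * (\<Sum>s\<le>j. real (j choose s) * (majority (Suc j) (int s + 1) - majority (Suc j) (int s)) * a ^ s * b ^ (j - s))
     \<le> sqrt (real (Suc j)) * (a + b) ^ j"
proof -
  define D where "D = (\<Sum>s\<le>j. real (j choose s) * (majority (Suc j) (int s + 1) - majority (Suc j) (int s)) * a ^ s * b ^ (j - s))"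
  \<comment> \<open>Half of \<open>k = Suc j\<close>, rounded down: both parities of
    \<open>k\<close> then lead to the same coefficient \<open>(2 * l) choose l\<close>.\<close>
  define l where "l = Suc j div 2"
  have ab: "4 ^ i * (a * b) ^ i \<le> (a + b) ^ (2 * i)" for i
    using power_mono[OF mult_le_quarter_square[of a b], of i] assms
    by (simp add: power_mult_distrib power_mult)
  have D: "4 ^ l * D \<le> real ((2*l) choose l) * (a + b) ^ j"
  proof (cases "even j")
    case True
    then have j: "j = 2 * l" by (auto simp: l_def)
    have "D = (\<Sum>s\<le>j. if s = l then real (j choose l) * a ^ l * b ^ (j - l) else 0)"
      unfolding D_def by (intro sum.cong) (auto simp: majority_def j)
    also have "\<dots> = real ((2*l) choose l) * (a * b) ^ l"
      by (simp add: j power_mult_distrib)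
    finally have "4 ^ l * D = real ((2*l) choose l) * (4 ^ l * (a * b) ^ l)" by simp
    then show ?thesis using ab[of l] by (simp add: j mult_left_mono)
  next
    case False
    then obtain i where i: "j = 2 * i + 1" by (auto elim: oddE)
    then have l: "l = Suc i" by (simp add: l_def)
    have sym: "(2*i+1) choose (Suc i) = (2*i+1) choose i"
      using binomial_symmetric[of i "2*i+1"] by simp
    have c: "real ((2*l) choose l) = 2 * real ((2*i+1) choose i)"
      unfolding l using sym by simp
    \<comment> \<open>For even \<open>k\<close> the vote passes through the value 1/2, so there are
      two half jumps; together they restore the missing factor \<open>a + b\<close>.\<close>
    have "D = (\<Sum>s\<le>j. (if s = i then 1/2 * real ((2*i+1) choose i) * a ^ i * b ^ (i+1) else 0) + (if s = Suc i then 1/2 * real ((2*i+1) choose i) * a ^ (i+1) * b ^ i else 0))"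
      unfolding D_def using sym by (intro sum.cong) (auto simp: majority_def i)
    also have "\<dots> = 1/2 * real ((2*i+1) choose i) * a ^ i * b ^ (i+1) + 1/2 * real ((2*i+1) choose i) * a ^ (i+1) * b ^ i"
      by (simp add: sum.distrib i)
    also have "\<dots> = 1/2 * real ((2*i+1) choose i) * ((a * b) ^ i * (a + b))"
      by (simp add: power_mult_distrib algebra_simps)
    finally have "4 ^ l * D = real ((2*l) choose l) * ((4 ^ i * (a * b) ^ i) * (a + b))"
      unfolding c by (simp add: l mult_ac)
    also have "\<dots> \<le> real ((2*l) choose l) * ((a + b) ^ (2 * i) * (a + b))"
      using ab[of i] assms by (intro mult_left_mono mult_right_mono) auto
    finally show ?thesis by (simp add: i mult.commute)
  qed
  have kl: "real (Suc j) \<le> 2 * real l + 1" unfolding l_def by linarith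
  have "4 ^ l * (real (Suc j) * D) \<le> real (Suc j) * (real ((2*l) choose l) * (a + b) ^ j)"
    using mult_left_mono[OF D, of "real (Suc j)"] by (simp add: mult_ac)
  also have "\<dots> = sqrt (real (Suc j)) * sqrt (real (Suc j)) * (real ((2*l) choose l) * (a + b) ^ j)"
    by simp
  also have "\<dots> \<le> sqrt (real (Suc j)) * sqrt (2 * real l + 1) * (real ((2*l) choose l) * (a + b) ^ j)"
    using kl assms by (intro mult_right_mono mult_left_mono) auto
  also have "\<dots> = sqrt (real (Suc j)) * (a + b) ^ j * (real ((2*l) choose l) * sqrt (2 * real l + 1))"
    by simp
  also have "\<dots> \<le> sqrt (real (Suc j)) * (a + b) ^ j * 4 ^ l"
    using central_binomial_le assms by (intro mult_left_mono) auto
  finally show ?thesis unfolding D_def by (simp add: mult_ac)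
qed

text \<open>The absorption identities \<open>s * (k choose s) = k * ((k - 1) choose (s - 1))\<close>
  and \<open>(k - s) * (k choose s) = k * ((k - 1) choose s)\<close> turn the two summands of
  \<open>sensitivity\<close> into \<open>k * a * D\<close> and \<open>k * b * D\<close>. The bound
  is homogeneous rather than normalised to \<open>a + b = 1\<close> because \<open>a\<close> and
  \<open>b\<close> will be the masses of the two labels within a set whose probability may be less
  than 1.\<close>

lemma sensitivity_binomial_le:
  fixes a b :: real
  assumes "a \<ge> 0" "b \<ge> 0" "k \<ge> 1"
  shows "(\<Sum>s\<le>k. real (k choose s) * sensitivity k s * a ^ s * b ^ (k - s)) \<le> sqrt (real k) * (a + b) ^ k"
proof -
  obtain j where k: "k = Suc j" using assms(3) by (cases k) auto
  define d where "d s = majority k (int s + 1) - majority k (int s)" for s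
  define D where "D = (\<Sum>s\<le>j. real (j choose s) * d s * a ^ s * b ^ (j - s))"
  have 1: "(\<Sum>s\<le>k. real (k choose s) * (real s * (majority k (int s) - majority k (int s - 1))) * a ^ s * b ^ (k - s)) = real k * a * D"
  proof -
    have "(\<Sum>s\<le>k. real (k choose s) * (real s * (majority k (int s) - majority k (int s - 1))) * a ^ s * b ^ (k - s))
       = (\<Sum>s\<le>j. real (Suc s * (Suc j choose Suc s)) * d s * a ^ Suc s * b ^ (j - s))"
      unfolding k of_nat_mult
      by (subst sum.atMost_Suc_shift) (auto intro!: sum.cong simp: d_def k mult_ac add.commute simp del: binomial_Suc_Suc)
    also have "\<dots> = (\<Sum>s\<le>j. real k * a * (real (j choose s) * d s * a ^ s * b ^ (j - s)))"
      unfolding Suc_times_binomial k of_nat_mult by (intro sum.cong) (auto simp del: of_nat_Suc)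
    finally show ?thesis by (simp add: D_def sum_distrib_left)
  qed
  have 2: "(\<Sum>s\<le>k. real (k choose s) * ((real k - real s) * d s) * a ^ s * b ^ (k - s)) = real k * b * D"
  proof -
    have "(\<Sum>s\<le>k. real (k choose s) * ((real k - real s) * d s) * a ^ s * b ^ (k - s))
       = (\<Sum>s\<le>j. real (k choose s) * ((real k - real s) * d s) * a ^ s * b ^ (k - s))"
      by (simp add: k)
    also have "\<dots> = (\<Sum>s\<le>j. real k * b * (real (j choose s) * d s * a ^ s * b ^ (j - s)))"
    proof (intro sum.cong refl)
      fix s assume s: "s \<in> {..j}"
      have "real ((k - s) * (k choose s)) = real (k * (j choose s))"
        using binomial_absorb_comp[of k s] k by simp
      then have "real (k - s) * real (k choose s) = real k * real (j choose s)"
        unfolding of_nat_mult .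
      moreover have "real (k - s) = real k - real s" using s k by (simp add: of_nat_diff)
      ultimately have "real (k choose s) * (real k - real s) = real k * real (j choose s)"
        by (simp add: mult.commute)
      then have "real (k choose s) * ((real k - real s) * d s) * a ^ s * b ^ (k - s) = real k * real (j choose s) * d s * a ^ s * b ^ (k - s)"
        by (metis mult.assoc)
      moreover have "b ^ (k - s) = b * b ^ (j - s)" using s k by (simp add: Suc_diff_le)
      ultimately show "real (k choose s) * ((real k - real s) * d s) * a ^ s * b ^ (k - s) = real k * b * (real (j choose s) * d s * a ^ s * b ^ (j - s))"
        by (simp only: mult_ac)
    qed
    finally show ?thesis by (simp add: D_def sum_distrib_left)
  qed
  have "(\<Sum>s\<le>k. real (k choose s) * sensitivity k s * a ^ s * b ^ (k - s)) = real k * a * D + real k * b * D"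
    unfolding 1[symmetric] 2[symmetric] sum.distrib[symmetric]
    by (intro sum.cong) (auto simp: sensitivity_def d_def algebra_simps)
  also have "\<dots> = (a + b) * (real k * D)" by (simp add: algebra_simps)
  also have "\<dots> \<le> (a + b) * (sqrt (real k) * (a + b) ^ j)"
    using majority_step_sum_le[OF assms(1,2), of j] assms unfolding D_def d_def k by (intro mult_left_mono) auto
  finally show ?thesis by (simp add: k mult_ac)
qed

section \<open>Resampling and reindexing in product measures\<close>

lemma (in prob_space) integrable_bounded:
  fixes f :: "'a \<Rightarrow> real"
  assumes "f \<in> borel_measurable M" "\<And>x. x \<in> space M \<Longrightarrow> \<bar>f x\<bar> \<le> c"
  shows "integrable M f"
  using assms by (intro integrable_const_bound[where B = c] AE_I2) auto

lemma (in prob_space) prob_space_PiM_const: "prob_space (PiM I (\<lambda>_. M))"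
  by (intro prob_space_PiM prob_space_axioms)

text \<open>A coordinate is integrated out by overwriting it with an independent copy, which
  preserves the product law. The index set thus stays fixed and may be infinite; equality is checked
  on finite-dimensional cylinders.\<close>

lemma (in prob_space) resample_distr:
  assumes i: "i \<in> I"
  shows "distr (PiM I (\<lambda>_. M) \<Otimes>\<^sub>M M) (PiM I (\<lambda>_. M)) (\<lambda>(z, v). z(i := v)) = PiM I (\<lambda>_. M)"
    (is "?L = ?P")
proof (rule measure_eqI_PiM_infinite[symmetric, OF refl])
  interpret P: prob_space ?P by (rule prob_space_PiM_const)
  show "finite_measure ?P" by unfold_locales
  have meas: "(\<lambda>(z, v). z(i := v)) \<in> measurable (?P \<Otimes>\<^sub>M M) ?P"
    using measurable_add_dim[of i I "\<lambda>_. M"] i by (simp add: insert_absorb)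
  fix A J assume J: "finite J" "J \<subseteq> I" and A: "\<And>j. j \<in> J \<Longrightarrow> A j \<in> sets M"
  let ?X = "prod_emb I (\<lambda>_. M) J (Pi\<^sub>E J A)"
  have "?P ?X = (\<Prod>j\<in>J. M (A j))"
    using J A by (intro emeasure_PiM_emb prob_space_axioms) auto
  \<comment> \<open>If \<open>i\<close> is not among the constrained coordinates, the fresh value
    ranges over the whole space, of mass 1.\<close>
  also have "\<dots> = (\<Prod>j\<in>J - {i}. M (A j)) * M (if i \<in> J then A i else space M)"
    using prod.remove[of J i "\<lambda>j. M (A j)"] J emeasure_space_1
    by (cases "i \<in> J") (auto simp: mult.commute)
  also have "(\<Prod>j\<in>J - {i}. M (A j)) = ?P (prod_emb I (\<lambda>_. M) (J - {i}) (Pi\<^sub>E (J - {i}) A))"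
    using J A by (intro emeasure_PiM_emb[symmetric] prob_space_axioms) auto
  also have "\<dots> * M (if i \<in> J then A i else space M) =
      (?P \<Otimes>\<^sub>M M) (prod_emb I (\<lambda>_. M) (J - {i}) (Pi\<^sub>E (J - {i}) A) \<times> (if i \<in> J then A i else space M))"
    using J A by (intro emeasure_pair_measure_Times[symmetric] sets_PiM_I) auto
  also have "prod_emb I (\<lambda>_. M) (J - {i}) (Pi\<^sub>E (J - {i}) A) \<times> (if i \<in> J then A i else space M)
      = (\<lambda>(z, v). z(i := v)) -` ?X \<inter> space (?P \<Otimes>\<^sub>M M)" (is "?S = ?T")
  proof (rule set_eqI)
    fix w :: "('b \<Rightarrow> 'a) \<times> 'a"
    obtain z v where w: "w = (z, v)" by (cases w)
    have Ai: "i \<in> J \<Longrightarrow> v \<in> A i \<Longrightarrow> v \<in> space M" using A[of i, THEN sets.sets_into_space] by auto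
    have 1: "(z, v) \<in> ?S \<longleftrightarrow> z \<in> space ?P \<and> v \<in> space M \<and> (\<forall>j\<in>J - {i}. z j \<in> A j) \<and> (i \<in> J \<longrightarrow> v \<in> A i)"
      using Ai by (auto simp: prod_emb_def space_PiM PiE_iff restrict_def extensional_def)
    have 2: "z \<in> space ?P \<Longrightarrow> v \<in> space M \<Longrightarrow> z(i := v) \<in> space ?P"
      using i by (auto simp: space_PiM PiE_iff extensional_def)
    have 3: "(z, v) \<in> ?T \<longleftrightarrow> z \<in> space ?P \<and> v \<in> space M \<and> (\<forall>j\<in>J. (z(i := v)) j \<in> A j)"
      using 2 i by (auto simp: prod_emb_def space_pair_measure space_PiM PiE_iff restrict_def extensional_def)
    have 4: "(\<forall>j\<in>J. (z(i := v)) j \<in> A j) \<longleftrightarrow> (\<forall>j\<in>J - {i}. z j \<in> A j) \<and> (i \<in> J \<longrightarrow> v \<in> A i)"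
      by auto
    show "w \<in> ?S \<longleftrightarrow> w \<in> ?T" unfolding w 1 3 4 by blast
  qed
  finally show "?P ?X = ?L ?X"
    using J A meas by (simp add: emeasure_distr)
qed simp

lemma (in prob_space) measurable_resample:
  "i \<in> I \<Longrightarrow> (\<lambda>(z, v). z(i := v)) \<in> measurable (PiM I (\<lambda>_. M) \<Otimes>\<^sub>M M) (PiM I (\<lambda>_. M))"
  using measurable_add_dim[of i I "\<lambda>_. M"] by (simp add: insert_absorb)

text \<open>Fubini for the overwritten coordinate. The second equation integrates the fresh value
  first, which averages out a test point; the third fixes it, which makes a pivot or a test point
  deterministic. Boundedness supplies the integrability.\<close>

lemma (in prob_space) resample_integral:
  fixes F :: "('i \<Rightarrow> 'a) \<Rightarrow> real"
  assumes i: "i \<in> I" and F: "F \<in> borel_measurable (PiM I (\<lambda>_. M))"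
    and bd: "\<And>z. z \<in> space (PiM I (\<lambda>_. M)) \<Longrightarrow> \<bar>F z\<bar> \<le> c"
  shows "(\<integral>z. F z \<partial>PiM I (\<lambda>_. M)) = (\<integral>w. F ((fst w)(i := snd w)) \<partial>(PiM I (\<lambda>_. M) \<Otimes>\<^sub>M M))"
    and "(\<integral>z. F z \<partial>PiM I (\<lambda>_. M)) = (\<integral>z. (\<integral>v. F (z(i := v)) \<partial>M) \<partial>PiM I (\<lambda>_. M))"
    and "(\<integral>z. F z \<partial>PiM I (\<lambda>_. M)) = (\<integral>v. (\<integral>z. F (z(i := v)) \<partial>PiM I (\<lambda>_. M)) \<partial>M)"
    and "integrable (PiM I (\<lambda>_. M)) (\<lambda>z. \<integral>v. F (z(i := v)) \<partial>M)"
    and "integrable M (\<lambda>v. \<integral>z. F (z(i := v)) \<partial>PiM I (\<lambda>_. M))"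
proof -
  let ?P = "PiM I (\<lambda>_. M)"
  interpret P: prob_space ?P by (rule prob_space_PiM_const)
  interpret PM: pair_prob_space ?P M by unfold_locales
  note m = measurable_resample[OF i]
  have "(\<integral>z. F z \<partial>?P) = (\<integral>z. F z \<partial>distr (?P \<Otimes>\<^sub>M M) ?P (\<lambda>(z, v). z(i := v)))"
    using resample_distr[OF i] by simp
  also have "\<dots> = (\<integral>w. F ((\<lambda>(z, v). z(i := v)) w) \<partial>(?P \<Otimes>\<^sub>M M))"
    by (rule integral_distr[OF m F])
  finally show eq: "(\<integral>z. F z \<partial>?P) = (\<integral>w. F ((fst w)(i := snd w)) \<partial>(?P \<Otimes>\<^sub>M M))"
    by (simp add: case_prod_unfold)
  have Fm: "(\<lambda>w. F ((fst w)(i := snd w))) \<in> borel_measurable (?P \<Otimes>\<^sub>M M)"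
    using measurable_compose[OF m F] by (simp add: case_prod_unfold)
  have "integrable (?P \<Otimes>\<^sub>M M) (\<lambda>w. F ((fst w)(i := snd w)))"
    using Fm measurable_space[OF m] by (intro PM.integrable_bounded[where c = c] bd) (auto simp: case_prod_unfold)
  then have int: "integrable (?P \<Otimes>\<^sub>M M) (\<lambda>(z, v). F (z(i := v)))" by (simp add: case_prod_unfold)
  show "(\<integral>z. F z \<partial>?P) = (\<integral>z. (\<integral>v. F (z(i := v)) \<partial>M) \<partial>?P)"
    unfolding eq using PM.integral_fst[OF int] by (simp add: case_prod_unfold)
  show "(\<integral>z. F z \<partial>?P) = (\<integral>v. (\<integral>z. F (z(i := v)) \<partial>?P) \<partial>M)"
    unfolding eq using PM.integral_snd[OF int] by (simp add: case_prod_unfold)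
  show "integrable ?P (\<lambda>z. \<integral>v. F (z(i := v)) \<partial>M)"
    using PM.integrable_fst[OF int] .
  show "integrable M (\<lambda>v. \<integral>z. F (z(i := v)) \<partial>?P)"
    using PM.integrable_snd[OF int] .
qed

lemma (in prob_space) resample_AE:
  assumes i: "i \<in> I" and ae: "AE z in PiM I (\<lambda>_. M). Q z"
  shows "AE w in PiM I (\<lambda>_. M) \<Otimes>\<^sub>M M. Q ((fst w)(i := snd w))"
proof -
  have "AE z in distr (PiM I (\<lambda>_. M) \<Otimes>\<^sub>M M) (PiM I (\<lambda>_. M)) (\<lambda>(z, v). z(i := v)). Q z"
    unfolding resample_distr[OF i] by (rule ae)
  from AE_distrD[OF measurable_resample[OF i] this] show ?thesis by (simp add: case_prod_unfold)
qed

lemma (in prob_space) reindex_integral: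
  fixes F :: "('i \<Rightarrow> 'a) \<Rightarrow> real"
  assumes "inj_on f I" "f \<in> I \<rightarrow> K" "F \<in> borel_measurable (PiM I (\<lambda>_. M))"
  shows "(\<integral>z. F (\<lambda>n\<in>I. z (f n)) \<partial>PiM K (\<lambda>_. M)) = (\<integral>z. F z \<partial>PiM I (\<lambda>_. M))"
proof -
  have m: "(\<lambda>z. \<lambda>n\<in>I. z (f n)) \<in> measurable (PiM K (\<lambda>_. M)) (PiM I (\<lambda>_. M))"
    using assms(2) by (intro measurable_restrict measurable_component_singleton) auto
  have "(\<integral>z. F z \<partial>PiM I (\<lambda>_. M)) = (\<integral>z. F z \<partial>distr (PiM K (\<lambda>_. M)) (PiM I (\<lambda>_. M)) (\<lambda>z. \<lambda>n\<in>I. z (f n)))"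
    using distr_PiM_reindex[of K "\<lambda>_. M" f I] assms prob_space_axioms by simp
  also have "\<dots> = (\<integral>z. F (\<lambda>n\<in>I. z (f n)) \<partial>PiM K (\<lambda>_. M))"
    by (rule integral_distr[OF m assms(3)])
  finally show ?thesis by simp
qed

text \<open>Attaching independent priorities to i.i.d. points yields i.i.d. pairs. The sets
  \<open>A i\<close> need not be rectangles, so \<open>u\<close> is fixed first: the integral over
  the points factorises over the sections of the \<open>A i\<close>, and the result factorises again
  over \<open>u\<close>.\<close>

lemma zip_distr:
  assumes "prob_space N" "prob_space U" "finite e"
  shows "distr (PiM e (\<lambda>_. U) \<Otimes>\<^sub>M PiM e (\<lambda>_. N)) (PiM e (\<lambda>_. N \<Otimes>\<^sub>M U)) (\<lambda>(u, z). \<lambda>i\<in>e. (z i, u i))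
     = PiM e (\<lambda>_. N \<Otimes>\<^sub>M U)" (is "?L = _")
proof -
  interpret N: prob_space N by fact
  interpret U: prob_space U by fact
  interpret NU: pair_prob_space N U by unfold_locales
  interpret N': product_prob_space "\<lambda>_. N" UNIV by unfold_locales
  interpret U': product_prob_space "\<lambda>_. U" UNIV by unfold_locales
  interpret NU': product_prob_space "\<lambda>_. N \<Otimes>\<^sub>M U" UNIV by unfold_locales
  interpret NI: prob_space "PiM e (\<lambda>_. N)" by (rule N.prob_space_PiM_const)
  interpret UI: prob_space "PiM e (\<lambda>_. U)" by (rule U.prob_space_PiM_const)
  interpret UN: pair_prob_space U N by unfold_locales
  have m: "(\<lambda>(u, z). \<lambda>i\<in>e. (z i, u i)) \<in> measurable (PiM e (\<lambda>_. U) \<Otimes>\<^sub>M PiM e (\<lambda>_. N)) (PiM e (\<lambda>_. N \<Otimes>\<^sub>M U))"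
    unfolding case_prod_unfold
    by (intro measurable_restrict measurable_Pair) (auto intro!: measurable_compose[OF measurable_snd] measurable_compose[OF measurable_fst] measurable_component_singleton)
  show ?thesis
  proof (rule NU'.PiM_eqI[OF assms(3)])
    fix A assume A: "\<And>i. i \<in> e \<Longrightarrow> A i \<in> sets (N \<Otimes>\<^sub>M U)"
    have B: "Pi\<^sub>E e A \<in> sets (PiM e (\<lambda>_. N \<Otimes>\<^sub>M U))" using A assms(3) by (intro sets_PiM_I_finite) auto
    have Am: "(\<lambda>x. indicator (A i) (x, v) :: ennreal) \<in> borel_measurable N" if "i \<in> e" "v \<in> space U" for i v
      using A[OF that(1)] that(2) by measurable
    have Am2: "(\<lambda>v. \<integral>\<^sup>+x. indicator (A i) (x, v) \<partial>N) \<in> borel_measurable U" if "i \<in> e" for i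
      using A[OF that] by measurable
    have "emeasure ?L (Pi\<^sub>E e A) = (\<integral>\<^sup>+w. indicator (Pi\<^sub>E e A) w \<partial>?L)"
      using B by simp
    also have "\<dots> = (\<integral>\<^sup>+w. indicator (Pi\<^sub>E e A) (case w of (u, z) \<Rightarrow> \<lambda>i\<in>e. (z i, u i)) \<partial>(PiM e (\<lambda>_. U) \<Otimes>\<^sub>M PiM e (\<lambda>_. N)))"
      using B by (subst nn_integral_distr[OF m]) auto
    also have "\<dots> = (\<integral>\<^sup>+w. (\<Prod>i\<in>e. indicator (A i) (snd w i, fst w i)) \<partial>(PiM e (\<lambda>_. U) \<Otimes>\<^sub>M PiM e (\<lambda>_. N)))"
      using assms(3) by (intro nn_integral_cong) (auto simp: indicator_def PiE_iff split: prod.split)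
    also have "\<dots> = (\<integral>\<^sup>+u. \<integral>\<^sup>+z. (\<Prod>i\<in>e. indicator (A i) (z i, u i)) \<partial>PiM e (\<lambda>_. N) \<partial>PiM e (\<lambda>_. U))"
    proof (subst NI.nn_integral_fst[symmetric])
      have "(\<lambda>w. indicator (A i) (snd w i, fst w i) :: ennreal) \<in> borel_measurable (PiM e (\<lambda>_. U) \<Otimes>\<^sub>M PiM e (\<lambda>_. N))" if "i \<in> e" for i
      proof (rule measurable_compose[where g = "indicator (A i)" and N = "N \<Otimes>\<^sub>M U"])
        show "(\<lambda>w. (snd w i, fst w i)) \<in> PiM e (\<lambda>_. U) \<Otimes>\<^sub>M PiM e (\<lambda>_. N) \<rightarrow>\<^sub>M N \<Otimes>\<^sub>M U"
          using that by (intro measurable_Pair) (auto intro!: measurable_compose[OF measurable_snd] measurable_compose[OF measurable_fst] measurable_component_singleton)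
      qed (use A[OF that] in auto)
      then show "(\<lambda>w. \<Prod>i\<in>e. indicator (A i) (snd w i, fst w i) :: ennreal) \<in> borel_measurable (PiM e (\<lambda>_. U) \<Otimes>\<^sub>M PiM e (\<lambda>_. N))"
        by (intro borel_measurable_prod_ennreal) auto
    qed simp
    also have "\<dots> = (\<integral>\<^sup>+u. (\<Prod>i\<in>e. \<integral>\<^sup>+x. indicator (A i) (x, u i) \<partial>N) \<partial>PiM e (\<lambda>_. U))"
    proof (rule nn_integral_cong)
      fix u assume u: "u \<in> space (PiM e (\<lambda>_. U))"
      show "(\<integral>\<^sup>+z. (\<Prod>i\<in>e. indicator (A i) (z i, u i)) \<partial>PiM e (\<lambda>_. N)) = (\<Prod>i\<in>e. \<integral>\<^sup>+x. indicator (A i) (x, u i) \<partial>N)"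
        using u by (intro N'.product_nn_integral_prod[OF assms(3)] Am) (auto simp: space_PiM)
    qed
    also have "\<dots> = (\<Prod>i\<in>e. \<integral>\<^sup>+v. \<integral>\<^sup>+x. indicator (A i) (x, v) \<partial>N \<partial>U)"
      by (intro U'.product_nn_integral_prod[OF assms(3)] Am2)
    also have "\<dots> = (\<Prod>i\<in>e. emeasure (N \<Otimes>\<^sub>M U) (A i))"
    proof (intro prod.cong refl)
      fix i assume i: "i \<in> e"
      have "(\<integral>\<^sup>+v. \<integral>\<^sup>+x. indicator (A i) (x, v) \<partial>N \<partial>U) = (\<integral>\<^sup>+w. indicator (A i) w \<partial>(N \<Otimes>\<^sub>M U))"
        using A[OF i] by (intro NU.nn_integral_snd) auto
      then show "(\<integral>\<^sup>+v. \<integral>\<^sup>+x. indicator (A i) (x, v) \<partial>N \<partial>U) = emeasure (N \<Otimes>\<^sub>M U) (A i)"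
        using A[OF i] by simp
    qed
    finally show "emeasure ?L (Pi\<^sub>E e A) = (\<Prod>i\<in>e. emeasure (N \<Otimes>\<^sub>M U) (A i))" .
  qed simp
qed

section \<open>The vote of the nearest points of a random sample\<close>

lemma borel_measurable_of_bool:
  "Measurable.pred M P \<Longrightarrow> (\<lambda>x. of_bool (P x) :: real) \<in> borel_measurable M"
  unfolding of_bool_def by measurable

lemma measurable_before:
  assumes "\<And>i. i \<in> e \<Longrightarrow> (\<lambda>x. W x i :: real) \<in> borel_measurable M"
    and "\<And>i. i \<in> e \<Longrightarrow> (\<lambda>x. R x i) \<in> borel_measurable M"
    and "i \<in> e" "j \<in> e"
  shows "Measurable.pred M (\<lambda>x. before (W x) (R x) j i)"
proof -
  note [measurable] = assms(1)[OF assms(3)] assms(1)[OF assms(4)] assms(2)[OF assms(3)] assms(2)[OF assms(4)]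
  show ?thesis unfolding before_def by measurable
qed

text \<open>Ranks are written as sums of indicators of \<open>before\<close>, so that measurability
  reduces to comparing finitely many real functions.\<close>

lemma measurable_votes:
  assumes "finite e"
    and "\<And>i. i \<in> e \<Longrightarrow> (\<lambda>x. W x i :: real) \<in> borel_measurable M"
    and "\<And>i. i \<in> e \<Longrightarrow> (\<lambda>x. R x i) \<in> borel_measurable M"
    and "\<And>i. i \<in> e \<Longrightarrow> (\<lambda>x. Y x i) \<in> measurable M (count_space UNIV)"
  shows "(\<lambda>x. votes (W x) k e (R x) (Y x)) \<in> measurable M (count_space UNIV)"
proof -
  have eq: "votes (W x) k e (R x) (Y x) =
      (\<Sum>i\<in>e. if (\<Sum>j\<in>e. if before (W x) (R x) j i then 1 else 0) < k then Y x i else 0)" for x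
  proof -
    have "card {j \<in> e. before (W x) (R x) j i} = (\<Sum>j\<in>e. if before (W x) (R x) j i then 1 else 0)" for i
      unfolding card_eq_sum by (rule sum.inter_filter[OF assms(1)])
    then show ?thesis unfolding votes_def nearest_def
      by (simp add: sum.inter_filter[OF assms(1)])
  qed
  have c: "(\<lambda>x. \<Sum>j\<in>e. if before (W x) (R x) j i then 1 else (0::nat)) \<in> measurable M (count_space UNIV)" if "i \<in> e" for i
    using measurable_before[OF assms(2,3) that]
    by (intro measurable_sum_nat) (auto intro!: measurable_If)
  have "Measurable.pred M (\<lambda>x. (\<Sum>j\<in>e. if before (W x) (R x) j i then 1 else 0) < k)" if "i \<in> e" for i
    using measurable_compose[OF c[OF that], of "\<lambda>n. n < k" "count_space UNIV"] by simp
  then show ?thesis unfolding eq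
    using assms(4) by (intro measurable_sum_nat measurable_If) auto
qed

lemma measurable_pivot_split:
  assumes "finite e" "b \<in> e" "A \<subseteq> e"
    and W: "\<And>i. i \<in> e \<Longrightarrow> (\<lambda>x. W x i :: real) \<in> borel_measurable M"
    and R: "\<And>i. i \<in> e \<Longrightarrow> (\<lambda>x. R x i) \<in> borel_measurable M"
  shows "Measurable.pred M (\<lambda>x. pivot_split (W x) (R x) e b A)"
proof -
  have "finite A" using assms finite_subset by blast
  then show ?thesis unfolding pivot_split_def using assms(1-3)
    by (intro pred_intros_logic pred_intros_finite measurable_before[where e = e, OF W R]) auto
qed

section \<open>The sum of the labels as a mixture of binomials\<close>

lemma sum_Pow_card:
  fixes h :: "nat \<Rightarrow> real"
  assumes "finite A"
  shows "(\<Sum>B\<in>Pow A. h (card B)) = (\<Sum>s\<le>card A. real (card A choose s) * h s)"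
proof -
  have "(\<Sum>B\<in>Pow A. h (card B)) = (\<Sum>s\<le>card A. \<Sum>B\<in>{B \<in> Pow A. card B = s}. h (card B))"
    using assms by (intro sum.group[symmetric]) (auto intro: card_mono)
  also have "\<dots> = (\<Sum>s\<le>card A. real (card {B. B \<subseteq> A \<and> card B = s}) * h s)"
    by (intro sum.cong) auto
  finally show ?thesis by (simp add: n_subsets[OF assms])
qed

context prob_space
begin

text \<open>The points of \<open>A\<close> are confined to \<open>C\<close>, those of
  \<open>R\<close> to \<open>D\<close>, the others are free. Splitting by the set \<open>A'\<close>
  of points labelled 1 gives the weight
  \<open>\<alpha> ^ card A' * \<beta> ^ (card A - card A')\<close>, where \<open>\<alpha>\<close>
  and \<open>\<beta>\<close> are the masses of the labels 1 and 0 in \<open>C\<close>. The binomial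
  hypothesis then applies, and \<open>\<alpha> + \<beta>\<close> is the probability of
  \<open>C\<close>.\<close>

lemma cylinder_votes_le:
  fixes \<psi> :: "nat \<Rightarrow> real" and y :: "'a \<Rightarrow> nat"
  assumes fin: "finite e" and A: "A \<subseteq> e" and R: "R \<subseteq> e" and AR: "A \<inter> R = {}"
    and C: "C \<in> events" and D: "D \<in> events"
    and y: "y \<in> measurable M (count_space UNIV)" and y01: "\<And>x. x \<in> space M \<Longrightarrow> y x \<in> {0, 1}"
    and B: "\<And>a b. a \<ge> 0 \<Longrightarrow> b \<ge> 0 \<Longrightarrow> (\<Sum>s\<le>card A. real (card A choose s) * \<psi> s * a ^ s * b ^ (card A - s)) \<le> B * (a + b) ^ card A"
  shows "(\<integral>z. ((\<Prod>a\<in>A. indicator C (z a)) * (\<Prod>c\<in>R. indicator D (z c))) * \<psi> (\<Sum>a\<in>A. y (z a)) \<partial>PiM e (\<lambda>_. M))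
    \<le> B * (\<integral>z. ((\<Prod>a\<in>A. indicator C (z a)) * (\<Prod>c\<in>R. indicator D (z c))) \<partial>PiM e (\<lambda>_. M))"
proof -
  interpret P: product_prob_space "\<lambda>_. M" UNIV by unfold_locales
  interpret PE: prob_space "PiM e (\<lambda>_. M)" by (rule prob_space_PiM_const)
  have finA: "finite A" "finite R" using A R fin finite_subset by auto
  define Y where "Y t = y -` {t} \<inter> space M" for t :: nat
  have Ym: "Y t \<in> events" for t unfolding Y_def using measurable_sets[OF y, of "{t}"] by simp
  define \<alpha> \<beta> \<delta> where "\<alpha> = prob (C \<inter> Y 1)" and "\<beta> = prob (C \<inter> Y 0)" and "\<delta> = prob D"
  have Cd: "prob C = \<alpha> + \<beta>"
  proof -
    have "C = (C \<inter> Y 1) \<union> (C \<inter> Y 0)" using sets.sets_into_space[OF C] y01 by (auto simp: Y_def)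
    then have "prob C = prob ((C \<inter> Y 1) \<union> (C \<inter> Y 0))" by simp
    also have "\<dots> = \<alpha> + \<beta>" unfolding \<alpha>_def \<beta>_def
      using C Ym by (intro finite_measure_Union) (auto simp: Y_def)
    finally show ?thesis .
  qed
  \<comment> \<open>These boxes serve twice: with labels prescribed on \<open>A\<close> for the
    expansion, and with \<open>S = S' = C\<close> for the right-hand side.\<close>
  define E where
    "E A' S S' i = (if i \<in> A' then S else if i \<in> A then S' else if i \<in> R then D else space M)" for A' S S' i
  have Pi: "(\<Prod>a\<in>A'. indicator S (z a)) * (\<Prod>a\<in>A - A'. indicator S' (z a)) * (\<Prod>c\<in>R. indicator D (z c)) = (\<Prod>i\<in>e. indicator (E A' S S' i) (z i) :: real)"
    if "A' \<subseteq> A" "z \<in> space (PiM e (\<lambda>_. M))" for A' S S' z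
  proof -
    have "(\<Prod>i\<in>e. indicator (E A' S S' i) (z i) :: real) = (\<Prod>i\<in>A \<union> R. indicator (E A' S S' i) (z i))"
      using fin A R that by (intro prod.mono_neutral_right) (auto simp: E_def space_PiM PiE_iff)
    also have "\<dots> = (\<Prod>i\<in>A. indicator (E A' S S' i) (z i)) * (\<Prod>i\<in>R. indicator (E A' S S' i) (z i))"
      using finA AR by (rule prod.union_disjoint)
    also have "(\<Prod>i\<in>A. indicator (E A' S S' i) (z i) :: real) = (\<Prod>i\<in>A - A'. indicator (E A' S S' i) (z i)) * (\<Prod>i\<in>A'. indicator (E A' S S' i) (z i))"
      using that finA by (intro prod.subset_diff) auto
    also have "(\<Prod>i\<in>A'. indicator (E A' S S' i) (z i) :: real) = (\<Prod>a\<in>A'. indicator S (z a))"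
      by (intro prod.cong) (auto simp: E_def)
    also have "(\<Prod>i\<in>A - A'. indicator (E A' S S' i) (z i) :: real) = (\<Prod>a\<in>A - A'. indicator S' (z a))"
      by (intro prod.cong) (auto simp: E_def)
    also have "(\<Prod>i\<in>R. indicator (E A' S S' i) (z i) :: real) = (\<Prod>c\<in>R. indicator D (z c))"
      using AR that by (intro prod.cong) (auto simp: E_def)
    finally show ?thesis by (simp add: mult_ac)
  qed
  have Em: "E A' S S' i \<in> events" if "S \<in> events" "S' \<in> events" for A' S S' i
    using that D by (auto simp: E_def)
  have IntE: "integrable (PiM e (\<lambda>_. M)) (\<lambda>z. (\<Prod>i\<in>e. indicator (E A' S S' i) (z i) :: real))"
     "(\<integral>z. (\<Prod>i\<in>e. indicator (E A' S S' i) (z i) :: real) \<partial>PiM e (\<lambda>_. M)) = prob S ^ card A' * prob S' ^ (card A - card A') * \<delta> ^ card R"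
    if "S \<in> events" "S' \<in> events" "A' \<subseteq> A" for A' S S'
  proof -
    show "integrable (PiM e (\<lambda>_. M)) (\<lambda>z. (\<Prod>i\<in>e. indicator (E A' S S' i) (z i) :: real))"
      using Em[OF that(1,2)] fin by (intro P.product_integrable_prod integrable_real_indicator) (auto simp: less_top[symmetric])
    have "(\<integral>z. (\<Prod>i\<in>e. indicator (E A' S S' i) (z i) :: real) \<partial>PiM e (\<lambda>_. M)) = (\<Prod>i\<in>e. prob (E A' S S' i))"
      using Em[OF that(1,2)] fin
      by (subst P.product_integral_prod) (auto intro!: prod.cong integrable_real_indicator simp: less_top[symmetric])
    also have "\<dots> = (\<Prod>i\<in>A \<union> R. prob (E A' S S' i))"
      using fin A R that by (intro prod.mono_neutral_right) (auto simp: E_def prob_space)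
    also have "\<dots> = (\<Prod>i\<in>A. prob (E A' S S' i)) * (\<Prod>i\<in>R. prob (E A' S S' i))"
      using finA AR by (rule prod.union_disjoint)
    also have "(\<Prod>i\<in>A. prob (E A' S S' i)) = (\<Prod>i\<in>A - A'. prob (E A' S S' i)) * (\<Prod>i\<in>A'. prob (E A' S S' i))"
      using that finA by (intro prod.subset_diff) auto
    also have "(\<Prod>i\<in>A'. prob (E A' S S' i)) = (\<Prod>a\<in>A'. prob S)"
      by (intro prod.cong) (auto simp: E_def)
    also have "(\<Prod>i\<in>A - A'. prob (E A' S S' i)) = (\<Prod>a\<in>A - A'. prob S')"
      by (intro prod.cong) (auto simp: E_def)
    also have "(\<Prod>i\<in>R. prob (E A' S S' i)) = (\<Prod>c\<in>R. \<delta>)"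
      using AR that by (intro prod.cong) (auto simp: E_def \<delta>_def)
    finally show "(\<integral>z. (\<Prod>i\<in>e. indicator (E A' S S' i) (z i) :: real) \<partial>PiM e (\<lambda>_. M)) = prob S ^ card A' * prob S' ^ (card A - card A') * \<delta> ^ card R"
      using that finA finite_subset[OF that(3)] by (simp add: card_Diff_subset)
  qed
  \<comment> \<open>Only the subset \<open>A0\<close> of points actually labelled 1 can give a
    nonzero product.\<close>
  have expand: "((\<Prod>a\<in>A. indicator C (z a)) * (\<Prod>c\<in>R. indicator D (z c))) * \<psi> (\<Sum>a\<in>A. y (z a))
     = (\<Sum>A'\<in>Pow A. \<psi> (card A') * (\<Prod>i\<in>e. indicator (E A' (C \<inter> Y 1) (C \<inter> Y 0) i) (z i)))"
    if z: "z \<in> space (PiM e (\<lambda>_. M))" for z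
  proof -
    define A0 where "A0 = {a \<in> A. y (z a) = 1}"
    have zs: "z a \<in> space M" "y (z a) \<in> {0, 1}" if "a \<in> A" for a
      using z y01[of "z a"] that A by (auto simp: space_PiM)
    have A0: "A0 \<in> Pow A" by (auto simp: A0_def)
    have sy: "(\<Sum>a\<in>A. y (z a)) = card A0"
    proof -
      have "(\<Sum>a\<in>A. y (z a)) = (\<Sum>a\<in>A. if y (z a) = 1 then 1 else 0)"
        using zs(2) by (intro sum.cong) auto
      then show ?thesis unfolding A0_def card_eq_sum by (simp only: sum.inter_filter[OF finA(1)])
    qed
    have zero: "(\<Prod>a\<in>A'. indicator (C \<inter> Y 1) (z a)) * (\<Prod>a\<in>A - A'. indicator (C \<inter> Y 0) (z a)) = (0::real)"
      if A': "A' \<in> Pow A - {A0}" for A'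
    proof -
      have finA': "finite A'" "finite (A - A')" using A' finA finite_subset by auto
      from A' consider a where "a \<in> A'" "a \<notin> A0" | a where "a \<in> A0" "a \<notin> A'" by blast
      then show ?thesis
      proof cases
        case 1
        then have "indicator (C \<inter> Y 1) (z a) = (0::real)" using A' by (auto simp: A0_def Y_def)
        then have "(\<Prod>a\<in>A'. indicator (C \<inter> Y 1) (z a)) = (0::real)" using finA' 1 by (intro prod_zero) auto
        then show ?thesis by simp
      next
        case 2
        then have "indicator (C \<inter> Y 0) (z a) = (0::real)" by (auto simp: A0_def Y_def)
        then have "(\<Prod>a\<in>A - A'. indicator (C \<inter> Y 0) (z a)) = (0::real)" using finA' 2 A0 by (intro prod_zero) auto
        then show ?thesis by simp
      qed
    qed
    have one: "(\<Prod>a\<in>A0. indicator (C \<inter> Y 1) (z a)) * (\<Prod>a\<in>A - A0. indicator (C \<inter> Y 0) (z a)) = (\<Prod>a\<in>A. indicator C (z a) :: real)"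
    proof -
      have "(\<Prod>a\<in>A0. indicator (C \<inter> Y 1) (z a)) = (\<Prod>a\<in>A0. indicator C (z a) :: real)"
        using zs by (intro prod.cong) (auto simp: A0_def Y_def indicator_def)
      moreover have "(\<Prod>a\<in>A - A0. indicator (C \<inter> Y 0) (z a)) = (\<Prod>a\<in>A - A0. indicator C (z a) :: real)"
        using zs by (intro prod.cong) (auto simp: A0_def Y_def indicator_def)
      moreover have "(\<Prod>a\<in>A. indicator C (z a) :: real) = (\<Prod>a\<in>A - A0. indicator C (z a)) * (\<Prod>a\<in>A0. indicator C (z a))"
        using A0 finA by (intro prod.subset_diff) auto
      ultimately show ?thesis by (simp add: mult.commute)
    qed
    have "(\<Sum>A'\<in>Pow A. \<psi> (card A') * (\<Prod>i\<in>e. indicator (E A' (C \<inter> Y 1) (C \<inter> Y 0) i) (z i)))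
      = (\<Sum>A'\<in>Pow A. \<psi> (card A') * ((\<Prod>a\<in>A'. indicator (C \<inter> Y 1) (z a)) * (\<Prod>a\<in>A - A'. indicator (C \<inter> Y 0) (z a)) * (\<Prod>c\<in>R. indicator D (z c))))"
      using Pi[OF _ z] by (intro sum.cong) auto
    also have "\<dots> = (\<Sum>A'\<in>{A0}. \<psi> (card A') * ((\<Prod>a\<in>A'. indicator (C \<inter> Y 1) (z a)) * (\<Prod>a\<in>A - A'. indicator (C \<inter> Y 0) (z a)) * (\<Prod>c\<in>R. indicator D (z c))))"
      using A0 zero finA by (intro sum.mono_neutral_right) auto
    also have "\<dots> = ((\<Prod>a\<in>A. indicator C (z a)) * (\<Prod>c\<in>R. indicator D (z c))) * \<psi> (\<Sum>a\<in>A. y (z a))"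
      using one by (simp add: sy)
    finally show ?thesis by simp
  qed
  have CY: "C \<inter> Y 1 \<in> events" "C \<inter> Y 0 \<in> events" using C Ym by auto
  have "(\<integral>z. ((\<Prod>a\<in>A. indicator C (z a)) * (\<Prod>c\<in>R. indicator D (z c))) * \<psi> (\<Sum>a\<in>A. y (z a)) \<partial>PiM e (\<lambda>_. M))
     = (\<integral>z. (\<Sum>A'\<in>Pow A. \<psi> (card A') * (\<Prod>i\<in>e. indicator (E A' (C \<inter> Y 1) (C \<inter> Y 0) i) (z i))) \<partial>PiM e (\<lambda>_. M))"
    using expand by (intro Bochner_Integration.integral_cong) auto
  also have "\<dots> = (\<Sum>A'\<in>Pow A. \<psi> (card A') * (\<alpha> ^ card A' * \<beta> ^ (card A - card A') * \<delta> ^ card R))"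
    using IntE[OF CY] by (subst Bochner_Integration.integral_sum) (auto simp: \<alpha>_def \<beta>_def intro!: sum.cong)
  also have "\<dots> = (\<Sum>s\<le>card A. real (card A choose s) * (\<psi> s * (\<alpha> ^ s * \<beta> ^ (card A - s) * \<delta> ^ card R)))"
    by (rule sum_Pow_card[OF finA(1)])
  also have "\<dots> = (\<Sum>s\<le>card A. real (card A choose s) * \<psi> s * \<alpha> ^ s * \<beta> ^ (card A - s)) * \<delta> ^ card R"
    unfolding sum_distrib_right by (intro sum.cong) (auto simp: mult_ac)
  also have "\<dots> \<le> (B * (\<alpha> + \<beta>) ^ card A) * \<delta> ^ card R"
    by (intro mult_right_mono B) (auto simp: \<alpha>_def \<beta>_def \<delta>_def)
  also have "\<dots> = B * (\<integral>z. (\<Prod>i\<in>e. indicator (E A C C i) (z i) :: real) \<partial>PiM e (\<lambda>_. M))"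
    using IntE(2)[OF C C, of A] Cd by simp
  also have "(\<integral>z. (\<Prod>i\<in>e. indicator (E A C C i) (z i) :: real) \<partial>PiM e (\<lambda>_. M)) = (\<integral>z. ((\<Prod>a\<in>A. indicator C (z a)) * (\<Prod>c\<in>R. indicator D (z c))) \<partial>PiM e (\<lambda>_. M))"
    using Pi[of A _ C C] by (intro Bochner_Integration.integral_cong) auto
  finally show ?thesis .
qed

text \<open>Almost surely exactly one pair of a pivot \<open>b\<close> and a set \<open>A\<close> of
  \<open>k\<close> points before it is realised. Fixing the value at \<open>b\<close> turns this
  event into a cylinder, because the priority \<open>w\<close> is a function of the point, so that
  all points of \<open>A\<close> obey the same condition. Each pair contributes at most
  \<open>B\<close> times its probability, and the probabilities sum to at most 1.\<close>

lemma pivot_votes_le: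
  fixes \<psi> :: "nat \<Rightarrow> real" and y :: "'a \<Rightarrow> nat" and r w :: "'a \<Rightarrow> real"
  assumes fin: "finite e" and k: "k < card e"
    and r: "r \<in> borel_measurable M" and w: "w \<in> borel_measurable M"
    and y: "y \<in> measurable M (count_space UNIV)" and y01: "\<And>x. x \<in> space M \<Longrightarrow> y x \<in> {0, 1}"
    and inj: "AE z in PiM e (\<lambda>_. M). inj_on (\<lambda>i. w (z i)) e"
    and \<psi>: "\<And>s. \<psi> s \<ge> 0"
    and B: "\<And>a b. a \<ge> 0 \<Longrightarrow> b \<ge> 0 \<Longrightarrow> (\<Sum>s\<le>k. real (k choose s) * \<psi> s * a ^ s * b ^ (k - s)) \<le> B * (a + b) ^ k"
  shows "(\<integral>z. \<psi> (votes (\<lambda>i. w (z i)) k e (\<lambda>i. r (z i)) (\<lambda>i. y (z i))) \<partial>PiM e (\<lambda>_. M)) \<le> B"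
proof -
  let ?P = "PiM e (\<lambda>_. M)"
  interpret PE: prob_space ?P by (rule prob_space_PiM_const)
  define F where "F b A z = (of_bool (pivot_split (\<lambda>i. w (z i)) (\<lambda>i. r (z i)) e b A) :: real)" for b A and z :: "nat \<Rightarrow> 'a"
  define G where "G b A z = F b A z * \<psi> (\<Sum>a\<in>A. y (z a))" for b A and z :: "nat \<Rightarrow> 'a"
  define \<A> where "\<A> b = {A. A \<subseteq> e - {b} \<and> card A = k}" for b
  have fin\<A>: "finite (\<A> b)" for b unfolding \<A>_def using fin by (auto intro: rev_finite_subset[of "Pow e"])
  have wm: "(\<lambda>z. w (z i)) \<in> borel_measurable ?P" and rm: "(\<lambda>z. r (z i)) \<in> borel_measurable ?P"
    and ym: "(\<lambda>z. y (z i)) \<in> measurable ?P (count_space UNIV)" if "i \<in> e" for i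
    by (rule measurable_compose[OF measurable_component_singleton[OF that]], fact)+
  define c where "c = (\<Sum>s\<le>card e. \<psi> s)"
  have \<psi>c: "\<psi> s \<le> c" if "s \<le> card e" for s
    unfolding c_def using that \<psi> by (intro member_le_sum) auto
  have c0: "0 \<le> c" using \<psi>c[of 0] \<psi>[of 0] by linarith
  have lab: "y (z i) \<in> {0, 1}" if "z \<in> space ?P" "i \<in> e" for z i
    using y01[of "z i"] that by (auto simp: space_PiM PiE_iff)
  have sumle: "(\<Sum>a\<in>A. y (z a)) \<le> card e" if "z \<in> space ?P" "A \<subseteq> e" for z A
  proof -
    have "(\<Sum>a\<in>A. y (z a)) \<le> card A"
      using lab[OF that(1)] that(2) fin finite_subset by (intro sum_labels_le) auto
    then show ?thesis using card_mono[OF fin that(2)] by linarith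
  qed
  have Fm: "F b A \<in> borel_measurable ?P" if "b \<in> e" "A \<in> \<A> b" for b A
    unfolding F_def using that fin wm rm
    by (intro borel_measurable_of_bool measurable_pivot_split) (auto simp: \<A>_def)
  have Sm: "(\<lambda>z. \<psi> (\<Sum>a\<in>A. y (z a))) \<in> borel_measurable ?P" if "A \<in> \<A> b" for b A
  proof -
    have "(\<lambda>z. \<Sum>a\<in>A. y (z a)) \<in> measurable ?P (count_space UNIV)"
      using that ym by (intro measurable_sum_nat) (auto simp: \<A>_def)
    then show ?thesis by (rule measurable_compose) (rule borel_measurable_count_space)
  qed
  have Gm: "G b A \<in> borel_measurable ?P" if "b \<in> e" "A \<in> \<A> b" for b A
    unfolding G_def using Fm[OF that] Sm[OF that(2)] by simp
  have Fb: "\<bar>F b A z\<bar> \<le> 1" for b A z by (simp add: F_def)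
  have Gb: "\<bar>G b A z\<bar> \<le> c" if "A \<in> \<A> b" "z \<in> space ?P" for b A z
    using \<psi>c[OF sumle[OF that(2)], of A] that(1) \<psi>[of "\<Sum>a\<in>A. y (z a)"] c0 by (auto simp: G_def F_def \<A>_def)
  have Fi: "integrable ?P (F b A)" and Gi: "integrable ?P (G b A)" if "b \<in> e" "A \<in> \<A> b" for b A
    using PE.integrable_bounded[OF Fm[OF that] Fb] PE.integrable_bounded[OF Gm[OF that] Gb[OF that(2)]] by auto
  have Vm: "(\<lambda>z. \<psi> (votes (\<lambda>i. w (z i)) k e (\<lambda>i. r (z i)) (\<lambda>i. y (z i)))) \<in> borel_measurable ?P"
    by (rule measurable_compose[OF measurable_votes[OF fin] borel_measurable_count_space]) (use wm rm ym in auto)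
  have Vle: "votes (\<lambda>i. w (z i)) k e (\<lambda>i. r (z i)) (\<lambda>i. y (z i)) \<le> card e" if "z \<in> space ?P" for z
    unfolding votes_def by (intro sumle[OF that] nearest_subset)
  have Vi: "integrable ?P (\<lambda>z. \<psi> (votes (\<lambda>i. w (z i)) k e (\<lambda>i. r (z i)) (\<lambda>i. y (z i))))"
    using \<psi>c[OF Vle] \<psi> by (intro PE.integrable_bounded[OF Vm, of c]) auto
  have key: "(\<integral>z. G b A z \<partial>?P) \<le> B * (\<integral>z. F b A z \<partial>?P)" if b: "b \<in> e" and A: "A \<in> \<A> b" for b A
  proof -
    have A': "A \<subseteq> e - {b}" "card A = k" using A by (auto simp: \<A>_def)
    define C where "C v = {x \<in> space M. r x < r v \<or> (r x = r v \<and> w x < w v)}" for v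
    define D where "D v = {x \<in> space M. r v < r x \<or> (r v = r x \<and> w v < w x)}" for v
    have CD: "C v \<in> events" "D v \<in> events" for v unfolding C_def D_def using r w by measurable
    have FI: "F b A (z(b := v)) = (\<Prod>a\<in>A. indicator (C v) (z a)) * (\<Prod>c\<in>e - A - {b}. indicator (D v) (z c))"
      if z: "z \<in> space ?P" for z v
    proof -
      have zs: "z i \<in> space M" if "i \<in> e" for i using z that by (auto simp: space_PiM PiE_iff)
      have "(\<Prod>a\<in>A. indicator (C v) (z a) :: real) = of_bool (\<forall>a\<in>A. z a \<in> C v)"
        using finite_subset[OF A'(1)] fin by (auto simp: indicator_def)
      moreover have "(\<Prod>c\<in>e - A - {b}. indicator (D v) (z c) :: real) = of_bool (\<forall>c\<in>e - A - {b}. z c \<in> D v)"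
        using fin by (auto simp: indicator_def)
      moreover have "(\<forall>a\<in>A. before (\<lambda>i. w ((z(b := v)) i)) (\<lambda>i. r ((z(b := v)) i)) a b) \<longleftrightarrow> (\<forall>a\<in>A. z a \<in> C v)"
        using A'(1) zs by (intro ball_cong) (auto simp: before_def C_def)
      moreover have "(\<forall>c\<in>e - A - {b}. before (\<lambda>i. w ((z(b := v)) i)) (\<lambda>i. r ((z(b := v)) i)) b c) \<longleftrightarrow> (\<forall>c\<in>e - A - {b}. z c \<in> D v)"
        using zs by (intro ball_cong) (auto simp: before_def D_def)
      ultimately show ?thesis unfolding F_def pivot_split_def by simp
    qed
    have GI: "G b A (z(b := v)) = F b A (z(b := v)) * \<psi> (\<Sum>a\<in>A. y (z a))" for z v
    proof -
      have "(\<Sum>a\<in>A. y ((z(b := v)) a)) = (\<Sum>a\<in>A. y (z a))" using A'(1) by (intro sum.cong) auto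
      then show ?thesis by (simp add: G_def)
    qed
    have inner: "(\<integral>z. G b A (z(b := v)) \<partial>?P) \<le> B * (\<integral>z. F b A (z(b := v)) \<partial>?P)" for v
    proof -
      have "(\<integral>z. G b A (z(b := v)) \<partial>?P) = (\<integral>z. ((\<Prod>a\<in>A. indicator (C v) (z a)) * (\<Prod>c\<in>e - A - {b}. indicator (D v) (z c))) * \<psi> (\<Sum>a\<in>A. y (z a)) \<partial>?P)"
        by (intro Bochner_Integration.integral_cong) (auto simp: GI FI)
      also have "\<dots> \<le> B * (\<integral>z. ((\<Prod>a\<in>A. indicator (C v) (z a)) * (\<Prod>c\<in>e - A - {b}. indicator (D v) (z c))) \<partial>?P)"
        using A' B by (intro cylinder_votes_le[OF fin _ _ _ CD y y01]) auto
      also have "(\<integral>z. ((\<Prod>a\<in>A. indicator (C v) (z a)) * (\<Prod>c\<in>e - A - {b}. indicator (D v) (z c))) \<partial>?P) = (\<integral>z. F b A (z(b := v)) \<partial>?P)"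
        by (intro Bochner_Integration.integral_cong) (auto simp: FI)
      finally show ?thesis .
    qed
    note rG = resample_integral[OF b Gm[OF b A] Gb[OF A]] and rF = resample_integral[OF b Fm[OF b A] Fb]
    have "(\<integral>z. G b A z \<partial>?P) = (\<integral>v. (\<integral>z. G b A (z(b := v)) \<partial>?P) \<partial>M)" by (rule rG(3))
    also have "\<dots> \<le> (\<integral>v. B * (\<integral>z. F b A (z(b := v)) \<partial>?P) \<partial>M)"
      using rG(5) rF(5) inner by (intro integral_mono) auto
    also have "\<dots> = B * (\<integral>z. F b A z \<partial>?P)" using rF(3) by simp
    finally show ?thesis .
  qed
  \<comment> \<open>At \<open>a = 1\<close> and \<open>b = 0\<close> the binomial hypothesis bounds
    \<open>B\<close> from below by a sum of nonnegative terms.\<close>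
  have B0: "0 \<le> B" using B[of 1 0] \<psi>[of k] sum_nonneg[of "{..k}" "\<lambda>s. real (k choose s) * \<psi> s * 1 ^ s * 0 ^ (k - s)"] \<psi> by simp
  have "(\<integral>z. \<psi> (votes (\<lambda>i. w (z i)) k e (\<lambda>i. r (z i)) (\<lambda>i. y (z i))) \<partial>?P) \<le> (\<integral>z. (\<Sum>b\<in>e. \<Sum>A\<in>\<A> b. G b A z) \<partial>?P)"
  proof (rule integral_mono_AE[OF Vi])
    show "integrable ?P (\<lambda>z. \<Sum>b\<in>e. \<Sum>A\<in>\<A> b. G b A z)" using Gi by (intro Bochner_Integration.integrable_sum) auto
    show "AE z in ?P. \<psi> (votes (\<lambda>i. w (z i)) k e (\<lambda>i. r (z i)) (\<lambda>i. y (z i))) \<le> (\<Sum>b\<in>e. \<Sum>A\<in>\<A> b. G b A z)"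
      using inj
    proof eventually_elim
      case (elim z)
      let ?V = "nearest (\<lambda>i. w (z i)) k e (\<lambda>i. r (z i))"
      obtain b where b: "b \<in> e" "pivot_split (\<lambda>i. w (z i)) (\<lambda>i. r (z i)) e b ?V" "b \<notin> ?V"
        using pivot_split_exists[OF fin elim k] by blast
      have V: "?V \<in> \<A> b" using card_nearest[OF fin elim, of k] k b(3) nearest_subset unfolding \<A>_def by fastforce
      have nn: "0 \<le> G b A z" for b A by (simp add: G_def F_def \<psi>)
      have "\<psi> (votes (\<lambda>i. w (z i)) k e (\<lambda>i. r (z i)) (\<lambda>i. y (z i))) = G b ?V z"
        using b by (simp add: G_def F_def votes_def)
      also have "\<dots> \<le> (\<Sum>A\<in>\<A> b. G b A z)" using V fin\<A> nn by (intro member_le_sum) auto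
      also have "\<dots> \<le> (\<Sum>b\<in>e. \<Sum>A\<in>\<A> b. G b A z)"
        using b fin nn by (intro member_le_sum[of b e "\<lambda>b. \<Sum>A\<in>\<A> b. G b A z"] sum_nonneg) auto
      finally show ?case .
    qed
  qed
  also have "\<dots> = (\<Sum>b\<in>e. \<Sum>A\<in>\<A> b. (\<integral>z. G b A z \<partial>?P))"
    using Gi by (subst Bochner_Integration.integral_sum) (auto intro!: sum.cong Bochner_Integration.integral_sum)
  also have "\<dots> \<le> (\<Sum>b\<in>e. \<Sum>A\<in>\<A> b. B * (\<integral>z. F b A z \<partial>?P))"
    by (intro sum_mono key) auto
  also have "\<dots> = B * (\<integral>z. (\<Sum>b\<in>e. \<Sum>A\<in>\<A> b. F b A z) \<partial>?P)"
    using Fi by (subst Bochner_Integration.integral_sum)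
      (auto intro!: sum.cong simp: sum_distrib_left Bochner_Integration.integral_sum)
  also have "\<dots> \<le> B * 1"
  proof (rule mult_left_mono[OF _ B0])
    have "(\<integral>z. (\<Sum>b\<in>e. \<Sum>A\<in>\<A> b. F b A z) \<partial>?P) \<le> (\<integral>z. 1 \<partial>?P)"
    proof (rule integral_mono_AE)
      show "integrable ?P (\<lambda>z. \<Sum>b\<in>e. \<Sum>A\<in>\<A> b. F b A z)" using Fi by (intro Bochner_Integration.integrable_sum) auto
      show "AE z in ?P. (\<Sum>b\<in>e. \<Sum>A\<in>\<A> b. F b A z) \<le> 1"
        using inj
      proof eventually_elim
        case (elim z)
        let ?V = "nearest (\<lambda>i. w (z i)) k e (\<lambda>i. r (z i))"
        obtain b where b: "b \<in> e" "pivot_split (\<lambda>i. w (z i)) (\<lambda>i. r (z i)) e b ?V" "b \<notin> ?V"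
          using pivot_split_exists[OF fin elim k] by blast
        have V: "?V \<subseteq> e - {b}" "card ?V = k" using card_nearest[OF fin elim, of k] k b(3) nearest_subset by fastforce+
        have F0: "F b' A z = of_bool (b' = b \<and> A = ?V)" if "b' \<in> e" "A \<in> \<A> b'" for b' A
        proof -
          have *: "b' = b \<and> A = ?V" if ps: "pivot_split (\<lambda>i. w (z i)) (\<lambda>i. r (z i)) e b' A"
          proof -
            have A: "A \<subseteq> e - {b'}" "card A = k" using \<open>A \<in> \<A> b'\<close> by (auto simp: \<A>_def)
            have "card {l \<in> e. before (\<lambda>i. w (z i)) (\<lambda>i. r (z i)) l b'} = card {l \<in> e. before (\<lambda>i. w (z i)) (\<lambda>i. r (z i)) l b}"
              using pivot_split_unique(2)[OF fin elim \<open>b' \<in> e\<close> A ps] pivot_split_unique(2)[OF fin elim b(1) V b(2)] by simp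
            then have "b' = b" using rank_bij[OF fin elim, of "\<lambda>i. r (z i)"] b(1) \<open>b' \<in> e\<close>
              unfolding bij_betw_def inj_on_def by blast
            then show ?thesis using pivot_split_unique(1)[OF fin elim \<open>b' \<in> e\<close> A ps] by simp
          qed
          then have "pivot_split (\<lambda>i. w (z i)) (\<lambda>i. r (z i)) e b' A \<longleftrightarrow> b' = b \<and> A = ?V" using b(2) by metis
          then show ?thesis unfolding F_def by (rule arg_cong)
        qed
        have "(\<Sum>b'\<in>e. \<Sum>A\<in>\<A> b'. F b' A z) = (\<Sum>b'\<in>e. \<Sum>A\<in>\<A> b'. of_bool (b' = b \<and> A = ?V))"
          using F0 by (intro sum.cong) auto
        also have "\<dots> \<le> (\<Sum>b'\<in>e. if b' = b then 1 else 0)"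
          using fin\<A> by (intro sum_mono) (auto simp: of_bool_def)
        also have "\<dots> = 1" using b fin by simp
        finally show ?case .
      qed
    qed simp
    then show "(\<integral>z. (\<Sum>b\<in>e. \<Sum>A\<in>\<A> b. F b A z) \<partial>?P) \<le> 1" using PE.prob_space by simp
  qed
  finally show ?thesis by simp
qed

end

section \<open>Exchanging the index order for random priorities\<close>

lemma nearestD: "i \<in> nearest \<pi> k e r \<Longrightarrow> i \<in> e"
  by (simp add: nearest_def)

text \<open>With all distances equal the ranks sort \<open>e\<close> by priority; their inverse is
  the increasing enumeration.\<close>

lemma order_enumeration:
  fixes \<pi> :: "nat \<Rightarrow> 'p::linorder"
  assumes "finite e" "inj_on \<pi> e"
  shows "\<exists>f. bij_betw f {..<card e} e \<and> (\<forall>i<card e. \<forall>j<card e. \<pi> (f i) < \<pi> (f j) \<longleftrightarrow> i < j)"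
proof -
  define g where "g i = card {l \<in> e. before \<pi> (\<lambda>_. 0) l i}" for i
  have g: "bij_betw g e {..<card e}" unfolding g_def by (rule rank_bij[OF assms])
  have mono: "g i < g j" if "i \<in> e" "j \<in> e" "\<pi> i < \<pi> j" for i j
    unfolding g_def using that by (intro rank_mono[OF assms(1)]) (auto simp: before_def)
  define f where "f = the_inv_into e g"
  have f: "bij_betw f {..<card e} e" unfolding f_def by (rule bij_betw_the_inv_into[OF g])
  have gf: "g (f i) = i" "f i \<in> e" if "i < card e" for i
    using that g f by (auto simp: f_def bij_betw_def f_the_inv_into_f)
  have "\<pi> (f i) < \<pi> (f j) \<longleftrightarrow> i < j" if ij: "i < card e" "j < card e" for i j
  proof -
    consider "\<pi> (f i) < \<pi> (f j)" | "\<pi> (f j) < \<pi> (f i)" | "\<pi> (f i) = \<pi> (f j)" by fastforce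
    then show ?thesis
    proof cases
      case 1 then show ?thesis using mono[of "f i" "f j"] gf ij by auto
    next
      case 2 then show ?thesis using mono[of "f j" "f i"] gf ij by auto
    next
      case 3
      then have "f i = f j" using assms(2) gf ij by (auto dest: inj_onD)
      then have "i = j" using gf(1)[OF ij(1)] gf(1)[OF ij(2)] by metis
      then show ?thesis by simp
    qed
  qed
  then show ?thesis using f by blast
qed

lemma votes_reindex:
  fixes f :: "nat \<Rightarrow> nat"
  assumes "inj_on f D" and "\<And>i j. i \<in> D \<Longrightarrow> j \<in> D \<Longrightarrow> \<pi> (f i) < \<pi> (f j) \<longleftrightarrow> \<rho> i < \<rho> j"
  shows "votes \<pi> k (f ` D) r y = votes \<rho> k D (\<lambda>i. r (f i)) (\<lambda>i. y (f i))"
proof -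
  have "inj_on f (nearest \<rho> k D (\<lambda>i. r (f i)))"
    using assms(1) nearest_subset by (rule inj_on_subset)
  moreover have "nearest \<pi> k (f ` D) r = f ` nearest \<rho> k D (\<lambda>i. r (f i))"
    using assms by (rule nearest_reindex)
  ultimately show ?thesis unfolding votes_def by (simp add: sum.reindex)
qed

lemma votes_cong:
  assumes "\<And>i. i \<in> e \<Longrightarrow> r i = r' i" "\<And>i. i \<in> e \<Longrightarrow> y i = y' i"
  shows "votes \<pi> k e r y = votes \<pi> k e r' y'"
proof -
  have b: "before \<pi> r j i \<longleftrightarrow> before \<pi> r' j i" if "i \<in> e" "j \<in> e" for i j
    using assms(1) that by (simp add: before_def)
  have "{j \<in> e. before \<pi> r j i} = {j \<in> e. before \<pi> r' j i}" if "i \<in> e" for i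
    using b[OF that] by auto
  then have "nearest \<pi> k e r = nearest \<pi> k e r'" unfolding nearest_def by auto
  then show ?thesis unfolding votes_def using assms(2) by (intro sum.cong) (auto dest: nearestD)
qed

context prob_space
begin

text \<open>Overwriting coordinate \<open>i\<close> makes its priority independent of that of
  \<open>j\<close>, and a law without atoms almost surely avoids any given value.\<close>

lemma AE_inj_on_PiM:
  fixes w :: "'a \<Rightarrow> real"
  assumes "finite e" and w: "w \<in> borel_measurable M" and na: "\<And>c. AE x in M. w x \<noteq> c"
  shows "AE z in PiM e (\<lambda>_. M). inj_on (\<lambda>i. w (z i)) e"
proof -
  let ?P = "PiM e (\<lambda>_. M)"
  interpret P: prob_space ?P by (rule prob_space_PiM_const)
  interpret PM: pair_prob_space ?P M by unfold_locales
  have "AE z in ?P. w (z i) \<noteq> w (z j)" if ij: "i \<in> e" "j \<in> e" "i \<noteq> j" for i j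
  proof -
    have m: "(\<lambda>z. w (z l)) \<in> borel_measurable ?P" if "l \<in> e" for l
      by (rule measurable_compose[OF measurable_component_singleton[OF that] w])
    note [measurable] = m[OF ij(1)] m[OF ij(2)] w
    have pm: "{x \<in> space ?P. w (x i) \<noteq> w (x j)} \<in> sets ?P"
      by (intro borel_measurable_neq m ij)
    have "AE q in ?P \<Otimes>\<^sub>M M. w (snd q) \<noteq> w (fst q j)"
    proof (rule PM.AE_pair_measure)
      show "{q \<in> space (?P \<Otimes>\<^sub>M M). w (snd q) \<noteq> w (fst q j)} \<in> sets (?P \<Otimes>\<^sub>M M)" by measurable
      show "AE z in ?P. AE v in M. w (snd (z, v)) \<noteq> w (fst (z, v) j)" using na by simp
    qed
    then have "AE q in ?P \<Otimes>\<^sub>M M. w ((case q of (z, v) \<Rightarrow> z(i := v)) i) \<noteq> w ((case q of (z, v) \<Rightarrow> z(i := v)) j)"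
      using ij(3) by (auto simp: case_prod_unfold)
    then have "AE z in distr (?P \<Otimes>\<^sub>M M) ?P (\<lambda>(z, v). z(i := v)). w (z i) \<noteq> w (z j)"
      using pm by (subst AE_distr_iff[OF measurable_resample[OF ij(1)]]) simp_all
    then show ?thesis unfolding resample_distr[OF ij(1)] .
  qed
  then have "AE z in ?P. \<forall>i\<in>e. \<forall>j\<in>e. i \<noteq> j \<longrightarrow> w (z i) \<noteq> w (z j)"
    using assms(1) by (auto simp: AE_finite_all)
  then show ?thesis by eventually_elim (auto simp: inj_on_def)
qed

text \<open>Enumerating \<open>e\<close> by increasing priority carries it to
  \<open>{..<card e}\<close> in its natural order, and the law of i.i.d. points is invariant under
  injective reindexing. As the right-hand side does not mention \<open>\<pi>\<close>, any two
  injective priorities give the same integral.\<close>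

lemma votes_priority_integral:
  fixes \<psi> :: "nat \<Rightarrow> real" and y :: "'a \<Rightarrow> nat" and r :: "'a \<Rightarrow> real" and \<pi> :: "nat \<Rightarrow> real"
  assumes fin: "finite e" and inj: "inj_on \<pi> e" and eI: "e \<subseteq> I"
    and r: "r \<in> borel_measurable M" and y: "y \<in> measurable M (count_space UNIV)"
  shows "(\<integral>z. \<psi> (votes \<pi> k e (\<lambda>i. r (z i)) (\<lambda>i. y (z i))) \<partial>PiM I (\<lambda>_. M)) =
    (\<integral>z. \<psi> (votes real k {..<card e} (\<lambda>i. r (z i)) (\<lambda>i. y (z i))) \<partial>PiM {..<card e} (\<lambda>_. M))"
proof -
  let ?D = "{..<card e}"
  obtain f where f: "bij_betw f ?D e" "\<And>i j. i \<in> ?D \<Longrightarrow> j \<in> ?D \<Longrightarrow> \<pi> (f i) < \<pi> (f j) \<longleftrightarrow> real i < real j"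
    using order_enumeration[OF fin inj] by auto
  have fD: "f ` ?D = e" "inj_on f ?D" using f(1) by (auto simp: bij_betw_def)
  have m: "(\<lambda>z. \<psi> (votes real k ?D (\<lambda>i. r (z i)) (\<lambda>i. y (z i)))) \<in> borel_measurable (PiM ?D (\<lambda>_. M))"
    by (rule measurable_compose[OF measurable_votes borel_measurable_count_space])
      (auto intro!: measurable_compose[OF measurable_component_singleton] r y)
  have "votes \<pi> k e (\<lambda>i. r (z i)) (\<lambda>i. y (z i)) = votes real k ?D (\<lambda>i. r ((\<lambda>n\<in>?D. z (f n)) i)) (\<lambda>i. y ((\<lambda>n\<in>?D. z (f n)) i))" for z
  proof -
    have "votes \<pi> k e (\<lambda>i. r (z i)) (\<lambda>i. y (z i)) = votes real k ?D (\<lambda>i. r (z (f i))) (\<lambda>i. y (z (f i)))"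
      using votes_reindex[where \<pi> = \<pi> and \<rho> = real and f = f and r = "\<lambda>i. r (z i)" and y = "\<lambda>i. y (z i)", OF fD(2) f(2)] fD(1) by simp
    also have "\<dots> = votes real k ?D (\<lambda>i. r ((\<lambda>n\<in>?D. z (f n)) i)) (\<lambda>i. y ((\<lambda>n\<in>?D. z (f n)) i))"
      by (rule votes_cong) auto
    finally show ?thesis .
  qed
  then show ?thesis
    using reindex_integral[OF fD(2) _ m, of I] fD(1) eI by auto
qed

text \<open>For almost every draw \<open>u\<close> of priorities the integral over the points agrees
  with the one for the index order. Averaging over \<open>u\<close> therefore leaves the integral
  unchanged, and \<open>pivot_votes_le\<close> applies to the pairs of points and
  priorities.\<close>

theorem votes_integral_le:
  fixes \<psi> :: "nat \<Rightarrow> real" and y :: "'a \<Rightarrow> nat" and r :: "'a \<Rightarrow> real"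
  assumes fin: "finite e" and eI: "e \<subseteq> I" and k: "k \<le> card e"
    and r: "r \<in> borel_measurable M" and y: "y \<in> measurable M (count_space UNIV)"
    and y01: "\<And>x. x \<in> space M \<Longrightarrow> y x \<in> {0, 1}"
    and \<psi>: "\<And>s. \<psi> s \<ge> 0"
    and B: "\<And>a b. a \<ge> 0 \<Longrightarrow> b \<ge> 0 \<Longrightarrow> (\<Sum>s\<le>k. real (k choose s) * \<psi> s * a ^ s * b ^ (k - s)) \<le> B * (a + b) ^ k"
  shows "(\<integral>z. \<psi> (votes real k e (\<lambda>i. r (z i)) (\<lambda>i. y (z i))) \<partial>PiM I (\<lambda>_. M)) \<le> B"
proof -
  let ?P = "PiM e (\<lambda>_. M)"
  interpret PE: prob_space ?P by (rule prob_space_PiM_const)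
  have inj_real: "inj_on real e" by (simp add: inj_on_def)
  have red: "(\<integral>z. \<psi> (votes real k e (\<lambda>i. r (z i)) (\<lambda>i. y (z i))) \<partial>PiM I (\<lambda>_. M))
     = (\<integral>z. \<psi> (votes real k e (\<lambda>i. r (z i)) (\<lambda>i. y (z i))) \<partial>?P)"
    using votes_priority_integral[OF fin inj_real eI r y] votes_priority_integral[OF fin inj_real subset_refl r y] by simp
  show ?thesis
  proof (cases "k = card e")
    \<comment> \<open>Here there is no pivot, but every label is counted, so the sum is binomial
      without any conditioning.\<close>
    case True
    have n: "nearest real k e q = e" for q
      using card_nearest[OF fin inj_real, of k q] True fin by (intro card_subset_eq) (auto dest: nearestD)
    have "(\<integral>z. \<psi> (votes real k e (\<lambda>i. r (z i)) (\<lambda>i. y (z i))) \<partial>?P)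
       = (\<integral>z. ((\<Prod>a\<in>e. indicator (space M) (z a)) * (\<Prod>c\<in>{}. indicator (space M) (z c))) * \<psi> (\<Sum>a\<in>e. y (z a)) \<partial>?P)"
    proof (intro Bochner_Integration.integral_cong refl)
      fix z assume z: "z \<in> space ?P"
      have "(\<Prod>a\<in>e. indicator (space M) (z a) :: real) = 1"
        using z by (intro prod.neutral) (auto simp: space_PiM PiE_iff)
      then show "\<psi> (votes real k e (\<lambda>i. r (z i)) (\<lambda>i. y (z i))) = ((\<Prod>a\<in>e. indicator (space M) (z a)) * (\<Prod>c\<in>{}. indicator (space M) (z c))) * \<psi> (\<Sum>a\<in>e. y (z a))"
        by (simp add: votes_def n)
    qed
    also have "\<dots> \<le> B * (\<integral>z. ((\<Prod>a\<in>e. indicator (space M) (z a)) * (\<Prod>c\<in>{}. indicator (space M) (z c))) \<partial>?P)"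
      using B True by (intro cylinder_votes_le[OF fin _ _ _ _ _ y y01]) auto
    also have "(\<integral>z. ((\<Prod>a\<in>e. indicator (space M) (z a)) * (\<Prod>c\<in>{}. indicator (space M) (z c))) \<partial>?P) = (\<integral>z. 1 \<partial>?P :: real)"
      by (intro Bochner_Integration.integral_cong refl) (auto simp: space_PiM PiE_iff intro!: prod.neutral)
    finally show ?thesis using red PE.prob_space by simp
  next
    case False
    then have k': "k < card e" using k by simp
    define U where "U = uniform_measure lborel {0..1::real}"
    interpret U: prob_space U unfolding U_def by (rule prob_space_uniform_measure) auto
    interpret UI: prob_space "PiM e (\<lambda>_. U)" by (rule U.prob_space_PiM_const)
    interpret MU: pair_prob_space M U by unfold_locales
    interpret UP: pair_prob_space "PiM e (\<lambda>_. U)" ?P by unfold_locales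
    have sU: "sets U = sets borel" by (simp add: U_def)
    have na: "AE v in U. v \<noteq> c" for c
      unfolding U_def using AE_lborel_singleton[of c] by (intro AE_uniform_measureI) auto
    have injU: "AE u in PiM e (\<lambda>_. U). inj_on u e"
      using U.AE_inj_on_PiM[where w = "\<lambda>x. x", OF fin _ na] measurable_ident_sets[OF sU] by simp
    have injMU: "AE z in PiM e (\<lambda>_. M \<Otimes>\<^sub>M U). inj_on (\<lambda>i. snd (z i)) e"
    proof (rule MU.AE_inj_on_PiM[OF fin])
      show sm: "snd \<in> borel_measurable (M \<Otimes>\<^sub>M U)"
        using measurable_snd[of M U] measurable_ident_sets[OF sU] by (auto intro: measurable_compose)
      fix c
      show "AE x in M \<Otimes>\<^sub>M U. snd x \<noteq> c"
        using sm na by (intro MU.AE_pair_measure) auto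
    qed
    define V where "V u z = \<psi> (votes u k e (\<lambda>i. r (z i)) (\<lambda>i. y (z i)))" for u :: "nat \<Rightarrow> real" and z
    have ym: "(\<lambda>x. y (fst x)) \<in> measurable (M \<Otimes>\<^sub>M U) (count_space UNIV)" and rm: "(\<lambda>x. r (fst x)) \<in> borel_measurable (M \<Otimes>\<^sub>M U)"
      by (rule measurable_compose[OF measurable_fst], fact)+
    have Wm: "(\<lambda>z. V (\<lambda>i. snd (z i)) (\<lambda>i. fst (z i))) \<in> borel_measurable (PiM e (\<lambda>_. M \<Otimes>\<^sub>M U))"
      unfolding V_def
      by (rule measurable_compose[OF measurable_votes[OF fin] borel_measurable_count_space])
        (auto intro!: measurable_compose[OF measurable_component_singleton] rm ym measurable_compose[OF measurable_snd] simp: measurable_ident_sets[OF sU])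
    have zm: "(\<lambda>(u, z). \<lambda>i\<in>e. (z i, u i)) \<in> measurable (PiM e (\<lambda>_. U) \<Otimes>\<^sub>M PiM e (\<lambda>_. M)) (PiM e (\<lambda>_. M \<Otimes>\<^sub>M U))"
      unfolding case_prod_unfold
      by (intro measurable_restrict measurable_Pair) (auto intro!: measurable_compose[OF measurable_snd] measurable_compose[OF measurable_fst] measurable_component_singleton)
    have Vcong: "V (\<lambda>i. snd ((\<lambda>i\<in>e. (z i, u i)) i)) (\<lambda>i. fst ((\<lambda>i\<in>e. (z i, u i)) i)) = V u z" for u z
    proof -
      have "nearest (\<lambda>i. snd ((\<lambda>i\<in>e. (z i, u i)) i)) k e q = nearest u k e q" for q
        unfolding nearest_def before_def by (auto intro!: arg_cong[where f = "\<lambda>c. c < k"] arg_cong[where f = card] cong: conj_cong)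
      then have "votes (\<lambda>i. snd ((\<lambda>i\<in>e. (z i, u i)) i)) k e q y' = votes u k e q y'" for q y'
        by (simp add: votes_def)
      then show ?thesis unfolding V_def by (auto intro!: arg_cong[where f = \<psi>] votes_cong)
    qed
    have VUm: "(\<lambda>w. V (fst w) (snd w)) \<in> borel_measurable (PiM e (\<lambda>_. U) \<Otimes>\<^sub>M ?P)"
      using measurable_compose[OF zm Wm] Vcong by (simp add: case_prod_unfold)
    define c where "c = (\<Sum>s\<le>card e. \<psi> s)"
    have Vb: "\<bar>V u z\<bar> \<le> c" if "z \<in> space ?P" for u z
    proof -
      have "votes u k e (\<lambda>i. r (z i)) (\<lambda>i. y (z i)) \<le> card (nearest u k e (\<lambda>i. r (z i)))"
        unfolding votes_def using that y01 nearest_subset fin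
        by (intro sum_labels_le finite_nearest) (auto simp: space_PiM PiE_iff nearest_def)
      also have "\<dots> \<le> card e" using fin nearest_subset by (rule card_mono)
      finally show ?thesis unfolding V_def c_def using \<psi> by (simp add: member_le_sum)
    qed
    have Vint: "integrable (PiM e (\<lambda>_. U) \<Otimes>\<^sub>M ?P) (\<lambda>(u, z). V u z)"
      using VUm Vb by (intro UP.integrable_bounded[of _ c]) (auto simp: case_prod_unfold space_pair_measure)
    have "(\<integral>z. \<psi> (votes real k e (\<lambda>i. r (z i)) (\<lambda>i. y (z i))) \<partial>?P) = (\<integral>u. (\<integral>z. \<psi> (votes real k e (\<lambda>i. r (z i)) (\<lambda>i. y (z i))) \<partial>?P) \<partial>PiM e (\<lambda>_. U))"
      using UI.prob_space by simp
    also have "\<dots> = (\<integral>u. (\<integral>z. V u z \<partial>?P) \<partial>PiM e (\<lambda>_. U))"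
    proof (rule integral_cong_AE)
      show "(\<lambda>u. \<integral>z. V u z \<partial>?P) \<in> borel_measurable (PiM e (\<lambda>_. U))"
        using UP.integrable_fst[OF Vint] by simp
      show "AE u in PiM e (\<lambda>_. U). (\<integral>z. \<psi> (votes real k e (\<lambda>i. r (z i)) (\<lambda>i. y (z i))) \<partial>?P) = (\<integral>z. V u z \<partial>?P)"
        using injU
      proof eventually_elim
        case (elim u)
        show ?case unfolding V_def
          using votes_priority_integral[OF fin inj_real subset_refl r y] votes_priority_integral[OF fin elim subset_refl r y] by simp
      qed
    qed simp
    also have "\<dots> = (\<integral>w. V (fst w) (snd w) \<partial>(PiM e (\<lambda>_. U) \<Otimes>\<^sub>M ?P))"
      using UP.integral_fst[OF Vint] by (simp add: case_prod_unfold)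
    also have "\<dots> = (\<integral>w. (\<lambda>z. V (\<lambda>i. snd (z i)) (\<lambda>i. fst (z i))) (case w of (u, z) \<Rightarrow> \<lambda>i\<in>e. (z i, u i)) \<partial>(PiM e (\<lambda>_. U) \<Otimes>\<^sub>M ?P))"
      using Vcong by (simp add: case_prod_unfold)
    also have "\<dots> = (\<integral>z. V (\<lambda>i. snd (z i)) (\<lambda>i. fst (z i)) \<partial>distr (PiM e (\<lambda>_. U) \<Otimes>\<^sub>M ?P) (PiM e (\<lambda>_. M \<Otimes>\<^sub>M U)) (\<lambda>(u, z). \<lambda>i\<in>e. (z i, u i)))"
      by (rule integral_distr[OF zm Wm, symmetric])
    also have "\<dots> = (\<integral>z. V (\<lambda>i. snd (z i)) (\<lambda>i. fst (z i)) \<partial>PiM e (\<lambda>_. M \<Otimes>\<^sub>M U))"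
      unfolding zip_distr[OF prob_space_axioms U.prob_space_axioms fin] ..
    also have "\<dots> \<le> B"
      unfolding V_def
    proof (rule MU.pivot_votes_le[OF fin k' rm _ ym _ injMU \<psi> B])
      show "snd \<in> borel_measurable (M \<Otimes>\<^sub>M U)"
        using measurable_snd[of M U] measurable_ident_sets[OF sU] by (auto intro: measurable_compose)
      fix x assume "x \<in> space (M \<Otimes>\<^sub>M U)"
      then have "fst x \<in> space M" by (auto simp: space_pair_measure)
      then show "y (fst x) \<in> {0, 1}" by (rule y01)
    qed
    finally show ?thesis using red by simp
  qed
qed

end

section \<open>Stability of the vote under deletion\<close>

text \<open>For \<open>s > k\<close> the factor \<open>k - s\<close> is negative, but the vote is
  already decided and the increment it multiplies vanishes.\<close>

lemma sensitivity_nonneg: "0 \<le> sensitivity k s"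
proof -
  have m: "majority k (int s - 1) \<le> majority k (int s)" "majority k (int s) \<le> majority k (int s + 1)"
    by (rule majority_mono, simp)+
  show ?thesis
  proof (cases "s \<le> k")
    case True
    then show ?thesis unfolding sensitivity_def using m by (intro add_nonneg_nonneg mult_nonneg_nonneg) auto
  next
    case False
    then have "majority k (int s + 1) = majority k (int s)" by (simp add: majority_def)
    then show ?thesis unfolding sensitivity_def using m by simp
  qed
qed

text \<open>The misclassification indicator averaged over the tie-breaking variable: as labels are
  0 or 1, it is the distance from the majority vote (1/2 for a tied vote) to the label.\<close>

definition err :: "nat \<Rightarrow> nat set \<Rightarrow> (nat \<Rightarrow> (real ^ 'd) \<times> nat) \<Rightarrow> (real ^ 'd) \<times> nat \<Rightarrow> real" where
  "err k e z x =
     \<bar>majority k (int (votes real k e (\<lambda>i. dist (fst (z i)) (fst x)) (\<lambda>i. snd (z i)))) - real (snd x)\<bar>"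

lemma err_cong: "(\<And>i. i \<in> e \<Longrightarrow> z i = z' i) \<Longrightarrow> err k e z x = err k e z' x"
  unfolding err_def by (simp cong: votes_cong)

lemma err_bounds:
  assumes "snd x \<in> {0, 1}"
  shows "0 \<le> err k e z x" "err k e z x \<le> 1"
proof -
  let ?m = "majority k (int (votes real k e (\<lambda>i. dist (fst (z i)) (fst x)) (\<lambda>i. snd (z i))))"
  have "0 \<le> ?m" "?m \<le> 1" by (rule majority_bounds)+
  then show "0 \<le> err k e z x" "err k e z x \<le> 1" using assms unfolding err_def by auto
qed

text \<open>Comparing \<open>2 * s\<close> with \<open>k\<close> in the integers replaces the real
  average and matches the form of \<open>majority\<close>.\<close>

lemma knn_votes:
  assumes "k \<ge> 1"
  defines "s \<equiv> \<lambda>e z x. votes real k e (\<lambda>i. dist (fst (z i)) x) (\<lambda>i. snd (z i))"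
  shows "knn k e z b x = (if 2 * int (s e z x) > int k then 1 else if 2 * int (s e z x) < int k then 0 else of_bool b)"
proof -
  have n: "neighbours k e (\<lambda>i. fst (z i)) x = nearest real k e (\<lambda>i. dist (fst (z i)) x)"
    unfolding neighbours_eq_nearest by (simp add: nearest_def before_def)
  have sr: "1 / real k * (\<Sum>i\<in>neighbours k e (\<lambda>i. fst (z i)) x. real (snd (z i))) = real (s e z x) / real k"
    by (simp add: n s_def votes_def)
  have c: "real (s e z x) / real k > 1/2 \<longleftrightarrow> 2 * int (s e z x) > int k"
    "real (s e z x) / real k < 1/2 \<longleftrightarrow> 2 * int (s e z x) < int k"
    using assms(1) by (auto simp: field_simps)
  show ?thesis unfolding knn_def Let_def sr c ..
qed

lemma err_knn:
  assumes "snd x \<in> {0, 1}" "k \<ge> 1"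
  shows "(of_bool (knn k e z True (fst x) \<noteq> snd x) + of_bool (knn k e z False (fst x) \<noteq> snd x)) / 2 = err k e z x"
  unfolding knn_votes[OF assms(2)] err_def majority_def using assms(1) by auto

text \<open>Double counting: a set of size \<open>Suc m\<close> with a distinguished element amounts
  to a set of size \<open>m\<close> with a point outside it.\<close>

lemma sum_remove_element:
  fixes h :: "nat set \<Rightarrow> nat \<Rightarrow> real"
  assumes "finite G"
  shows "(\<Sum>e\<in>{e. e \<subseteq> G \<and> card e = Suc m}. \<Sum>i\<in>e. h (e - {i}) i)
     = (\<Sum>e\<in>{e. e \<subseteq> G \<and> card e = m}. \<Sum>i\<in>G - e. h e i)"
proof -
  have fin: "finite {e. e \<subseteq> G \<and> card e = n}" for n using assms by simp
  have fe: "finite e" if "e \<subseteq> G" for e using that assms finite_subset by blast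
  have "(\<Sum>e\<in>{e. e \<subseteq> G \<and> card e = Suc m}. \<Sum>i\<in>e. h (e - {i}) i)
     = (\<Sum>(e, i)\<in>(SIGMA e:{e. e \<subseteq> G \<and> card e = Suc m}. e). h (e - {i}) i)"
    using fin fe by (intro sum.Sigma) auto
  also have "\<dots> = (\<Sum>(e, i)\<in>(SIGMA e:{e. e \<subseteq> G \<and> card e = m}. G - e). h e i)"
    by (rule sum.reindex_bij_witness[of _ "\<lambda>(e, i). (insert i e, i)" "\<lambda>(e, i). (e - {i}, i)"])
      (auto simp: insert_absorb fe card_insert_if)
  also have "\<dots> = (\<Sum>e\<in>{e. e \<subseteq> G \<and> card e = m}. \<Sum>i\<in>G - e. h e i)"
    using fin assms by (intro sum.Sigma[symmetric]) auto
  finally show ?thesis .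
qed

lemma sum_held_out_swap:
  fixes f :: "nat set \<Rightarrow> nat \<Rightarrow> real"
  assumes "finite G"
  shows "(\<Sum>e\<in>{e. e \<subseteq> G \<and> card e = m}. \<Sum>i\<in>G - e. f e i)
     = (\<Sum>i\<in>G. \<Sum>e\<in>{e. e \<subseteq> G - {i} \<and> card e = m}. f e i)"
proof -
  have fin: "finite {e. e \<subseteq> G \<and> card e = n}" "finite {e. e \<subseteq> G - {i} \<and> card e = n}" for n i using assms by simp_all
  have "(\<Sum>e\<in>{e. e \<subseteq> G \<and> card e = m}. \<Sum>i\<in>G - e. f e i)
     = (\<Sum>(e, i)\<in>(SIGMA e:{e. e \<subseteq> G \<and> card e = m}. G - e). f e i)"
    using fin assms by (intro sum.Sigma) auto
  also have "\<dots> = (\<Sum>(i, e)\<in>(SIGMA i:G. {e. e \<subseteq> G - {i} \<and> card e = m}). f e i)"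
    by (rule sum.reindex_bij_witness[of _ "\<lambda>(i, e). (e, i)" "\<lambda>(e, i). (i, e)"]) auto
  also have "\<dots> = (\<Sum>i\<in>G. \<Sum>e\<in>{e. e \<subseteq> G - {i} \<and> card e = m}. f e i)"
    using fin assms by (intro sum.Sigma[symmetric]) auto
  finally show ?thesis .
qed

text \<open>Only the law \<open>\<nu>\<close> of one labelled point matters: the data and the fresh
  point become coordinates of a product of copies of \<open>\<nu>\<close>, where expectations are
  computed before being transported to the given space.\<close>

locale labelled_law = prob_space \<nu> for \<nu> :: "((real ^ 'd) \<times> nat) measure" +
  assumes measurable_point: "fst \<in> borel_measurable \<nu>"
    and measurable_label: "snd \<in> measurable \<nu> (count_space UNIV)"
    and label: "x \<in> space \<nu> \<Longrightarrow> snd x \<in> {0, 1}"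
begin

abbreviation law :: "nat set \<Rightarrow> (nat \<Rightarrow> (real ^ 'd) \<times> nat) measure" where
  "law I \<equiv> PiM I (\<lambda>_. \<nu>)"

sublocale law: prob_space "law I" for I
  by (rule prob_space_PiM_const)

lemma coordinate: "z \<in> space (law I) \<Longrightarrow> i \<in> I \<Longrightarrow> z i \<in> space \<nu>"
  by (auto simp: space_PiM PiE_iff)

lemma update_space: "z \<in> space (law I) \<Longrightarrow> v \<in> space \<nu> \<Longrightarrow> i \<in> I \<Longrightarrow> z(i := v) \<in> space (law I)"
  by (auto simp: space_PiM PiE_iff extensional_def)

lemma measurable_err_gen:
  assumes "finite e" "\<And>i. i \<in> e \<Longrightarrow> (\<lambda>w. Z w i) \<in> measurable N \<nu>" "X \<in> measurable N \<nu>"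
  shows "(\<lambda>w. err k e (Z w) (X w)) \<in> borel_measurable N"
proof -
  have X: "(\<lambda>w. fst (X w)) \<in> borel_measurable N" "(\<lambda>w. real (snd (X w))) \<in> borel_measurable N"
    using measurable_compose[OF assms(3) measurable_point]
      measurable_compose[OF measurable_compose[OF assms(3) measurable_label] borel_measurable_count_space] by auto
  have "(\<lambda>w. votes real k e (\<lambda>i. dist (fst (Z w i)) (fst (X w))) (\<lambda>i. snd (Z w i))) \<in> measurable N (count_space UNIV)"
  proof (rule measurable_votes[OF assms(1)])
    fix i assume i: "i \<in> e"
    show "(\<lambda>w. dist (fst (Z w i)) (fst (X w))) \<in> borel_measurable N"
      by (intro borel_measurable_dist X measurable_compose[OF assms(2)[OF i] measurable_point])
    show "(\<lambda>w. snd (Z w i)) \<in> measurable N (count_space UNIV)"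
      by (rule measurable_compose[OF assms(2)[OF i] measurable_label])
  qed simp
  then have "(\<lambda>w. majority k (int (votes real k e (\<lambda>i. dist (fst (Z w i)) (fst (X w))) (\<lambda>i. snd (Z w i))))) \<in> borel_measurable N"
    by (rule measurable_compose[of _ _ _ "\<lambda>s. majority k (int s)"]) (rule borel_measurable_count_space)
  then show ?thesis unfolding err_def using X by simp
qed

lemma measurable_err:
  assumes "finite e" "e \<subseteq> I" "j \<in> I"
  shows "(\<lambda>z. err k e z (z j)) \<in> borel_measurable (law I)"
  using assms by (intro measurable_err_gen measurable_component_singleton) auto

lemma err_abs_le_1: "snd x \<in> {0,1} \<Longrightarrow> \<bar>err k e z x\<bar> \<le> 1"
  using err_bounds[of x k e z] by simp

lemma err_diff_le_1: "snd x \<in> {0,1} \<Longrightarrow> \<bar>err k e z x - err k e' z' x\<bar> \<le> 1"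
  using err_bounds[of x k e z] err_bounds[of x k e' z'] by auto

lemma integrable_err_diff:
  assumes "finite e" "e \<subseteq> I" "finite e'" "e' \<subseteq> I" "j \<in> I"
  shows "integrable (law I) (\<lambda>z. \<bar>err k e z (z j) - err k e' z (z j)\<bar>)"
proof (rule law.integrable_bounded[of _ _ 1])
  show "(\<lambda>z. \<bar>err k e z (z j) - err k e' z (z j)\<bar>) \<in> borel_measurable (law I)"
    using measurable_err[of e I j k] measurable_err[of e' I j k] assms by simp
  fix z assume "z \<in> space (law I)"
  then show "\<bar>\<bar>err k e z (z j) - err k e' z (z j)\<bar>\<bar> \<le> 1"
    using err_diff_le_1[OF label[OF coordinate]] assms(5) by simp
qed

text \<open>Overwriting coordinate \<open>j\<close> fixes the test point \<open>v\<close>. Its label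
  is then a constant, so differences of \<open>err\<close> are at most differences of the majority
  vote. Their sum is at most \<open>sensitivity\<close>, whose mean over the training points
  \<open>votes_integral_le\<close> bounds.\<close>

theorem err_stability:
  assumes fin: "finite e" and e: "e \<subseteq> I" and j: "j \<in> I" "j \<notin> e" and k: "k \<le> card e" "k \<ge> 1"
  shows "(\<Sum>i\<in>e. \<integral>z. \<bar>err k e z (z j) - err k (e - {i}) z (z j)\<bar> \<partial>law I) \<le> sqrt (real k)"
proof -
  define F where "F z = (\<Sum>i\<in>e. \<bar>err k e z (z j) - err k (e - {i}) z (z j)\<bar>)" for z :: "nat \<Rightarrow> (real ^ 'd) \<times> nat"
  have Fi: "integrable (law I) (\<lambda>z. \<bar>err k e z (z j) - err k (e - {i}) z (z j)\<bar>)" for i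
    using fin e j by (intro integrable_err_diff) auto
  have Fm: "F \<in> borel_measurable (law I)"
    unfolding F_def using Fi by (intro borel_measurable_sum borel_measurable_integrable) auto
  have Fb: "\<bar>F z\<bar> \<le> real (card e)" if "z \<in> space (law I)" for z
  proof -
    have "F z \<le> (\<Sum>i\<in>e. 1)"
      unfolding F_def using err_diff_le_1[OF label[OF coordinate[OF that j(1)]]] by (intro sum_mono) auto
    moreover have "0 \<le> F z" unfolding F_def by (intro sum_nonneg) auto
    ultimately show ?thesis by simp
  qed
  have "(\<Sum>i\<in>e. \<integral>z. \<bar>err k e z (z j) - err k (e - {i}) z (z j)\<bar> \<partial>law I) = (\<integral>z. F z \<partial>law I)"
    unfolding F_def using Fi by (subst Bochner_Integration.integral_sum) auto
  also have "\<dots> = (\<integral>v. (\<integral>z. F (z(j := v)) \<partial>law I) \<partial>\<nu>)"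
    by (rule resample_integral(3)[OF j(1) Fm Fb])
  also have "\<dots> \<le> (\<integral>v. sqrt (real k) \<partial>\<nu>)"
  proof (rule integral_mono)
    show "integrable \<nu> (\<lambda>v. \<integral>z. F (z(j := v)) \<partial>law I)"
      by (rule resample_integral(5)[OF j(1) Fm Fb])
    fix v assume v: "v \<in> space \<nu>"
    let ?S = "\<lambda>z. sensitivity k (votes real k e (\<lambda>i. dist (fst (z i)) (fst v)) (\<lambda>i. snd (z i)))"
    have rm: "(\<lambda>x. dist (fst x) (fst v)) \<in> borel_measurable \<nu>"
      using measurable_point by (intro borel_measurable_dist) auto
    have "(\<integral>z. F (z(j := v)) \<partial>law I) \<le> (\<integral>z. ?S z \<partial>law I)"
    proof (rule integral_mono)
      have um: "(\<lambda>z. z(j := v)) \<in> measurable (law I) (law I)"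
        using measurable_compose[of "\<lambda>z. (z, v)" "law I" "law I \<Otimes>\<^sub>M \<nu>", OF _ measurable_resample[OF j(1)]] v by simp
      show "integrable (law I) (\<lambda>z. F (z(j := v)))"
        using measurable_compose[OF um Fm] Fb[OF update_space[OF _ v j(1)]] by (rule law.integrable_bounded)
      have "?S \<in> borel_measurable (law I)"
      proof (rule measurable_compose[OF measurable_votes[OF fin] borel_measurable_count_space])
        fix i assume "i \<in> e"
        then have i: "i \<in> I" using e by auto
        show "(\<lambda>z. dist (fst (z i)) (fst v)) \<in> borel_measurable (law I)"
          by (rule measurable_compose[OF measurable_component_singleton[OF i] rm])
        show "(\<lambda>z. snd (z i)) \<in> measurable (law I) (count_space UNIV)"
          by (rule measurable_compose[OF measurable_component_singleton[OF i] measurable_label])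
      qed simp
      moreover have "\<bar>?S z\<bar> \<le> (\<Sum>s\<le>card e. sensitivity k s)" if z: "z \<in> space (law I)" for z
      proof -
        have "votes real k e (\<lambda>i. dist (fst (z i)) (fst v)) (\<lambda>i. snd (z i)) \<le> card (nearest real k e (\<lambda>i. dist (fst (z i)) (fst v)))"
          unfolding votes_def using fin label[OF coordinate[OF z]] e by (intro sum_labels_le finite_nearest) (auto dest: nearestD)
        also have "\<dots> \<le> card e" using fin nearest_subset by (rule card_mono)
        finally show ?thesis by (simp add: sensitivity_nonneg member_le_sum)
      qed
      ultimately show "integrable (law I) ?S" by (rule law.integrable_bounded)
      fix z assume z: "z \<in> space (law I)"
      have "F (z(j := v)) = (\<Sum>i\<in>e. \<bar>err k e z v - err k (e - {i}) z v\<bar>)"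
      proof -
        have "err k e' (z(j := v)) v = err k e' z v" if "e' \<subseteq> e" for e'
          using that j(2) by (intro err_cong) auto
        then show ?thesis unfolding F_def by simp
      qed
      also have "\<dots> \<le> (\<Sum>i\<in>e. \<bar>majority k (votes real k e (\<lambda>i. dist (fst (z i)) (fst v)) (\<lambda>i. snd (z i)))
          - majority k (votes real k (e - {i}) (\<lambda>i. dist (fst (z i)) (fst v)) (\<lambda>i. snd (z i)))\<bar>)"
        unfolding err_def by (intro sum_mono) linarith
      also have "\<dots> \<le> ?S z"
        using label[OF coordinate[OF z]] e by (intro sum_vote_changes_le fin k(1)) (auto simp: inj_on_def)
      finally show "F (z(j := v)) \<le> ?S z" .
    qed
    also have "\<dots> \<le> sqrt (real k)"
      using sensitivity_binomial_le[OF _ _ k(2)]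
      by (intro votes_integral_le[OF fin e k(1) rm measurable_label label sensitivity_nonneg])
    finally show "(\<integral>z. F (z(j := v)) \<partial>law I) \<le> sqrt (real k)" .
  qed simp
  finally show ?thesis by (simp add: prob_space)
qed

text \<open>Stability bounds only the sum over all deleted points, hence the average over all
  subsets. The induction goes down from \<open>card G\<close>: sets of size \<open>m\<close> arise
  by deleting one point from sets of size \<open>Suc m\<close>, at an average cost of
  \<open>sqrt k / Suc m\<close>.\<close>

lemma err_subsample:
  assumes G: "finite G" "G \<subseteq> I" and j: "j \<in> I" "j \<notin> G" and k: "k \<ge> 1" "k \<le> m" and m: "m \<le> card G"
  shows "(\<Sum>e\<in>{e. e \<subseteq> G \<and> card e = m}. \<integral>z. \<bar>err k e z (z j) - err k G z (z j)\<bar> \<partial>law I)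
    \<le> real (card G choose m) * (real (card G - m) * sqrt (real k) / real (Suc m))"
  using m k(2)
proof (induction m rule: inc_induct)
  case base
  have "{e. e \<subseteq> G \<and> card e = card G} = {G}" using G(1) card_subset_eq by auto
  then show ?case by simp
next
  case (step m)
  let ?N = "card G"
  define D where "D e = (\<integral>z. \<bar>err k e z (z j) - err k G z (z j)\<bar> \<partial>law I)" for e
  define T where "T m = (\<Sum>e\<in>{e. e \<subseteq> G \<and> card e = m}. D e)" for m
  have fe: "finite e" if "e \<subseteq> G" for e using that G finite_subset by blast
  have cardc: "card {e. e \<subseteq> G \<and> card e = m} = ?N choose m" for m by (rule n_subsets[OF G(1)])
  have tri: "D (e - {i}) \<le> D e + (\<integral>z. \<bar>err k e z (z j) - err k (e - {i}) z (z j)\<bar> \<partial>law I)" if e: "e \<subseteq> G" for e i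
  proof -
    have int: "integrable (law I) (\<lambda>z. \<bar>err k e z (z j) - err k G z (z j)\<bar>)"
      "integrable (law I) (\<lambda>z. \<bar>err k e z (z j) - err k (e - {i}) z (z j)\<bar>)"
      "integrable (law I) (\<lambda>z. \<bar>err k (e - {i}) z (z j) - err k G z (z j)\<bar>)"
      using fe[OF e] G e j by (auto intro!: integrable_err_diff)
    show ?thesis unfolding D_def
      unfolding Bochner_Integration.integral_add[OF int(1,2), symmetric]
      using int by (intro integral_mono Bochner_Integration.integrable_add) auto
  qed
  have "(real ?N - real m) * T m = (\<Sum>e\<in>{e. e \<subseteq> G \<and> card e = m}. \<Sum>i\<in>G - e. D e)"
  proof -
    have *: "(\<Sum>i\<in>G - e. D e) = (real ?N - real m) * D e" if "e \<in> {e. e \<subseteq> G \<and> card e = m}" for e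
    proof -
      have e: "e \<subseteq> G" "card e = m" using that by auto
      have "card (G - e) = ?N - m" using card_Diff_subset[OF fe[OF e(1)] e(1)] e(2) by simp
      moreover have "m \<le> ?N" using card_mono[OF G(1) e(1)] e(2) by simp
      ultimately have "real (card (G - e)) = real ?N - real m" by (simp add: of_nat_diff)
      then show ?thesis by simp
    qed
    show ?thesis unfolding T_def sum_distrib_left by (intro sum.cong refl) (rule *[symmetric])
  qed
  also have "\<dots> = (\<Sum>e\<in>{e. e \<subseteq> G \<and> card e = Suc m}. \<Sum>i\<in>e. D (e - {i}))"
    by (rule sum_remove_element[OF G(1), symmetric])
  also have "\<dots> \<le> (\<Sum>e\<in>{e. e \<subseteq> G \<and> card e = Suc m}. real (Suc m) * D e + sqrt (real k))"
  proof (rule sum_mono)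
    fix e assume e: "e \<in> {e. e \<subseteq> G \<and> card e = Suc m}"
    have "(\<Sum>i\<in>e. D (e - {i})) \<le> (\<Sum>i\<in>e. D e + (\<integral>z. \<bar>err k e z (z j) - err k (e - {i}) z (z j)\<bar> \<partial>law I))"
      using e tri by (intro sum_mono) auto
    also have "\<dots> = real (Suc m) * D e + (\<Sum>i\<in>e. \<integral>z. \<bar>err k e z (z j) - err k (e - {i}) z (z j)\<bar> \<partial>law I)"
      using e by (simp add: sum.distrib)
    also have "\<dots> \<le> real (Suc m) * D e + sqrt (real k)"
      using e G j fe step.prems k(1) by (intro add_left_mono err_stability) auto
    finally show "(\<Sum>i\<in>e. D (e - {i})) \<le> real (Suc m) * D e + sqrt (real k)" .
  qed
  also have "\<dots> = real (Suc m) * T (Suc m) + real (?N choose Suc m) * sqrt (real k)"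
    by (simp add: sum.distrib sum_distrib_left T_def cardc del: of_nat_Suc)
  also have "\<dots> \<le> real (Suc m) * (real (?N choose Suc m) * (real (?N - Suc m) * sqrt (real k) / real (Suc (Suc m)))) + real (?N choose Suc m) * sqrt (real k)"
    using step.IH step.prems unfolding T_def D_def by (intro add_right_mono mult_left_mono) auto
  \<comment> \<open>Weakening the denominator from \<open>m + 2\<close> to \<open>m + 1\<close> lets
    the costs of all steps add up to a multiple of one fraction.\<close>
  also have "\<dots> \<le> real (Suc m) * (real (?N choose Suc m) * (real (?N - Suc m) * sqrt (real k) / real (Suc m))) + real (?N choose Suc m) * sqrt (real k)"
    by (intro add_right_mono mult_left_mono divide_left_mono) auto
  also have "\<dots> = real (Suc m * (?N choose Suc m)) * (real (?N - m) * sqrt (real k) / real (Suc m))"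
  proof -
    have "real (?N - m) = real (?N - Suc m) + 1" using step.hyps by linarith
    then show ?thesis by (simp add: field_simps)
  qed
  also have "Suc m * (?N choose Suc m) = (?N - m) * (?N choose m)"
    using binomial_absorb_comp[of ?N m] step.hyps Suc_times_binomial_eq[of "?N - 1" m] times_binomial_minus1_eq[of "Suc m" ?N]
    by (simp add: mult.commute)
  also have "real ((?N - m) * (?N choose m)) = (real ?N - real m) * real (?N choose m)"
    using step.hyps by (simp add: of_nat_diff)
  finally have "(real ?N - real m) * T m \<le> (real ?N - real m) * (real (?N choose m) * (real (?N - m) * sqrt (real k) / real (Suc m)))"
    by (simp only: mult_ac)
  moreover have "0 < real ?N - real m" using step.hyps by simp
  ultimately have "T m \<le> real (?N choose m) * (real (?N - m) * sqrt (real k) / real (Suc m))"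
    by (rule mult_left_le_imp_le)
  then show ?case unfolding T_def D_def .
qed

end

section \<open>Held-out errors\<close>

text \<open>For \<open>m = n - p\<close> and \<open>G = {1..n}\<close> this is the mean of the
  leave-p-out estimator over the tie-breaking variables with the data fixed.\<close>

definition held_out :: "nat \<Rightarrow> nat \<Rightarrow> nat set \<Rightarrow> (nat \<Rightarrow> (real ^ 'd) \<times> nat) \<Rightarrow> real" where
  "held_out k m G z = (\<Sum>e\<in>{e. e \<subseteq> G \<and> card e = m}. \<Sum>i\<in>G - e. err k e z (z i))
     / (real (card G choose m) * real (card G - m))"

definition loo :: "nat \<Rightarrow> nat set \<Rightarrow> (nat \<Rightarrow> (real ^ 'd) \<times> nat) \<Rightarrow> real" where
  "loo k W z = (\<Sum>i\<in>W. err k (W - {i}) z (z i)) / real (card W)"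

lemma binomial_remove: "(n choose m) * (n - m) = n * ((n - 1) choose m)" for n m :: nat
  using binomial_absorb_comp[of n m] by (simp add: mult.commute)

lemma binomial_Suc_remove: "(n choose m) * (n - m) = (n choose Suc m) * Suc m" for n m :: nat
  using binomial_absorb_comp[of n m] times_binomial_minus1_eq[of "Suc m" n] by (simp add: mult.commute)

text \<open>The pairs \<open>(e, i)\<close> are grouped by the set \<open>insert i e\<close>; the
  normalisers agree by \<open>binomial_Suc_remove\<close>.\<close>

lemma held_out_eq_loo_average:
  assumes "finite G" "Suc m \<le> card G"
  shows "held_out k m G z = (\<Sum>W\<in>{W. W \<subseteq> G \<and> card W = Suc m}. loo k W z) / real (card G choose Suc m)"
proof -
  have "(\<Sum>e\<in>{e. e \<subseteq> G \<and> card e = m}. \<Sum>i\<in>G - e. err k e z (z i)) = (\<Sum>W\<in>{W. W \<subseteq> G \<and> card W = Suc m}. \<Sum>i\<in>W. err k (W - {i}) z (z i))"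
    by (rule sum_remove_element[OF assms(1), symmetric])
  also have "\<dots> = (\<Sum>W\<in>{W. W \<subseteq> G \<and> card W = Suc m}. real (Suc m) * loo k W z)"
    by (intro sum.cong) (auto simp: loo_def simp del: of_nat_Suc)
  also have "\<dots> = real (Suc m) * (\<Sum>W\<in>{W. W \<subseteq> G \<and> card W = Suc m}. loo k W z)"
    by (rule sum_distrib_left[symmetric])
  moreover have "real (card G choose m) * real (card G - m) = real (card G choose Suc m) * real (Suc m)"
    unfolding of_nat_mult[symmetric] binomial_Suc_remove ..
  ultimately show ?thesis unfolding held_out_def by (simp del: of_nat_Suc)
qed

lemma sum_off_diagonal_swap:
  fixes h :: "nat \<Rightarrow> nat \<Rightarrow> real"
  assumes "finite W"
  shows "(\<Sum>i\<in>W. \<Sum>j\<in>W - {i}. h i j) = (\<Sum>j\<in>W. \<Sum>i\<in>W - {j}. h i j)"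
proof -
  have "(\<Sum>i\<in>W. \<Sum>j\<in>W - {i}. h i j) = (\<Sum>(i, j)\<in>(SIGMA i:W. W - {i}). h i j)"
    using assms by (intro sum.Sigma) auto
  also have "\<dots> = (\<Sum>(j, i)\<in>(SIGMA j:W. W - {j}). h i j)"
    by (rule sum.reindex_bij_witness[of _ "\<lambda>(i, j). (j, i)" "\<lambda>(i, j). (j, i)"]) auto
  also have "\<dots> = (\<Sum>j\<in>W. \<Sum>i\<in>W - {j}. h i j)"
    using assms by (intro sum.Sigma[symmetric]) auto
  finally show ?thesis .
qed

lemma loo_eq_held_out:
  assumes "finite G" "G \<noteq> {}"
  shows "loo k G z = held_out k (card G - 1) G z"
proof -
  have c: "Suc (card G - 1) = card G" using assms by (simp add: card_gt_0_iff)
  have "{W. W \<subseteq> G \<and> card W = card G} = {G}" using assms(1) card_subset_eq by auto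
  then show ?thesis using held_out_eq_loo_average[OF assms(1), of "card G - 1" k z] unfolding c by simp
qed

lemma integral_double_sum:
  fixes f :: "'i \<Rightarrow> 'j \<Rightarrow> 'a \<Rightarrow> real"
  assumes "\<And>i j. i \<in> A \<Longrightarrow> j \<in> B i \<Longrightarrow> integrable M (f i j)"
  shows "integrable M (\<lambda>z. (\<Sum>i\<in>A. \<Sum>j\<in>B i. f i j z) / c)"
    and "(\<integral>z. (\<Sum>i\<in>A. \<Sum>j\<in>B i. f i j z) / c \<partial>M) = (\<Sum>i\<in>A. \<Sum>j\<in>B i. \<integral>z. f i j z \<partial>M) / c"
proof -
  have i1: "integrable M (\<lambda>z. \<Sum>j\<in>B i. f i j z)" if "i \<in> A" for i
    using assms[OF that] by (rule Bochner_Integration.integrable_sum)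
  have i2: "integrable M (\<lambda>z. \<Sum>i\<in>A. \<Sum>j\<in>B i. f i j z)"
    using i1 by (rule Bochner_Integration.integrable_sum)
  then show "integrable M (\<lambda>z. (\<Sum>i\<in>A. \<Sum>j\<in>B i. f i j z) / c)" by simp
  have "(\<integral>z. (\<Sum>i\<in>A. \<Sum>j\<in>B i. f i j z) \<partial>M) = (\<Sum>i\<in>A. \<integral>z. (\<Sum>j\<in>B i. f i j z) \<partial>M)"
    using i1 by (rule Bochner_Integration.integral_sum)
  also have "\<dots> = (\<Sum>i\<in>A. \<Sum>j\<in>B i. \<integral>z. f i j z \<partial>M)"
    using assms by (intro sum.cong refl Bochner_Integration.integral_sum)
  finally show "(\<integral>z. (\<Sum>i\<in>A. \<Sum>j\<in>B i. f i j z) / c \<partial>M) = (\<Sum>i\<in>A. \<Sum>j\<in>B i. \<integral>z. f i j z \<partial>M) / c"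
    by simp
qed

section \<open>Error at a fresh point, bias and mean squared error\<close>

context labelled_law
begin

text \<open>This is the conditional error given the data with tie-breaking averaged out; in the
  final theorem \<open>class_error\<close> turns out to equal it almost surely.\<close>

definition lerr :: "nat \<Rightarrow> nat set \<Rightarrow> (nat \<Rightarrow> (real ^ 'd) \<times> nat) \<Rightarrow> real" where
  "lerr k e z = (\<integral>v. err k e z v \<partial>\<nu>)"

lemma lerr_cong: "(\<And>i. i \<in> e \<Longrightarrow> z i = z' i) \<Longrightarrow> lerr k e z = lerr k e z'"
  unfolding lerr_def by (intro Bochner_Integration.integral_cong refl err_cong)

lemma measurable_err_pair:
  assumes "finite e" "e \<subseteq> I"
  shows "(\<lambda>w. err k e (fst w) (snd w)) \<in> borel_measurable (law I \<Otimes>\<^sub>M \<nu>)"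
  using assms by (intro measurable_err_gen) (auto intro!: measurable_compose[OF measurable_fst] measurable_component_singleton)

lemma integrable_err:
  assumes "finite e" "e \<subseteq> I" "z \<in> space (law I)"
  shows "integrable \<nu> (\<lambda>v. err k e z v)"
  using assms coordinate[OF assms(3)] err_abs_le_1[OF label]
  by (intro integrable_bounded[of _ 1] measurable_err_gen) auto

lemma measurable_lerr:
  assumes "finite e" "e \<subseteq> I"
  shows "lerr k e \<in> borel_measurable (law I)"
  unfolding lerr_def using measurable_err_pair[OF assms, of k]
  by (intro borel_measurable_lebesgue_integral) (simp add: case_prod_unfold)

lemma lerr_bounds:
  assumes "finite e" "e \<subseteq> I" "z \<in> space (law I)"
  shows "0 \<le> lerr k e z" "lerr k e z \<le> 1"
proof -
  show "0 \<le> lerr k e z" unfolding lerr_def using err_bounds[OF label] by (intro integral_nonneg_AE AE_I2) auto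
  have "lerr k e z \<le> (\<integral>v. 1 \<partial>\<nu>)" unfolding lerr_def
    using err_bounds[OF label] by (intro integral_mono integrable_err[OF assms]) auto
  then show "lerr k e z \<le> 1" by (simp add: prob_space)
qed

lemma integrable_lerr: "finite e \<Longrightarrow> e \<subseteq> I \<Longrightarrow> integrable (law I) (lerr k e)"
  using lerr_bounds by (intro law.integrable_bounded[of _ _ 1] measurable_lerr) auto

lemma integrable_err_coordinate:
  assumes "finite e" "e \<subseteq> I" "j \<in> I"
  shows "integrable (law I) (\<lambda>z. err k e z (z j))"
  using err_abs_le_1[OF label[OF coordinate[OF _ assms(3)]]]
  by (intro law.integrable_bounded[of _ _ 1] measurable_err assms) auto

text \<open>As \<open>j\<close> lies outside \<open>e\<close>, overwriting it changes the test point
  only, which thereby becomes a fresh one.\<close>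

lemma integral_err_coordinate:
  assumes "finite e" "e \<subseteq> I" "j \<in> I" "j \<notin> e"
  shows "(\<integral>z. err k e z (z j) \<partial>law I) = (\<integral>z. lerr k e z \<partial>law I)"
proof -
  have "(\<integral>z. err k e z (z j) \<partial>law I) = (\<integral>z. (\<integral>v. err k e (z(j := v)) ((z(j := v)) j) \<partial>\<nu>) \<partial>law I)"
    using err_abs_le_1[OF label[OF coordinate[OF _ assms(3)]]]
    by (intro resample_integral(2)[of j I _ 1] measurable_err assms) auto
  moreover have "err k e (z(j := v)) ((z(j := v)) j) = err k e z v" for z :: "nat \<Rightarrow> (real ^ 'd) \<times> nat" and v
    using assms(4) by (auto intro!: err_cong)
  ultimately show ?thesis by (simp add: lerr_def)
qed

text \<open>Given the training points, the absolute value of a mean is at most the mean of the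
  absolute values; coordinate \<open>j\<close> plays the fresh point.\<close>

lemma integral_lerr_diff_le:
  assumes e: "finite e" "e \<subseteq> I" and e': "finite e'" "e' \<subseteq> I" and j: "j \<in> I" "j \<notin> e" "j \<notin> e'"
  shows "(\<integral>z. \<bar>lerr k e z - lerr k e' z\<bar> \<partial>law I) \<le> (\<integral>z. \<bar>err k e z (z j) - err k e' z (z j)\<bar> \<partial>law I)"
proof -
  let ?F = "\<lambda>z. \<bar>err k e z (z j) - err k e' z (z j)\<bar>"
  have Fm: "?F \<in> borel_measurable (law I)" using measurable_err[OF e j(1), of k] measurable_err[OF e' j(1), of k] by simp
  have Fb: "\<bar>?F z\<bar> \<le> 1" if "z \<in> space (law I)" for z
    using err_diff_le_1[OF label[OF coordinate[OF that j(1)]]] by simp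
  have eq: "?F (z(j := v)) = \<bar>err k e z v - err k e' z v\<bar>" for z v
  proof -
    have "err k e (z(j := v)) v = err k e z v" "err k e' (z(j := v)) v = err k e' z v"
      using j(2,3) by (auto intro!: err_cong)
    then show ?thesis by simp
  qed
  have "(\<integral>z. \<bar>lerr k e z - lerr k e' z\<bar> \<partial>law I) \<le> (\<integral>z. (\<integral>v. ?F (z(j := v)) \<partial>\<nu>) \<partial>law I)"
  proof (rule integral_mono)
    show "integrable (law I) (\<lambda>z. \<bar>lerr k e z - lerr k e' z\<bar>)"
      using integrable_lerr[OF e, of k] integrable_lerr[OF e', of k] by auto
    show "integrable (law I) (\<lambda>z. \<integral>v. ?F (z(j := v)) \<partial>\<nu>)"
      by (rule resample_integral(4)[OF j(1) Fm Fb])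
    fix z assume z: "z \<in> space (law I)"
    note i = integrable_err[OF e z, of k] integrable_err[OF e' z, of k]
    have "lerr k e z - lerr k e' z = (\<integral>v. err k e z v - err k e' z v \<partial>\<nu>)"
      unfolding lerr_def using i by simp
    then show "\<bar>lerr k e z - lerr k e' z\<bar> \<le> (\<integral>v. ?F (z(j := v)) \<partial>\<nu>)"
      unfolding eq using integral_abs_bound[of \<nu> "\<lambda>v. err k e z v - err k e' z v"] by simp
  qed
  also have "\<dots> = (\<integral>z. ?F z \<partial>law I)"
    by (rule resample_integral(2)[OF j(1) Fm Fb, symmetric])
  finally show ?thesis .
qed

lemma measurable_held_out:
  assumes "finite G" "G \<subseteq> I"
  shows "held_out k m G \<in> borel_measurable (law I)"
  unfolding held_out_def using assms
  by (intro borel_measurable_divide borel_measurable_sum measurable_err borel_measurable_const)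
    (auto intro: finite_subset)

lemma held_out_bounds:
  assumes "finite G" "G \<subseteq> I" "m < card G" "z \<in> space (law I)"
  shows "0 \<le> held_out k m G z" "held_out k m G z \<le> 1"
proof -
  have b: "0 \<le> err k e z (z i)" "err k e z (z i) \<le> 1" if "i \<in> G" for e i
    using err_bounds[OF label[OF coordinate[OF assms(4)]]] that assms(2) by auto
  show "0 \<le> held_out k m G z"
    unfolding held_out_def using b by (intro divide_nonneg_nonneg sum_nonneg) auto
  have "(\<Sum>e\<in>{e. e \<subseteq> G \<and> card e = m}. \<Sum>i\<in>G - e. err k e z (z i)) \<le> (\<Sum>e\<in>{e. e \<subseteq> G \<and> card e = m}. \<Sum>i\<in>G - e. 1)"
    using b by (intro sum_mono) auto
  also have "\<dots> = (\<Sum>e\<in>{e. e \<subseteq> G \<and> card e = m}. real (card G - m))"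
    using assms(1) by (intro sum.cong) (auto simp: card_Diff_subset finite_subset)
  also have "\<dots> = real (card G choose m) * real (card G - m)"
    by (simp add: n_subsets[OF assms(1)])
  finally show "held_out k m G z \<le> 1"
    unfolding held_out_def using assms(3) by (intro divide_le_eq_1[THEN iffD2]) auto
qed

lemma integrable_held_out:
  assumes "finite G" "G \<subseteq> I" "m < card G"
  shows "integrable (law I) (held_out k m G)"
  using held_out_bounds[OF assms] by (intro law.integrable_bounded[of _ _ 1] measurable_held_out assms) auto

text \<open>In expectation each held-out error becomes \<open>lerr\<close> of its training set. The
  spare coordinate \<open>j\<close> is a common test point for \<open>e\<close> and
  \<open>G\<close>, which brings the difference into the form bounded by
  \<open>err_subsample\<close>.\<close>

theorem held_out_bias:
  assumes G: "finite G" "G \<subseteq> I" and j: "j \<in> I" "j \<notin> G" and k: "k \<ge> 1" "k \<le> m" and m: "m < card G"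
  shows "\<bar>(\<integral>z. held_out k m G z \<partial>law I) - (\<integral>z. lerr k G z \<partial>law I)\<bar> \<le> real (card G - m) * sqrt (real k) / real (Suc m)"
proof -
  let ?E = "{e. e \<subseteq> G \<and> card e = m}"
  have cE: "card ?E = card G choose m" by (rule n_subsets[OF G(1)])
  have e: "finite e" "e \<subseteq> I" if "e \<in> ?E" for e using that G finite_subset[of e G] by auto
  have pos: "0 < real (card G choose m)" using m by simp
  define D where "D e = (\<integral>z. \<bar>err k e z (z j) - err k G z (z j)\<bar> \<partial>law I)" for e
  have "(\<integral>z. held_out k m G z \<partial>law I) = (\<Sum>e\<in>?E. \<Sum>i\<in>G - e. \<integral>z. err k e z (z i) \<partial>law I) / (real (card G choose m) * real (card G - m))"
    unfolding held_out_def using e G by (intro integral_double_sum(2) integrable_err_coordinate) auto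
  also have "(\<Sum>e\<in>?E. \<Sum>i\<in>G - e. \<integral>z. err k e z (z i) \<partial>law I) = (\<Sum>e\<in>?E. real (card G - m) * (\<integral>z. lerr k e z \<partial>law I))"
  proof (rule sum.cong[OF refl])
    fix e assume e': "e \<in> ?E"
    have "(\<Sum>i\<in>G - e. \<integral>z. err k e z (z i) \<partial>law I) = (\<Sum>i\<in>G - e. \<integral>z. lerr k e z \<partial>law I)"
      using e[OF e'] G by (intro sum.cong refl integral_err_coordinate) auto
    then show "(\<Sum>i\<in>G - e. \<integral>z. err k e z (z i) \<partial>law I) = real (card G - m) * (\<integral>z. lerr k e z \<partial>law I)"
      using e[OF e'] e' by (auto simp: card_Diff_subset)
  qed
  also have "\<dots> = real (card G - m) * (\<Sum>e\<in>?E. \<integral>z. lerr k e z \<partial>law I)"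
    by (rule sum_distrib_left[symmetric])
  finally have "(\<integral>z. held_out k m G z \<partial>law I) = (\<Sum>e\<in>?E. \<integral>z. lerr k e z \<partial>law I) / real (card G choose m)"
    using m by simp
  then have "(\<integral>z. held_out k m G z \<partial>law I) - (\<integral>z. lerr k G z \<partial>law I) = (\<Sum>e\<in>?E. (\<integral>z. lerr k e z \<partial>law I) - (\<integral>z. lerr k G z \<partial>law I)) / real (card G choose m)"
    using pos by (simp add: sum_subtractf cE diff_divide_distrib)
  also have "\<bar>\<dots>\<bar> \<le> (\<Sum>e\<in>?E. \<bar>(\<integral>z. lerr k e z \<partial>law I) - (\<integral>z. lerr k G z \<partial>law I)\<bar>) / real (card G choose m)"
    by (simp add: divide_right_mono sum_abs)
  also have "\<dots> \<le> (\<Sum>e\<in>?E. D e) / real (card G choose m)"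
  proof (intro divide_right_mono sum_mono)
    fix e assume e': "e \<in> ?E"
    have je: "j \<notin> e" using e' j by auto
    have "(\<integral>z. lerr k e z \<partial>law I) - (\<integral>z. lerr k G z \<partial>law I) = (\<integral>z. err k e z (z j) - err k G z (z j) \<partial>law I)"
      using integrable_err_coordinate[OF e[OF e'] j(1), of k] integrable_err_coordinate[OF G j(1), of k]
      by (simp add: integral_err_coordinate[OF e[OF e'] j(1) je] integral_err_coordinate[OF G j])
    then show "\<bar>(\<integral>z. lerr k e z \<partial>law I) - (\<integral>z. lerr k G z \<partial>law I)\<bar> \<le> D e"
      unfolding D_def using integral_abs_bound[of "law I" "\<lambda>z. err k e z (z j) - err k G z (z j)"] by simp
  qed simp
  also have "\<dots> \<le> real (card G - m) * sqrt (real k) / real (Suc m)"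
    using err_subsample[OF G j k] m pos unfolding D_def by (simp add: divide_le_eq mult.commute del: of_nat_Suc)
  finally show ?thesis .
qed

text \<open>For a held-out point \<open>i\<close> the sets \<open>e\<close> are compared with
  \<open>G - {i}\<close>, so \<open>err_subsample\<close> is applied to a sample of
  \<open>card G - 1\<close> points with \<open>i\<close> as the test point. For
  \<open>m = card G - p\<close> this leaves \<open>p - 1\<close> deletions.\<close>

lemma held_out_loo_diff:
  assumes G: "finite G" "G \<subseteq> I" and k: "k \<ge> 1" "k \<le> m" and m: "m < card G"
  shows "(\<integral>z. \<bar>held_out k m G z - loo k G z\<bar> \<partial>law I) \<le> real (card G - 1 - m) * sqrt (real k) / real (Suc m)"
proof -
  let ?n = "card G" and ?E = "\<lambda>i. {e. e \<subseteq> G - {i} \<and> card e = m}"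
  let ?C = "real ((?n - 1) choose m)"
  have n0: "0 < real ?n" using m by simp
  have C0: "0 < ?C" using m by simp
  have cE: "real (card (?E i)) = ?C" if "i \<in> G" for i using n_subsets[of "G - {i}" m] G that by simp
  have fe: "finite e" "e \<subseteq> I" if "e \<in> ?E i" for e i using that G finite_subset[of e "G - {i}"] by auto
  define d where "d i e z = \<bar>err k e z (z i) - err k (G - {i}) z (z i)\<bar>" for i e and z :: "nat \<Rightarrow> (real ^ 'd) \<times> nat"
  have di: "integrable (law I) (d i e)" if "i \<in> G" "e \<in> ?E i" for i e
    unfolding d_def using that fe[OF that(2)] G by (intro integrable_err_diff) auto
  have le: "\<bar>held_out k m G z - loo k G z\<bar> \<le> (\<Sum>i\<in>G. \<Sum>e\<in>?E i. d i e z) / (real ?n * ?C)" for z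
  proof -
    have "held_out k m G z = (\<Sum>i\<in>G. \<Sum>e\<in>?E i. err k e z (z i)) / (real ?n * ?C)"
      unfolding held_out_def sum_held_out_swap[OF G(1)] of_nat_mult[symmetric] binomial_remove ..
    moreover have "loo k G z = (\<Sum>i\<in>G. \<Sum>e\<in>?E i. err k (G - {i}) z (z i)) / (real ?n * ?C)"
    proof -
      have "(\<Sum>i\<in>G. \<Sum>e\<in>?E i. err k (G - {i}) z (z i)) = ?C * (\<Sum>i\<in>G. err k (G - {i}) z (z i))"
        using cE by (simp add: sum_distrib_left)
      then show ?thesis unfolding loo_def using C0 by simp
    qed
    ultimately have eq: "held_out k m G z - loo k G z = (\<Sum>i\<in>G. \<Sum>e\<in>?E i. err k e z (z i) - err k (G - {i}) z (z i)) / (real ?n * ?C)"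
      by (simp add: sum_subtractf diff_divide_distrib)
    have "\<bar>held_out k m G z - loo k G z\<bar> = \<bar>\<Sum>i\<in>G. \<Sum>e\<in>?E i. err k e z (z i) - err k (G - {i}) z (z i)\<bar> / (real ?n * ?C)"
      unfolding eq by simp
    also have "\<dots> \<le> (\<Sum>i\<in>G. \<Sum>e\<in>?E i. d i e z) / (real ?n * ?C)"
      unfolding d_def by (intro divide_right_mono order_trans[OF sum_abs] sum_mono order_trans[OF sum_abs]) auto
    finally show ?thesis .
  qed
  have "(\<integral>z. \<bar>held_out k m G z - loo k G z\<bar> \<partial>law I) \<le> (\<integral>z. (\<Sum>i\<in>G. \<Sum>e\<in>?E i. d i e z) / (real ?n * ?C) \<partial>law I)"
    using integral_double_sum(1)[where f = d and A = G and B = ?E, OF di] order_trans[OF abs_ge_zero le] le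
    by (intro integral_mono_AE' AE_I2) simp_all
  also have "\<dots> = (\<Sum>i\<in>G. \<Sum>e\<in>?E i. \<integral>z. d i e z \<partial>law I) / (real ?n * ?C)"
    using di by (rule integral_double_sum(2))
  also have "\<dots> \<le> (\<Sum>i\<in>G. ?C * (real (?n - 1 - m) * sqrt (real k) / real (Suc m))) / (real ?n * ?C)"
  proof (intro divide_right_mono sum_mono)
    fix i assume i: "i \<in> G"
    show "(\<Sum>e\<in>?E i. \<integral>z. d i e z \<partial>law I) \<le> ?C * (real (?n - 1 - m) * sqrt (real k) / real (Suc m))"
    proof -
      have c: "card (G - {i}) = ?n - 1" using G(1) i by simp
      have "m \<le> ?n - 1" using m by simp
      then show ?thesis
        using err_subsample[of "G - {i}" I i k m] G i k unfolding d_def c by blast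
    qed
  qed auto
  also have "\<dots> = real (?n - 1 - m) * sqrt (real k) / real (Suc m)"
    using n0 C0 by (simp del: of_nat_Suc)
  finally show ?thesis .
qed

lemma lerr_stability:
  assumes fin: "finite e" and e: "e \<subseteq> I" and j: "j \<in> I" "j \<notin> e" and k: "k \<le> card e" "k \<ge> 1"
  shows "(\<Sum>i\<in>e. \<integral>z. \<bar>lerr k e z - lerr k (e - {i}) z\<bar> \<partial>law I) \<le> sqrt (real k)"
proof -
  have "(\<Sum>i\<in>e. \<integral>z. \<bar>lerr k e z - lerr k (e - {i}) z\<bar> \<partial>law I) \<le> (\<Sum>i\<in>e. \<integral>z. \<bar>err k e z (z j) - err k (e - {i}) z (z j)\<bar> \<partial>law I)"
    using fin e j by (intro sum_mono integral_lerr_diff_le) auto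
  also have "\<dots> \<le> sqrt (real k)" by (rule err_stability[OF fin e j k])
  finally show ?thesis .
qed

text \<open>With \<open>i\<close> outside \<open>g\<close> and different from \<open>j\<close>, the
  second factor and \<open>lerr\<close> do not depend on the value at \<open>i\<close>; averaging
  over that value centres the first factor.\<close>

lemma integral_centered_product:
  assumes g: "finite g" "g \<subseteq> I" and i: "i \<in> I" "i \<notin> g" and j: "j \<in> I" and ij: "i \<noteq> j"
  shows "(\<integral>z. (err k g z (z i) - lerr k g z) * (err k g z (z j) - lerr k g z) \<partial>law I) = 0"
proof -
  let ?F = "\<lambda>z. (err k g z (z i) - lerr k g z) * (err k g z (z j) - lerr k g z)"
  have Fm: "?F \<in> borel_measurable (law I)"
    using measurable_err[OF g i(1), of k] measurable_err[OF g j, of k] measurable_lerr[OF g, of k] by simp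
  have Fb: "\<bar>?F z\<bar> \<le> 1" if z: "z \<in> space (law I)" for z
  proof -
    have b: "\<bar>err k g z (z l) - lerr k g z\<bar> \<le> 1" if "l \<in> I" for l
      using err_bounds[OF label[OF coordinate[OF z that]], of k g z] lerr_bounds[OF g z, of k] by auto
    show ?thesis unfolding abs_mult using b[OF i(1)] b[OF j] by (intro mult_le_one) auto
  qed
  have "(\<integral>z. ?F z \<partial>law I) = (\<integral>z. (\<integral>v. ?F (z(i := v)) \<partial>\<nu>) \<partial>law I)"
    by (rule resample_integral(2)[OF i(1) Fm Fb])
  also have "\<dots> = (\<integral>z. 0 \<partial>law I)"
  proof (rule Bochner_Integration.integral_cong[OF refl])
    fix z assume z: "z \<in> space (law I)"
    have *: "?F (z(i := v)) = (err k g z v - lerr k g z) * (err k g z (z j) - lerr k g z)" for v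
    proof -
      have "err k g (z(i := v)) x = err k g z x" for x using i(2) by (intro err_cong) auto
      moreover have "lerr k g (z(i := v)) = lerr k g z" using i(2) by (intro lerr_cong) auto
      ultimately show ?thesis using ij by simp
    qed
    have "(\<integral>v. ?F (z(i := v)) \<partial>\<nu>) = (\<integral>v. (err k g z v - lerr k g z) * (err k g z (z j) - lerr k g z) \<partial>\<nu>)"
      by (simp only: *)
    also have "\<dots> = (\<integral>v. err k g z v - lerr k g z \<partial>\<nu>) * (err k g z (z j) - lerr k g z)"
      by simp
    also have "(\<integral>v. err k g z v - lerr k g z \<partial>\<nu>) = 0"
      using integrable_err[OF g z, of k] by (simp add: lerr_def prob_space)
    finally show "(\<integral>v. ?F (z(i := v)) \<partial>\<nu>) = 0" by (simp only: mult_zero_left)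
  qed
  finally show ?thesis by simp
qed

lemma product_perturb:
  fixes a b a' b' :: real
  assumes "\<bar>a\<bar> \<le> 1" "\<bar>b'\<bar> \<le> 1"
  shows "a * b - a' * b' \<le> \<bar>a - a'\<bar> + \<bar>b - b'\<bar>"
proof -
  have "a * b - a' * b' = a * (b - b') + (a - a') * b'" by (simp add: algebra_simps)
  also have "\<dots> \<le> \<bar>a\<bar> * \<bar>b - b'\<bar> + \<bar>a - a'\<bar> * \<bar>b'\<bar>"
    by (metis abs_ge_self abs_mult add_mono)
  also have "\<dots> \<le> 1 * \<bar>b - b'\<bar> + \<bar>a - a'\<bar> * 1"
    using assms by (intro add_mono mult_right_mono mult_left_mono) auto
  finally show ?thesis by simp
qed

text \<open>With \<open>n = card G\<close>, the diagonal of the expanded square contributes at most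
  \<open>n\<close>. A product \<open>a i * a j\<close> is compared with
  \<open>b i j * b j i\<close>, whose expectation vanishes. The price is three deletions per factor,
  each kind summing to at most \<open>n * sqrt k\<close> over all pairs; two factors give the
  constant 6.\<close>

theorem loo_lerr_mse:
  assumes G: "finite G" "G \<subseteq> I" and j0: "j0 \<in> I" "j0 \<notin> G" and k: "k \<ge> 1" "k \<le> card G - 1"
  shows "(\<integral>z. (loo k G z - lerr k G z)\<^sup>2 \<partial>law I) \<le> (1 + 6 * sqrt (real k)) / real (card G)"
proof -
  let ?n = "real (card G)"
  have n0: "0 < ?n" using k by (cases "card G") auto
  define a where "a i z = err k (G - {i}) z (z i) - lerr k G z" for i and z :: "nat \<Rightarrow> (real ^ 'd) \<times> nat"
  define b where "b i j z = err k (G - {i} - {j}) z (z i) - lerr k (G - {i} - {j}) z" for i j and z :: "nat \<Rightarrow> (real ^ 'd) \<times> nat"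
  define \<delta> where "\<delta> i j = (\<integral>z. \<bar>err k (G - {i}) z (z i) - err k (G - {i} - {j}) z (z i)\<bar> \<partial>law I)" for i j
  define \<tau>1 where "\<tau>1 i = (\<integral>z. \<bar>lerr k G z - lerr k (G - {i}) z\<bar> \<partial>law I)" for i
  define \<tau>2 where "\<tau>2 i j = (\<integral>z. \<bar>lerr k (G - {i}) z - lerr k (G - {i} - {j}) z\<bar> \<partial>law I)" for i j
  \<comment> \<open>The term \<open>\<delta>\<close> deletes \<open>j\<close> from the training set
    of the error; \<open>\<tau>1\<close> and \<open>\<tau>2\<close> delete \<open>i\<close> and then
    \<open>j\<close> from that of its mean.\<close>
  define c where "c i j = \<delta> i j + \<tau>1 i + \<tau>2 i j" for i j
  have sub: "finite (G - {i})" "G - {i} \<subseteq> I" "finite (G - {i} - {j})" "G - {i} - {j} \<subseteq> I" for i j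
    using G by auto
  have GI: "i \<in> I" if "i \<in> G" for i using that G by auto
  have cent_le: "\<bar>err k e z (z i) - lerr k e' z\<bar> \<le> 1" if "i \<in> G" "finite e'" "e' \<subseteq> I" "z \<in> space (law I)" for e e' i z
    using err_bounds[OF label[OF coordinate[OF that(4) GI[OF that(1)]]], of k e z] lerr_bounds[OF that(2,3,4), of k] by auto
  have ab: "\<bar>a i z\<bar> \<le> 1" "\<bar>b i j z\<bar> \<le> 1" if "i \<in> G" "z \<in> space (law I)" for i j z
    unfolding a_def b_def using cent_le[OF that(1) _ _ that(2)] sub G by auto
  have am: "a i \<in> borel_measurable (law I)" "b i j \<in> borel_measurable (law I)" if "i \<in> G" for i j
    unfolding a_def b_def using sub G GI[OF that]
    by (auto intro!: borel_measurable_diff measurable_err measurable_lerr)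
  have pi: "integrable (law I) (\<lambda>z. a i z * a j z)" "integrable (law I) (\<lambda>z. b i j z * b j i z)"
    if "i \<in> G" "j \<in> G" for i j
  proof -
    show "integrable (law I) (\<lambda>z. a i z * a j z)"
      using ab that am by (intro law.integrable_bounded[of _ _ 1]) (auto simp: abs_mult intro!: mult_le_one)
    show "integrable (law I) (\<lambda>z. b i j z * b j i z)"
      using ab that am by (intro law.integrable_bounded[of _ _ 1]) (auto simp: abs_mult intro!: mult_le_one)
  qed
  have di: "integrable (law I) (\<lambda>z. \<bar>a i z - b i j z\<bar>)" if "i \<in> G" for i j
  proof (rule law.integrable_bounded[of _ _ 2])
    show "(\<lambda>z. \<bar>a i z - b i j z\<bar>) \<in> borel_measurable (law I)" using am[OF that] by simp
    show "\<bar>\<bar>a i z - b i j z\<bar>\<bar> \<le> 2" if "z \<in> space (law I)" for z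
      using ab(1)[OF \<open>i \<in> G\<close> that] ab(2)[OF \<open>i \<in> G\<close> that, of j] by (simp add: abs_le_iff)
  qed
  have dc: "(\<integral>z. \<bar>a i z - b i j z\<bar> \<partial>law I) \<le> c i j" if i: "i \<in> G" for i j
  proof -
    have i1: "integrable (law I) (\<lambda>z. \<bar>err k (G - {i}) z (z i) - err k (G - {i} - {j}) z (z i)\<bar>)"
      using sub GI[OF i] by (intro integrable_err_diff)
    have i2: "integrable (law I) (\<lambda>z. \<bar>lerr k G z - lerr k (G - {i}) z\<bar>)"
      "integrable (law I) (\<lambda>z. \<bar>lerr k (G - {i}) z - lerr k (G - {i} - {j}) z\<bar>)"
      by (rule integrable_abs[OF Bochner_Integration.integrable_diff[OF integrable_lerr[OF G] integrable_lerr[OF sub(1,2)]]],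
          rule integrable_abs[OF Bochner_Integration.integrable_diff[OF integrable_lerr[OF sub(1,2)] integrable_lerr[OF sub(3,4)]]])
    have "(\<integral>z. \<bar>a i z - b i j z\<bar> \<partial>law I) \<le> (\<integral>z. (\<bar>err k (G - {i}) z (z i) - err k (G - {i} - {j}) z (z i)\<bar> + \<bar>lerr k G z - lerr k (G - {i}) z\<bar>)
       + \<bar>lerr k (G - {i}) z - lerr k (G - {i} - {j}) z\<bar> \<partial>law I)"
      using i1 i2 di[OF i] by (intro integral_mono Bochner_Integration.integrable_add) (auto simp: a_def b_def)
    also have "\<dots> = c i j"
      unfolding c_def \<delta>_def \<tau>1_def \<tau>2_def using i1 i2
      by (simp add: Bochner_Integration.integral_add Bochner_Integration.integrable_add)
    finally show ?thesis .
  qed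
  have off: "(\<integral>z. a i z * a j z \<partial>law I) \<le> c i j + c j i" if ij: "i \<in> G" "j \<in> G - {i}" for i j
  proof -
    have j: "j \<in> G" "j \<noteq> i" using ij by auto
    have swap: "G - {j} - {i} = G - {i} - {j}" by blast
    have "(\<integral>z. b i j z * b j i z \<partial>law I) = 0"
      unfolding b_def swap using sub GI ij j by (intro integral_centered_product) auto
    then have "(\<integral>z. a i z * a j z \<partial>law I) = (\<integral>z. a i z * a j z - b i j z * b j i z \<partial>law I)"
      using pi[OF ij(1) j(1)] by simp
    also have "\<dots> \<le> (\<integral>z. \<bar>a i z - b i j z\<bar> + \<bar>a j z - b j i z\<bar> \<partial>law I)"
      using pi[OF ij(1) j(1)] di ij j ab
      by (intro integral_mono Bochner_Integration.integrable_add Bochner_Integration.integrable_diff product_perturb) auto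
    also have "\<dots> = (\<integral>z. \<bar>a i z - b i j z\<bar> \<partial>law I) + (\<integral>z. \<bar>a j z - b j i z\<bar> \<partial>law I)"
      using di ij j by (intro Bochner_Integration.integral_add) auto
    also have "\<dots> \<le> c i j + c j i" using dc ij j by (intro add_mono) auto
    finally show ?thesis .
  qed
  have diag: "(\<integral>z. a i z * a i z \<partial>law I) \<le> 1" if "i \<in> G" for i
  proof -
    have "(\<integral>z. a i z * a i z \<partial>law I) \<le> (\<integral>z. 1 \<partial>law I)"
    proof (rule integral_mono[OF pi(1)[OF that that]])
      show "a i z * a i z \<le> 1" if "z \<in> space (law I)" for z
        using ab(1)[OF \<open>i \<in> G\<close> that] by (metis abs_mult_self_eq abs_ge_zero mult_le_one)
    qed simp
    then show ?thesis by (simp add: law.prob_space)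
  qed
  have sum_c: "(\<Sum>i\<in>G. \<Sum>j\<in>G - {i}. c i j) \<le> 3 * ?n * sqrt (real k)"
  proof -
    \<comment> \<open>The term \<open>\<tau>1 i\<close> does not involve \<open>j\<close>: it is
      counted \<open>n\<close> times here, and stability is used for it only when summing over
      \<open>i\<close>.\<close>
    have "(\<Sum>j\<in>G - {i}. c i j) \<le> 2 * sqrt (real k) + ?n * \<tau>1 i" if i: "i \<in> G" for i
    proof -
      have l0: "0 \<le> \<tau>1 i" unfolding \<tau>1_def by (intro integral_nonneg_AE) auto
      have "(\<Sum>j\<in>G - {i}. \<delta> i j) \<le> sqrt (real k)" unfolding \<delta>_def
        using sub GI[OF i] i G(1) k by (intro err_stability) auto
      moreover have "(\<Sum>j\<in>G - {i}. \<tau>2 i j) \<le> sqrt (real k)" unfolding \<tau>2_def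
        using sub GI[OF i] i G(1) k by (intro lerr_stability[of _ _ i]) auto
      moreover have "(\<Sum>j\<in>G - {i}. \<tau>1 i) \<le> ?n * \<tau>1 i"
        using l0 i G(1) by (auto intro!: mult_right_mono)
      ultimately show ?thesis unfolding c_def by (simp only: sum.distrib)
    qed
    then have "(\<Sum>i\<in>G. \<Sum>j\<in>G - {i}. c i j) \<le> (\<Sum>i\<in>G. 2 * sqrt (real k) + ?n * \<tau>1 i)"
      by (rule sum_mono)
    also have "\<dots> = 2 * ?n * sqrt (real k) + ?n * (\<Sum>i\<in>G. \<tau>1 i)"
      by (simp add: sum.distrib sum_distrib_left)
    also have "\<dots> \<le> 2 * ?n * sqrt (real k) + ?n * sqrt (real k)"
      unfolding \<tau>1_def using k by (intro add_left_mono mult_left_mono lerr_stability[OF G j0]) auto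
    finally show ?thesis by simp
  qed
  have "(loo k G z - lerr k G z)\<^sup>2 = (\<Sum>i\<in>G. \<Sum>j\<in>G. a i z * a j z) / ?n\<^sup>2" for z
  proof -
    have "loo k G z - lerr k G z = (\<Sum>i\<in>G. a i z) / ?n"
      using n0 by (simp add: loo_def a_def sum_subtractf diff_divide_distrib)
    then show ?thesis by (simp add: power_divide power2_eq_square sum_product)
  qed
  then have "(\<integral>z. (loo k G z - lerr k G z)\<^sup>2 \<partial>law I) = (\<Sum>i\<in>G. \<Sum>j\<in>G. \<integral>z. a i z * a j z \<partial>law I) / ?n\<^sup>2"
    using integral_double_sum(2)[where f = "\<lambda>i j z. a i z * a j z" and A = G and B = "\<lambda>_. G" and c = "?n\<^sup>2", OF pi(1)] by simp
  also have "\<dots> \<le> (?n + 6 * ?n * sqrt (real k)) / ?n\<^sup>2"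
  proof (rule divide_right_mono)
    have "(\<Sum>i\<in>G. \<Sum>j\<in>G. \<integral>z. a i z * a j z \<partial>law I) = (\<Sum>i\<in>G. (\<integral>z. a i z * a i z \<partial>law I) + (\<Sum>j\<in>G - {i}. \<integral>z. a i z * a j z \<partial>law I))"
      using G(1) by (intro sum.cong refl sum.remove)
    also have "\<dots> \<le> (\<Sum>i\<in>G. 1 + (\<Sum>j\<in>G - {i}. c i j + c j i))"
      using diag off by (intro sum_mono add_mono) auto
    also have "\<dots> = ?n + ((\<Sum>i\<in>G. \<Sum>j\<in>G - {i}. c i j) + (\<Sum>i\<in>G. \<Sum>j\<in>G - {i}. c j i))"
      by (simp add: sum.distrib)
    also have "(\<Sum>i\<in>G. \<Sum>j\<in>G - {i}. c j i) = (\<Sum>i\<in>G. \<Sum>j\<in>G - {i}. c i j)"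
      by (rule sum_off_diagonal_swap[OF G(1), symmetric])
    finally show "(\<Sum>i\<in>G. \<Sum>j\<in>G. \<integral>z. a i z * a j z \<partial>law I) \<le> ?n + 6 * ?n * sqrt (real k)"
      using sum_c by linarith
  qed simp
  also have "\<dots> = (1 + 6 * sqrt (real k)) / ?n"
    using n0 by (simp add: field_simps power2_eq_square)
  finally show ?thesis .
qed

text \<open>For numbers in the unit interval \<open>(r - l)\<^sup>2 - (s - l)\<^sup>2 = (r - s) * (r
  + s - 2 * l)\<close> is at most \<open>2 * \<bar>r - s\<bar>\<close>, so the mean absolute
  distance to \<open>loo\<close> suffices.\<close>

theorem held_out_lerr_mse:
  assumes G: "finite G" "G \<subseteq> I" and j0: "j0 \<in> I" "j0 \<notin> G" and k: "k \<ge> 1" "k \<le> m" and m: "m < card G"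
  shows "(\<integral>z. (held_out k m G z - lerr k G z)\<^sup>2 \<partial>law I)
    \<le> 2 * (real (card G - 1 - m) * sqrt (real k) / real (Suc m)) + (1 + 6 * sqrt (real k)) / real (card G)"
proof -
  have "G \<noteq> {}" using m by auto
  then have loo: "loo k G z = held_out k (card G - 1) G z" for z :: "nat \<Rightarrow> (real ^ 'd) \<times> nat"
    by (rule loo_eq_held_out[OF G(1)])
  have bd: "0 \<le> held_out k m G z" "held_out k m G z \<le> 1" "0 \<le> loo k G z" "loo k G z \<le> 1" "0 \<le> lerr k G z" "lerr k G z \<le> 1"
    if "z \<in> space (law I)" for z
    unfolding loo using held_out_bounds[OF G _ that] lerr_bounds[OF G that] m by auto
  have ms: "held_out k m G \<in> borel_measurable (law I)" "(\<lambda>z. loo k G z) \<in> borel_measurable (law I)" "lerr k G \<in> borel_measurable (law I)"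
    unfolding loo using measurable_held_out[OF G] measurable_lerr[OF G] by auto
  have sq: "x\<^sup>2 \<le> 1" if "\<bar>x\<bar> \<le> 1" for x :: real using that by (simp add: abs_square_le_1)
  have i1: "integrable (law I) (\<lambda>z. (held_out k m G z - lerr k G z)\<^sup>2)"
    using ms bd by (intro law.integrable_bounded[of _ _ 1]) (auto intro!: sq simp: abs_le_iff, (smt (verit))+)
  have i2: "integrable (law I) (\<lambda>z. (loo k G z - lerr k G z)\<^sup>2)"
    using ms bd by (intro law.integrable_bounded[of _ _ 1]) (auto intro!: sq simp: abs_le_iff, (smt (verit))+)
  have i3: "integrable (law I) (\<lambda>z. \<bar>held_out k m G z - loo k G z\<bar>)"
    using ms bd by (intro law.integrable_bounded[of _ _ 1]) (auto simp: abs_le_iff, (smt (verit))+)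
  have "(\<integral>z. (held_out k m G z - lerr k G z)\<^sup>2 \<partial>law I) \<le> (\<integral>z. 2 * \<bar>held_out k m G z - loo k G z\<bar> + (loo k G z - lerr k G z)\<^sup>2 \<partial>law I)"
  proof (rule integral_mono[OF i1])
    show "integrable (law I) (\<lambda>z. 2 * \<bar>held_out k m G z - loo k G z\<bar> + (loo k G z - lerr k G z)\<^sup>2)"
      using i2 i3 by simp
    fix z assume z: "z \<in> space (law I)"
    let ?r = "held_out k m G z" and ?s = "loo k G z" and ?l = "lerr k G z"
    have "(?r - ?l)\<^sup>2 - (?s - ?l)\<^sup>2 = (?r - ?s) * (?r + ?s - 2 * ?l)" by (simp add: power2_eq_square algebra_simps)
    also have "\<dots> \<le> \<bar>?r - ?s\<bar> * \<bar>?r + ?s - 2 * ?l\<bar>" by (metis abs_ge_self abs_mult)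
    also have "\<dots> \<le> \<bar>?r - ?s\<bar> * 2" using bd[OF z] by (intro mult_left_mono) (auto simp: abs_le_iff)
    finally show "(?r - ?l)\<^sup>2 \<le> 2 * \<bar>?r - ?s\<bar> + (?s - ?l)\<^sup>2" by simp
  qed
  also have "\<dots> = 2 * (\<integral>z. \<bar>held_out k m G z - loo k G z\<bar> \<partial>law I) + (\<integral>z. (loo k G z - lerr k G z)\<^sup>2 \<partial>law I)"
    using i2 i3 by simp
  also have "\<dots> \<le> 2 * (real (card G - 1 - m) * sqrt (real k) / real (Suc m)) + (1 + 6 * sqrt (real k)) / real (card G)"
    using held_out_loo_diff[OF G k m] loo_lerr_mse[OF G j0 k(1)] k m by (intro add_mono mult_left_mono) auto
  finally show ?thesis .
qed

end

section \<open>Variance of the held-out error\<close>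

lemma sum_of_squares_pos: "0 \<le> (\<Sum>i\<in>A. (g i)\<^sup>2)" for g :: "'i \<Rightarrow> real"
  by (intro sum_nonneg) auto

text \<open>For \<open>q = 2\<close> the constant is \<open>4 * \<kappa>\<close>, the left-hand norm
  is a standard deviation, and the norm of order \<open>q / 2\<close> is a plain expectation because
  its argument is nonnegative.\<close>

lemma moment_constant_sqrt:
  fixes D :: "'u measure" and f :: "(nat \<Rightarrow> 'u) \<Rightarrow> real"
  assumes mc: "moment_constant TYPE('u) \<kappa>" and D: "prob_space D"
    and f: "f \<in> borel_measurable (PiM {1..N} (\<lambda>_. D))"
    and bd: "\<And>z. z \<in> space (PiM {1..N} (\<lambda>_. D)) \<Longrightarrow> \<bar>f z\<bar> \<le> 1"
  shows "sqrt (\<integral>z. (f z - integral\<^sup>L (PiM {1..N} (\<lambda>_. D)) f)\<^sup>2 \<partial>PiM {1..N} (\<lambda>_. D))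
    \<le> sqrt (4 * \<kappa>) * sqrt (\<integral>w. (\<Sum>i\<in>{1..N}. (f (fst w) - f ((fst w)(i := snd w i)))\<^sup>2)
        \<partial>(PiM {1..N} (\<lambda>_. D) \<Otimes>\<^sub>M PiM {1..N} (\<lambda>_. D)))"
proof -
  let ?P = "PiM {1..N} (\<lambda>_. D)"
  interpret D: prob_space D by fact
  interpret P: prob_space ?P by (rule D.prob_space_PiM_const)
  have int: "integrable ?P (\<lambda>z. \<bar>f z\<bar> powr 2)"
  proof (rule P.integrable_bounded[of _ 1])
    show "(\<lambda>z. \<bar>f z\<bar> powr 2) \<in> borel_measurable ?P" using f by measurable
    show "\<bar>\<bar>f z\<bar> powr 2\<bar> \<le> 1" if "z \<in> space ?P" for z
      using bd[OF that] by (simp add: abs_square_le_1)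
  qed
  have h: "(\<forall>i. prob_space (D' i)) \<longrightarrow>
        (let P = \<Pi>\<^sub>M i\<in>{1..N}. D' i in
           f \<in> borel_measurable P \<longrightarrow> integrable P (\<lambda>u. \<bar>f u\<bar> powr 2) \<longrightarrow>
           lq_norm 2 P (\<lambda>u. f u - integral\<^sup>L P f) \<le>
             sqrt (2 * \<kappa> * 2) *
             sqrt (lq_norm (2 / 2) (P \<Otimes>\<^sub>M P)
                     (\<lambda>(u, u'). \<Sum>i\<in>{1..N}. (f u - f (u(i := u' i)))\<^sup>2)))" for D' :: "nat \<Rightarrow> 'u measure"
    using mc unfolding moment_constant_def by (elim conjE allE[of _ "2::real"]) auto
  have "lq_norm 2 ?P (\<lambda>u. f u - integral\<^sup>L ?P f) \<le>
             sqrt (2 * \<kappa> * 2) *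
             sqrt (lq_norm (2 / 2) (?P \<Otimes>\<^sub>M ?P)
                     (\<lambda>(u, u'). \<Sum>i\<in>{1..N}. (f u - f (u(i := u' i)))\<^sup>2))"
    using h[of "\<lambda>_. D"] D f int by (simp add: Let_def)
  moreover have "lq_norm 2 ?P (\<lambda>u. f u - integral\<^sup>L ?P f) = sqrt (\<integral>z. (f z - integral\<^sup>L ?P f)\<^sup>2 \<partial>?P)"
  proof -
    have "0 \<le> (\<integral>z. (f z - integral\<^sup>L ?P f)\<^sup>2 \<partial>?P)" by (intro integral_nonneg_AE) auto
    then show ?thesis unfolding lq_norm_def by (simp add: powr_half_sqrt)
  qed
  moreover have "lq_norm (2 / 2) (?P \<Otimes>\<^sub>M ?P) (\<lambda>(u, u'). \<Sum>i\<in>{1..N}. (f u - f (u(i := u' i)))\<^sup>2)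
      = (\<integral>w. (\<Sum>i\<in>{1..N}. (f (fst w) - f ((fst w)(i := snd w i)))\<^sup>2) \<partial>(?P \<Otimes>\<^sub>M ?P))"
  proof -
    have "0 \<le> (\<integral>w. (\<Sum>i\<in>{1..N}. (f (fst w) - f ((fst w)(i := snd w i)))\<^sup>2) \<partial>(?P \<Otimes>\<^sub>M ?P))"
      by (intro integral_nonneg_AE AE_I2 sum_of_squares_pos)
    then show ?thesis
      unfolding lq_norm_def by (simp add: case_prod_unfold abs_of_nonneg[OF sum_of_squares_pos])
  qed
  ultimately show ?thesis by (simp add: mult.commute)
qed

text \<open>The variance of the tie-breaking variables is not covered by the moment inequality, but the
  final bound is proportional to \<open>\<kappa>\<close>, so \<open>\<kappa>\<close> has to be bounded from below; a fair coin suffices.\<close>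

lemma moment_constant_ge:
  assumes "moment_constant TYPE((real ^ 'd) \<times> nat) \<kappa>"
  shows "\<kappa> \<ge> 1 / 16"
proof -
  let ?u = "(0, 0) :: (real ^ 'd) \<times> nat" and ?v = "(0, 1) :: (real ^ 'd) \<times> nat"
  define D where "D = measure_pmf (pmf_of_set {?u, ?v})"
  interpret D: prob_space D unfolding D_def by (rule measure_pmf.prob_space_axioms)
  interpret D': product_prob_space "\<lambda>_::nat. D" UNIV by unfold_locales
  let ?P = "PiM {1..1::nat} (\<lambda>_. D)"
  interpret P: prob_space ?P by (rule D.prob_space_PiM_const)
  interpret PP: pair_prob_space ?P ?P by unfold_locales
  \<comment> \<open>A fair coin flip has variance 1/4 and squared increments at most 1, so the
    inequality yields \<open>1 / 2 \<le> sqrt (4 * \<kappa>)\<close>.\<close>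
  define f where "f z = (of_bool (z 1 = ?u) :: real)" for z :: "nat \<Rightarrow> (real ^ 'd) \<times> nat"
  have f: "f \<in> borel_measurable ?P"
    unfolding f_def
  proof (rule measurable_compose[of "\<lambda>z. z 1" ?P D])
    show "(\<lambda>x. of_bool (x = ?u) :: real) \<in> borel_measurable D" by (simp add: D_def)
  qed simp
  have "integral\<^sup>L ?P f = (\<integral>x. of_bool (x = ?u) \<partial>D)"
    unfolding f_def atLeastAtMost_singleton by (rule D'.product_integral_singleton) (simp add: D_def)
  also have "\<dots> = (\<Sum>x\<in>{?u, ?v}. of_bool (x = ?u) / real (card {?u, ?v}))"
    unfolding D_def by (subst integral_pmf_of_set) (auto simp: sum_divide_distrib)
  finally have m: "integral\<^sup>L ?P f = 1 / 2" by simp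
  have sq: "(f z - 1 / 2)\<^sup>2 = 1 / 4" for z by (simp add: f_def power2_eq_square)
  have "(\<integral>z. (f z - integral\<^sup>L ?P f)\<^sup>2 \<partial>?P) = (\<integral>z. 1 / 4 \<partial>?P)" unfolding m sq ..
  also have "\<dots> = 1 / 4" using P.prob_space by simp
  finally have var: "(\<integral>z. (f z - integral\<^sup>L ?P f)\<^sup>2 \<partial>?P) = 1 / 4" .
  have "(\<integral>w. (\<Sum>i\<in>{1..1}. (f (fst w) - f ((fst w)(i := snd w i)))\<^sup>2) \<partial>(?P \<Otimes>\<^sub>M ?P)) \<le> (\<integral>w. 1 \<partial>(?P \<Otimes>\<^sub>M ?P))"
  proof (rule integral_mono_AE')
    show "integrable (?P \<Otimes>\<^sub>M ?P) (\<lambda>_. 1 :: real)" by (rule PP.integrable_const)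
  qed (auto simp: f_def)
  then have es: "(\<integral>w. (\<Sum>i\<in>{1..1}. (f (fst w) - f ((fst w)(i := snd w i)))\<^sup>2) \<partial>(?P \<Otimes>\<^sub>M ?P)) \<le> 1"
    using PP.prob_space by simp
  let ?E = "\<integral>w. (\<Sum>i\<in>{1..1}. (f (fst w) - f ((fst w)(i := snd w i)))\<^sup>2) \<partial>(?P \<Otimes>\<^sub>M ?P)"
  have "sqrt (1 / 4) \<le> sqrt (4 * \<kappa>) * sqrt ?E"
    unfolding var[symmetric] by (rule moment_constant_sqrt[OF assms D.prob_space_axioms f]) (simp add: f_def)
  moreover have E0: "0 \<le> ?E" by (intro integral_nonneg_AE AE_I2 sum_of_squares_pos)
  moreover have half: "sqrt (1 / 4) = (1 / 2 :: real)" by (simp add: real_sqrt_divide)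
  ultimately have h: "1 / 2 \<le> sqrt (4 * \<kappa>) * sqrt ?E" by simp
  have k0: "0 < 4 * \<kappa>"
  proof (rule ccontr)
    assume "\<not> 0 < 4 * \<kappa>"
    then have "sqrt (4 * \<kappa>) \<le> 0" by simp
    then have "sqrt (4 * \<kappa>) * sqrt ?E \<le> 0" using E0 by (intro mult_nonpos_nonneg) auto
    then show False using h by simp
  qed
  have "sqrt (4 * \<kappa>) * sqrt ?E \<le> sqrt (4 * \<kappa>) * 1" using es k0 by (intro mult_left_mono) auto
  then have "sqrt (1 / 4) \<le> sqrt (4 * \<kappa>)" using h half by linarith
  then have "1 / 4 \<le> 4 * \<kappa>" by (simp only: real_sqrt_le_iff)
  then show ?thesis by simp
qed

section \<open>Stone's property and the variance of the leave-one-out error\<close>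

lemma neighbours_nearest_real: "neighbours k e x y = nearest real k e (\<lambda>i. dist (x i) y)"
  by (simp add: neighbours_eq_nearest nearest_def before_def)

lemma neighbours_cong:
  assumes "\<And>j. j \<in> e \<Longrightarrow> x j = x' j"
  shows "neighbours k e x y = neighbours k e x' y"
proof -
  have "{j \<in> e. dist (x j) y < dist (x i) y \<or> (dist (x j) y = dist (x i) y \<and> j < i)}
      = {j \<in> e. dist (x' j) y < dist (x' i) y \<or> (dist (x' j) y = dist (x' i) y \<and> j < i)}" if "i \<in> e" for i
    using assms that by auto
  then show ?thesis unfolding neighbours_def by (intro Collect_cong conj_cong refl) simp
qed

context labelled_law
begin

text \<open>Of two points each is the nearest neighbour of the other, wherever they lie. This lower
  bound later absorbs terms free of \<open>\<gamma>\<close>.\<close>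

lemma stone_constant_ge_1:
  assumes "stone_constant (distr \<nu> borel fst) \<gamma>"
  shows "\<gamma> \<ge> 1"
proof -
  let ?\<mu> = "distr \<nu> borel fst"
  interpret m: prob_space ?\<mu> by (rule prob_space_distr[OF measurable_point])
  interpret P: prob_space "PiM {1..2::nat} (\<lambda>_. ?\<mu>)" by (rule m.prob_space_PiM_const)
  have "AE x in PiM {1..2::nat} (\<lambda>_. ?\<mu>). \<forall>k\<ge>1. \<forall>j\<in>{1..2}.
          real (card {i \<in> {1..2} - {j}. j \<in> neighbours k ({1..2} - {i}) x (x i)}) \<le> real k * \<gamma>"
    using assms unfolding stone_constant_def by blast
  then have "AE x in PiM {1..2::nat} (\<lambda>_. ?\<mu>). 1 \<le> \<gamma>"
  proof eventually_elim
    case (elim x)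
    have "{i \<in> {1..2} - {1}. 1 \<in> neighbours 1 ({1..2} - {i}) x (x i)} = {2::nat}"
    proof -
      have "{1..2} - {2} = {1::nat}" "{1..2} - {1} = {2::nat}" by auto
      moreover have "1 \<in> neighbours 1 {1} x (x 2)" by (simp add: neighbours_def)
      ultimately show ?thesis by (intro equalityI subsetI) simp_all
    qed
    moreover have "real (card {i \<in> {1..2} - {1}. 1 \<in> neighbours 1 ({1..2} - {i}) x (x i)}) \<le> real 1 * \<gamma>"
      using elim[rule_format, of 1 1] by simp
    ultimately show ?case by simp
  qed
  then show ?thesis by simp
qed

text \<open>The property is assumed for unlabelled points; forgetting the labels maps the product of
  the \<open>\<nu>\<close> to the product of the laws of the points.\<close>

lemma stone_law:
  assumes "stone_constant (distr \<nu> borel fst) \<gamma>"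
  shows "AE z in law {1..M}. \<forall>k\<ge>1. \<forall>j\<in>{1..M}.
    real (card {i \<in> {1..M} - {j}. j \<in> neighbours k ({1..M} - {i}) (\<lambda>i. fst (z i)) (fst (z i))}) \<le> real k * \<gamma>"
proof -
  let ?\<mu> = "distr \<nu> borel fst" and ?W = "{1..M}"
  let ?h = "\<lambda>z :: nat \<Rightarrow> (real ^ 'd) \<times> nat. \<lambda>i\<in>?W. fst (z i)"
  interpret m: prob_space ?\<mu> by (rule prob_space_distr[OF measurable_point])
  interpret P\<mu>: product_prob_space "\<lambda>_::nat. ?\<mu>" UNIV by unfold_locales
  interpret P\<nu>: product_prob_space "\<lambda>_::nat. \<nu>" UNIV by unfold_locales
  have hm: "?h \<in> measurable (law ?W) (PiM ?W (\<lambda>_. ?\<mu>))"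
    using measurable_point
    by (intro measurable_restrict measurable_compose[OF measurable_component_singleton[of _ ?W "\<lambda>_. \<nu>"]]) auto
  have eq: "distr (law ?W) (PiM ?W (\<lambda>_. ?\<mu>)) ?h = PiM ?W (\<lambda>_. ?\<mu>)"
  proof (rule P\<mu>.PiM_eqI)
    fix A :: "nat \<Rightarrow> (real ^ 'd) set" assume A: "\<And>i. i \<in> ?W \<Longrightarrow> A i \<in> sets ?\<mu>"
    have pre: "?h -` Pi\<^sub>E ?W A \<inter> space (law ?W) = Pi\<^sub>E ?W (\<lambda>i. fst -` A i \<inter> space \<nu>)"
      by (auto simp: space_PiM PiE_iff)
    have "emeasure (distr (law ?W) (PiM ?W (\<lambda>_. ?\<mu>)) ?h) (Pi\<^sub>E ?W A) = emeasure (law ?W) (Pi\<^sub>E ?W (\<lambda>i. fst -` A i \<inter> space \<nu>))"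
      unfolding pre[symmetric] using A by (intro emeasure_distr[OF hm sets_PiM_I_finite]) auto
    also have "\<dots> = (\<Prod>i\<in>?W. emeasure \<nu> (fst -` A i \<inter> space \<nu>))"
      using A measurable_sets[OF measurable_point] by (intro P\<nu>.emeasure_PiM) auto
    also have "\<dots> = (\<Prod>i\<in>?W. emeasure ?\<mu> (A i))"
      using A by (intro prod.cong) (auto simp: emeasure_distr[OF measurable_point])
    finally show "emeasure (distr (law ?W) (PiM ?W (\<lambda>_. ?\<mu>)) ?h) (Pi\<^sub>E ?W A) = (\<Prod>i\<in>?W. emeasure ?\<mu> (A i))" .
  qed simp_all
  have "AE x in distr (law ?W) (PiM ?W (\<lambda>_. ?\<mu>)) ?h. \<forall>k\<ge>1. \<forall>j\<in>?W.
          real (card {i \<in> ?W - {j}. j \<in> neighbours k (?W - {i}) x (x i)}) \<le> real k * \<gamma>"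
    unfolding eq using assms unfolding stone_constant_def by blast
  from AE_distrD[OF hm this] show ?thesis
  proof eventually_elim
    case (elim z)
    have n: "neighbours k (?W - {i}) (?h z) (?h z i) = neighbours k (?W - {i}) (\<lambda>i. fst (z i)) (fst (z i))" if "i \<in> ?W" for k i
    proof -
      have "?h z i = fst (z i)" using that by simp
      moreover have "neighbours k (?W - {i}) (?h z) (fst (z i)) = neighbours k (?W - {i}) (\<lambda>i. fst (z i)) (fst (z i))"
        by (rule neighbours_cong) simp
      ultimately show ?thesis by metis
    qed
    have "{i \<in> ?W - {j}. j \<in> neighbours k (?W - {i}) (?h z) (?h z i)} = {i \<in> ?W - {j}. j \<in> neighbours k (?W - {i}) (\<lambda>i. fst (z i)) (fst (z i))}" for k j
      by (intro Collect_cong conj_cong refl) (simp only: n Diff_iff)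
    then show ?case using elim by (simp only:)
  qed
qed

lemma err_remove_far:
  assumes "finite e" "i \<in> e" "i \<notin> neighbours k e (\<lambda>i. fst (z i)) (fst x)"
  shows "err k (e - {i}) z x = err k e z x"
proof -
  have "nearest real k (e - {i}) (\<lambda>i. dist (fst (z i)) (fst x)) = nearest real k e (\<lambda>i. dist (fst (z i)) (fst x))"
    using assms by (intro nearest_remove_far) (auto simp: inj_on_def neighbours_nearest_real)
  then show ?thesis unfolding err_def votes_def by simp
qed

lemma loo_bounds:
  assumes "finite G" "G \<noteq> {}" "G \<subseteq> I" "z \<in> space (law I)"
  shows "0 \<le> loo k G z" "loo k G z \<le> 1"
proof -
  have "card G - 1 < card G" using assms by (simp add: card_gt_0_iff)
  then show "0 \<le> loo k G z" "loo k G z \<le> 1"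
    unfolding loo_eq_held_out[OF assms(1,2)] using held_out_bounds assms by auto
qed

lemma measurable_loo:
  assumes "finite G" "G \<noteq> {}" "G \<subseteq> I"
  shows "loo k G \<in> borel_measurable (law I)"
  using measurable_held_out[OF assms(1,3), of k "card G - 1"]
  by (simp add: loo_eq_held_out[OF assms(1,2), abs_def])

text \<open>Stone's property bounds the number of held-out points that can notice the change of one
  observation by \<open>2 k \<gamma>\<close>, so the square of the sum of the changes is at most \<open>2 k \<gamma>\<close> times
  the sum, which stability controls.\<close>

lemma loo_update_le:
  assumes W: "finite W" and i: "i \<in> W" and z: "\<And>j. j \<in> W \<Longrightarrow> snd (z j) \<in> {0, 1}" and v: "snd v \<in> {0, 1}"
    and S: "real (card {j \<in> W - {i}. i \<in> neighbours k (W - {j}) (\<lambda>l. fst (z l)) (fst (z j))}) \<le> c"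
    and S': "real (card {j \<in> W - {i}. i \<in> neighbours k (W - {j}) (\<lambda>l. fst ((z(i := v)) l)) (fst ((z(i := v)) j))}) \<le> c"
  shows "(real (card W) * (loo k W z - loo k W (z(i := v))))\<^sup>2
    \<le> 2 + 4 * c * (\<Sum>j\<in>W - {i}. \<bar>err k (W - {j}) z (z j) - err k (W - {j} - {i}) z (z j)\<bar>
        + \<bar>err k (W - {j}) (z(i := v)) ((z(i := v)) j) - err k (W - {j} - {i}) (z(i := v)) ((z(i := v)) j)\<bar>)"
proof -
  let ?z = "z(i := v)"
  define d where "d j = err k (W - {j}) z (z j) - err k (W - {j}) ?z (?z j)" for j
  define t where "t = (\<Sum>j\<in>W - {i}. \<bar>d j\<bar>)"
  let ?N = "{j \<in> W - {i}. i \<in> neighbours k (W - {j}) (\<lambda>l. fst (z l)) (fst (z j))}"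
  let ?N' = "{j \<in> W - {i}. i \<in> neighbours k (W - {j}) (\<lambda>l. fst (?z l)) (fst (?z j))}"
  have z': "snd (?z j) \<in> {0, 1}" if "j \<in> W" for j using z[OF that] v by auto
  \<comment> \<open>With \<open>i\<close> deleted as well, the new value at \<open>i\<close> is
    invisible, so the errors before and after the change can be compared through a common
    term.\<close>
  have rem: "err k (W - {j} - {i}) z (z j) = err k (W - {j} - {i}) ?z (?z j)" if "j \<in> W - {i}" for j
  proof -
    have "err k (W - {j} - {i}) z (z j) = err k (W - {j} - {i}) ?z (z j)" by (rule err_cong) auto
    then show ?thesis using that by simp
  qed
  have d1: "\<bar>d j\<bar> \<le> 1" if "j \<in> W - {i}" for j
  proof -
    have "?z j = z j" using that by simp
    then show ?thesis unfolding d_def using err_diff_le_1[of "z j" k "W - {j}" z "W - {j}" ?z] z that by simp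
  qed
  have di: "\<bar>d i\<bar> \<le> 1"
    unfolding d_def using err_bounds[OF z[OF i], of k "W - {i}" z] err_bounds[OF z'[OF i], of k "W - {i}" ?z] by linarith
  have d0: "d j = 0" if j: "j \<in> W - {i}" "j \<notin> ?N" "j \<notin> ?N'" for j
  proof -
    have "err k (W - {j} - {i}) z (z j) = err k (W - {j}) z (z j)"
      using j i W by (intro err_remove_far) auto
    moreover have "err k (W - {j} - {i}) ?z (?z j) = err k (W - {j}) ?z (?z j)"
      using j i W by (intro err_remove_far) auto
    ultimately show ?thesis using rem[OF j(1)] by (simp add: d_def)
  qed
  have t0: "0 \<le> t" unfolding t_def by (intro sum_nonneg) auto
  have c0: "0 \<le> c" using S by (rule order_trans[rotated]) simp
  \<comment> \<open>A point \<open>j\<close> can notice the change only if \<open>i\<close> is among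
    its neighbours before or after; by \<open>S\<close> and \<open>S'\<close> each case concerns at
    most \<open>c\<close> points.\<close>
  have "t \<le> (\<Sum>j\<in>W - {i}. of_bool (j \<in> ?N) + of_bool (j \<in> ?N'))"
    unfolding t_def
  proof (rule sum_mono)
    fix j assume j: "j \<in> W - {i}"
    show "\<bar>d j\<bar> \<le> of_bool (j \<in> ?N) + of_bool (j \<in> ?N')"
    proof (cases "j \<in> ?N \<or> j \<in> ?N'")
      case True
      have "1 \<le> (of_bool P + of_bool Q :: real)" if "P \<or> Q" for P Q using that by auto
      from this[OF True] show ?thesis using d1[OF j] by linarith
    next
      case False
      then have "d j = 0" using d0[OF j] by blast
      moreover have "0 \<le> (of_bool P + of_bool Q :: real)" for P Q by simp
      note this[of "j \<in> ?N" "j \<in> ?N'"]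
      ultimately show ?thesis by linarith
    qed
  qed
  also have "\<dots> = real (card ?N) + real (card ?N')"
  proof -
    have "(\<Sum>j\<in>W - {i}. of_bool (j \<in> A)) = real (card A)" if "A \<subseteq> W - {i}" for A
    proof -
      have "(W - {i}) \<inter> A = A" using that by blast
      then show ?thesis using W by (simp add: sum.If_cases of_bool_def)
    qed
    note * = this
    have "?N \<subseteq> W - {i}" "?N' \<subseteq> W - {i}" by blast+
    from *[OF this(1)] *[OF this(2)] show ?thesis unfolding sum.distrib by (rule arg_cong2[where f = "(+)"])
  qed
  also have "\<dots> \<le> 2 * c" using S S' by linarith
  finally have tc: "t \<le> 2 * c" .
  have "real (card W) * (loo k W z - loo k W ?z) = (\<Sum>j\<in>W. d j)"
    using W i by (auto simp: loo_def d_def sum_subtractf right_diff_distrib)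
  also have "\<dots> = d i + (\<Sum>j\<in>W - {i}. d j)" using W i by (rule sum.remove)
  finally have "\<bar>real (card W) * (loo k W z - loo k W ?z)\<bar> \<le> \<bar>d i\<bar> + t"
    unfolding t_def using sum_abs[of d "W - {i}"] by linarith
  then have "\<bar>real (card W) * (loo k W z - loo k W ?z)\<bar> \<le> 1 + t" using di by linarith
  then have "(real (card W) * (loo k W z - loo k W ?z))\<^sup>2 \<le> (1 + t)\<^sup>2"
    by (metis abs_ge_zero power2_abs power_mono)
  also have "\<dots> \<le> 2 + 2 * (t * t)"
    using zero_le_power2[of "1 - t"] by (simp add: power2_eq_square algebra_simps)
  \<comment> \<open>One factor \<open>t\<close> is replaced by the sure bound \<open>2 * c\<close>;
    the other is kept, as its expectation is what stability controls.\<close>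
  also have "\<dots> \<le> 2 + 2 * (2 * c * t)" using tc t0 by (intro add_left_mono mult_left_mono mult_right_mono) auto
  also have "\<dots> = 2 + 4 * c * t" by simp
  also have "\<dots> \<le> 2 + 4 * c * (\<Sum>j\<in>W - {i}. \<bar>err k (W - {j}) z (z j) - err k (W - {j} - {i}) z (z j)\<bar>
        + \<bar>err k (W - {j}) ?z (?z j) - err k (W - {j} - {i}) ?z (?z j)\<bar>)"
    unfolding t_def
  proof (intro add_left_mono mult_left_mono sum_mono)
    fix j assume j: "j \<in> W - {i}"
    show "\<bar>d j\<bar> \<le> \<bar>err k (W - {j}) z (z j) - err k (W - {j} - {i}) z (z j)\<bar>
        + \<bar>err k (W - {j}) ?z (?z j) - err k (W - {j} - {i}) ?z (?z j)\<bar>"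
      unfolding d_def using rem[OF j] by linarith
  qed (use c0 in auto)
  finally show ?thesis .
qed

text \<open>Replacing observation \<open>i\<close> moves the sum of errors by its own term, whence
  the 2, and by the points that notice the change, whence \<open>8 * c\<close> times the deletion
  effects of \<open>i\<close>. For a fixed test point \<open>j\<close> these effects sum over
  \<open>i\<close> to at most \<open>sqrt k\<close>; summing over \<open>j\<close> and dividing by
  \<open>M\<^sup>2\<close> gives the bound.\<close>

theorem loo_variance:
  assumes stone: "stone_constant (distr \<nu> borel fst) \<gamma>" and mc: "moment_constant TYPE((real ^ 'd) \<times> nat) \<kappa>"
    and k: "k \<ge> 1" "k \<le> M - 1"
  shows "(\<integral>z. (loo k {1..M} z - integral\<^sup>L (law {1..M}) (loo k {1..M}))\<^sup>2 \<partial>law {1..M})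
    \<le> 4 * \<kappa> * ((2 + 8 * \<gamma> * (real k * sqrt (real k))) / real M)"
proof -
  let ?W = "{1..M}" and ?P = "law {1..M}"
  let ?f = "loo k ?W :: (nat \<Rightarrow> (real ^ 'd) \<times> nat) \<Rightarrow> real"
  interpret PN: pair_prob_space ?P \<nu> by unfold_locales
  interpret PP: pair_prob_space ?P ?P by unfold_locales
  have M0: "0 < real M" using k by auto
  have ne: "?W \<noteq> {}" using k by auto
  have fm: "?f \<in> borel_measurable ?P" by (rule measurable_loo[OF _ ne]) auto
  have fb: "0 \<le> ?f z" "?f z \<le> 1" if "z \<in> space ?P" for z
    using loo_bounds[OF _ ne _ that] by auto
  have g1: "1 \<le> \<gamma>" by (rule stone_constant_ge_1[OF stone])
  have ka: "1 / 16 \<le> \<kappa>" by (rule moment_constant_ge[OF mc])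
  define \<delta> where "\<delta> j i = (\<integral>z. \<bar>err k (?W - {j}) z (z j) - err k (?W - {j} - {i}) z (z j)\<bar> \<partial>?P)" for i j
  define c where "c = real k * \<gamma>"
  have c0: "0 \<le> c" using g1 by (simp add: c_def)
  define T where "T i = (\<integral>w. (?f (fst w) - ?f ((fst w)(i := snd w)))\<^sup>2 \<partial>(?P \<Otimes>\<^sub>M \<nu>))" for i
  have um: "(\<lambda>w. (fst w)(i := snd w)) \<in> measurable (?P \<Otimes>\<^sub>M \<nu>) ?P" if "i \<in> ?W" for i
    using measurable_resample[OF that] by (simp add: case_prod_unfold)
  have gm: "(\<lambda>w. (?f (fst w) - ?f ((fst w)(i := snd w)))\<^sup>2) \<in> borel_measurable (?P \<Otimes>\<^sub>M \<nu>)" if "i \<in> ?W" for i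
    using measurable_compose[OF measurable_fst fm, of \<nu>] measurable_compose[OF um[OF that] fm] by simp
  have sq1: "\<bar>(?f z - ?f z')\<^sup>2\<bar> \<le> 1" if "z \<in> space ?P" "z' \<in> space ?P" for z z'
    using fb[OF that(1)] fb[OF that(2)] by (auto simp: abs_square_le_1 abs_le_iff)
  have gb: "\<bar>(?f (fst w) - ?f ((fst w)(i := snd w)))\<^sup>2\<bar> \<le> 1" if "i \<in> ?W" "w \<in> space (?P \<Otimes>\<^sub>M \<nu>)" for i w
    using that measurable_space[OF um[OF that(1)] that(2)] by (intro sq1) (auto simp: space_pair_measure)
  have gi: "integrable (?P \<Otimes>\<^sub>M \<nu>) (\<lambda>w. (?f (fst w) - ?f ((fst w)(i := snd w)))\<^sup>2)" if "i \<in> ?W" for i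
    by (rule PN.integrable_bounded[OF gm[OF that] gb[OF that]])
  \<comment> \<open>The moment inequality draws a whole independent sample, but its
    \<open>i\<close>-th term sees one coordinate of it. A single fresh point may take its place, and
    the resampling facts apply.\<close>
  have copy: "integrable (?P \<Otimes>\<^sub>M ?P) (\<lambda>w. (?f (fst w) - ?f ((fst w)(i := snd w i)))\<^sup>2)"
    "(\<integral>w. (?f (fst w) - ?f ((fst w)(i := snd w i)))\<^sup>2 \<partial>(?P \<Otimes>\<^sub>M ?P)) = T i" if i: "i \<in> ?W" for i
  proof -
    have hm: "(\<lambda>w. (fst w, snd w i)) \<in> measurable (?P \<Otimes>\<^sub>M ?P) (?P \<Otimes>\<^sub>M \<nu>)"
      by (intro measurable_Pair measurable_fst measurable_compose[OF measurable_snd measurable_component_singleton[OF i]])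
    let ?g = "\<lambda>w. (?f (fst w) - ?f ((fst w)(i := snd w)))\<^sup>2"
    have m: "(\<lambda>w. ?g (fst w, snd w i)) \<in> borel_measurable (?P \<Otimes>\<^sub>M ?P)"
      by (rule measurable_compose[OF hm gm[OF i]])
    have int: "integrable (?P \<Otimes>\<^sub>M ?P) (\<lambda>w. ?g (fst w, snd w i))"
      using gb[OF i measurable_space[OF hm]] by (intro PP.integrable_bounded[OF m, of 1])
    then show "integrable (?P \<Otimes>\<^sub>M ?P) (\<lambda>w. (?f (fst w) - ?f ((fst w)(i := snd w i)))\<^sup>2)" by simp
    have "(\<integral>w. ?g (fst w, snd w i) \<partial>(?P \<Otimes>\<^sub>M ?P)) = (\<integral>z. (\<integral>z'. ?g (z, z' i) \<partial>?P) \<partial>?P)"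
      using PP.integral_fst[of "\<lambda>z z'. ?g (z, z' i)"] int by (simp add: case_prod_unfold)
    also have "\<dots> = (\<integral>z. (\<integral>v. ?g (z, v) \<partial>\<nu>) \<partial>?P)"
    proof (rule Bochner_Integration.integral_cong[OF refl])
      fix z assume z: "z \<in> space ?P"
      have vm: "(\<lambda>v. ?g (z, v)) \<in> borel_measurable \<nu>" using gm[OF i] z by (rule measurable_compose_Pair1[rotated])
      have "(\<integral>v. ?g (z, v) \<partial>\<nu>) = (\<integral>v. ?g (z, v) \<partial>distr ?P \<nu> (\<lambda>z'. z' i))"
        using distr_PiM_component[of ?W "\<lambda>_. \<nu>" i] prob_space_axioms i by simp
      also have "\<dots> = (\<integral>z'. ?g (z, z' i) \<partial>?P)"
        by (rule integral_distr[OF measurable_component_singleton[OF i] vm])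
      finally show "(\<integral>z'. ?g (z, z' i) \<partial>?P) = (\<integral>v. ?g (z, v) \<partial>\<nu>)" by simp
    qed
    also have "\<dots> = T i"
      unfolding T_def using PN.integral_fst[of "\<lambda>z v. ?g (z, v)"] gi[OF i] by (simp add: case_prod_unfold)
    finally show "(\<integral>w. (?f (fst w) - ?f ((fst w)(i := snd w i)))\<^sup>2 \<partial>(?P \<Otimes>\<^sub>M ?P)) = T i" by simp
  qed
  have T_le: "(real M)\<^sup>2 * T i \<le> 2 + 8 * c * (\<Sum>j\<in>?W - {i}. \<delta> j i)" if i: "i \<in> ?W" for i
  proof -
    define A where "A j z = \<bar>err k (?W - {j}) z (z j) - err k (?W - {j} - {i}) z (z j)\<bar>" for j and z :: "nat \<Rightarrow> (real ^ 'd) \<times> nat"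
    have Ai: "integrable ?P (A j)" if "j \<in> ?W" for j
      unfolding A_def using that by (intro integrable_err_diff) auto
    have Ab: "\<bar>A j z\<bar> \<le> 1" if "j \<in> ?W" "z \<in> space ?P" for j z
      unfolding A_def using err_diff_le_1[OF label[OF coordinate[OF that(2,1)]]] by simp
    have Am: "A j \<in> borel_measurable ?P" if "j \<in> ?W" for j using Ai[OF that] by auto
    have A1: "integrable (?P \<Otimes>\<^sub>M \<nu>) (\<lambda>w. A j (fst w))" "(\<integral>w. A j (fst w) \<partial>(?P \<Otimes>\<^sub>M \<nu>)) = \<delta> j i" if j: "j \<in> ?W" for j
    proof -
      show int: "integrable (?P \<Otimes>\<^sub>M \<nu>) (\<lambda>w. A j (fst w))"
        using Ab[OF j] measurable_compose[OF measurable_fst Am[OF j], of \<nu>]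
        by (intro PN.integrable_bounded[of _ 1]) (auto simp: space_pair_measure)
      show "(\<integral>w. A j (fst w) \<partial>(?P \<Otimes>\<^sub>M \<nu>)) = \<delta> j i"
        using PN.integral_fst[of "\<lambda>z v. A j z"] int by (simp add: case_prod_unfold prob_space \<delta>_def A_def)
    qed
    have A2: "integrable (?P \<Otimes>\<^sub>M \<nu>) (\<lambda>w. A j ((fst w)(i := snd w)))" "(\<integral>w. A j ((fst w)(i := snd w)) \<partial>(?P \<Otimes>\<^sub>M \<nu>)) = \<delta> j i" if j: "j \<in> ?W" for j
    proof -
      show "integrable (?P \<Otimes>\<^sub>M \<nu>) (\<lambda>w. A j ((fst w)(i := snd w)))"
        using Ab[OF j measurable_space[OF um[OF i]]] measurable_compose[OF um[OF i] Am[OF j]]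
        by (intro PN.integrable_bounded[of _ 1]) auto
      show "(\<integral>w. A j ((fst w)(i := snd w)) \<partial>(?P \<Otimes>\<^sub>M \<nu>)) = \<delta> j i"
        using resample_integral(1)[OF i Am[OF j] Ab[OF j]] by (simp add: \<delta>_def A_def)
    qed
    note st = stone_law[OF stone, of M]
    have st1: "AE w in ?P \<Otimes>\<^sub>M \<nu>. \<forall>k\<ge>1. \<forall>j\<in>?W.
        real (card {i \<in> ?W - {j}. j \<in> neighbours k (?W - {i}) (\<lambda>l. fst (fst w l)) (fst (fst w i))}) \<le> real k * \<gamma>"
    proof (rule AE_distrD[OF measurable_fst])
      show "AE z in distr (?P \<Otimes>\<^sub>M \<nu>) ?P fst. \<forall>k\<ge>1. \<forall>j\<in>?W.
          real (card {i \<in> ?W - {j}. j \<in> neighbours k (?W - {i}) (\<lambda>l. fst (z l)) (fst (z i))}) \<le> real k * \<gamma>"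
        unfolding distr_pair_fst by (rule st)
    qed
    have st2: "AE w in ?P \<Otimes>\<^sub>M \<nu>. \<forall>k\<ge>1. \<forall>j\<in>?W.
        real (card {i' \<in> ?W - {j}. j \<in> neighbours k (?W - {i'}) (\<lambda>l. fst (((fst w)(i := snd w)) l)) (fst (((fst w)(i := snd w)) i'))}) \<le> real k * \<gamma>"
      by (rule resample_AE[OF i st])
    have "(real M)\<^sup>2 * T i = (\<integral>w. (real (card ?W) * (?f (fst w) - ?f ((fst w)(i := snd w))))\<^sup>2 \<partial>(?P \<Otimes>\<^sub>M \<nu>))"
      unfolding T_def by (simp add: power_mult_distrib)
    also have "\<dots> \<le> (\<integral>w. 2 + 4 * c * (\<Sum>j\<in>?W - {i}. A j (fst w) + A j ((fst w)(i := snd w))) \<partial>(?P \<Otimes>\<^sub>M \<nu>))"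
    proof (rule integral_mono_AE)
      show "integrable (?P \<Otimes>\<^sub>M \<nu>) (\<lambda>w. (real (card ?W) * (?f (fst w) - ?f ((fst w)(i := snd w))))\<^sup>2)"
        using gi[OF i] by (simp add: power_mult_distrib)
      show "integrable (?P \<Otimes>\<^sub>M \<nu>) (\<lambda>w. 2 + 4 * c * (\<Sum>j\<in>?W - {i}. A j (fst w) + A j ((fst w)(i := snd w))))"
        using A1(1) A2(1)
        by (intro Bochner_Integration.integrable_add integrable_mult_right Bochner_Integration.integrable_sum PN.integrable_const) auto
      show "AE w in ?P \<Otimes>\<^sub>M \<nu>. (real (card ?W) * (?f (fst w) - ?f ((fst w)(i := snd w))))\<^sup>2
          \<le> 2 + 4 * c * (\<Sum>j\<in>?W - {i}. A j (fst w) + A j ((fst w)(i := snd w)))"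
        using st1 st2 AE_space
      proof eventually_elim
        case (elim w)
        have w: "fst w \<in> space ?P" "snd w \<in> space \<nu>" using elim(3) by (auto simp: space_pair_measure)
        show ?case unfolding A_def
          using i label[OF coordinate[OF w(1)]] label[OF w(2)] elim(1,2) k(1)
          by (intro loo_update_le) (auto simp: c_def)
      qed
    qed
    \<comment> \<open>The overwritten sample has the same law, so both deletion effects have the
      expectation \<open>\<delta> j i\<close>.\<close>
    also have "\<dots> = 2 + 4 * c * (\<Sum>j\<in>?W - {i}. \<delta> j i + \<delta> j i)"
    proof -
      have s: "integrable (?P \<Otimes>\<^sub>M \<nu>) (\<lambda>w. A j (fst w) + A j ((fst w)(i := snd w)))"
        "(\<integral>w. A j (fst w) + A j ((fst w)(i := snd w)) \<partial>(?P \<Otimes>\<^sub>M \<nu>)) = \<delta> j i + \<delta> j i" if "j \<in> ?W - {i}" for j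
        using A1 A2 that by simp_all
      have "(\<integral>w. (\<Sum>j\<in>?W - {i}. A j (fst w) + A j ((fst w)(i := snd w))) \<partial>(?P \<Otimes>\<^sub>M \<nu>)) = (\<Sum>j\<in>?W - {i}. \<delta> j i + \<delta> j i)"
        using s by (subst Bochner_Integration.integral_sum) (auto intro!: sum.cong)
      moreover have int: "integrable (?P \<Otimes>\<^sub>M \<nu>) (\<lambda>w. 4 * c * (\<Sum>j\<in>?W - {i}. A j (fst w) + A j ((fst w)(i := snd w))))"
        using s(1) by (intro integrable_mult_right Bochner_Integration.integrable_sum)
      moreover have "(\<integral>w. 2 \<partial>(?P \<Otimes>\<^sub>M \<nu>)) = (2 :: real)" using PN.prob_space by simp
      ultimately show ?thesis
        unfolding Bochner_Integration.integral_add[OF PN.integrable_const int] by simp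
    qed
    also have "\<dots> = 2 + 8 * c * (\<Sum>j\<in>?W - {i}. \<delta> j i)" by (simp only: sum.distrib) simp
    finally show ?thesis .
  qed
  have sum_\<delta>: "(\<Sum>i\<in>?W. \<Sum>j\<in>?W - {i}. \<delta> j i) \<le> real M * sqrt (real k)"
  proof -
    \<comment> \<open>Stability sums over the deleted point for a fixed test point, hence the
      exchange of the sums.\<close>
    have "(\<Sum>i\<in>?W. \<Sum>j\<in>?W - {i}. \<delta> j i) = (\<Sum>j\<in>?W. \<Sum>i\<in>?W - {j}. \<delta> j i)"
      by (rule sum_off_diagonal_swap) simp
    also have "\<dots> \<le> (\<Sum>j\<in>?W. sqrt (real k))"
      unfolding \<delta>_def using k by (intro sum_mono err_stability) auto
    finally show ?thesis by simp
  qed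
  let ?E = "\<integral>w. (\<Sum>i\<in>?W. (?f (fst w) - ?f ((fst w)(i := snd w i)))\<^sup>2) \<partial>(?P \<Otimes>\<^sub>M ?P)"
  have "?E = (\<Sum>i\<in>?W. T i)"
    using copy by (subst Bochner_Integration.integral_sum) (auto intro!: sum.cong)
  then have "(real M)\<^sup>2 * ?E = (\<Sum>i\<in>?W. (real M)\<^sup>2 * T i)" by (simp add: sum_distrib_left)
  also have "\<dots> \<le> (\<Sum>i\<in>?W. 2 + 8 * c * (\<Sum>j\<in>?W - {i}. \<delta> j i))" by (intro sum_mono T_le)
  also have "\<dots> = 2 * real M + 8 * c * (\<Sum>i\<in>?W. \<Sum>j\<in>?W - {i}. \<delta> j i)"
    by (simp add: sum.distrib sum_distrib_left)
  also have "\<dots> \<le> 2 * real M + 8 * c * (real M * sqrt (real k))"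
    using sum_\<delta> c0 by (intro add_left_mono mult_left_mono) auto
  also have "\<dots> = (real M)\<^sup>2 * ((2 + 8 * \<gamma> * (real k * sqrt (real k))) / real M)"
    using M0 by (simp add: c_def field_simps power2_eq_square)
  finally have E: "?E \<le> (2 + 8 * \<gamma> * (real k * sqrt (real k))) / real M"
    by (rule mult_left_le_imp_le) (use M0 in simp)
  let ?V = "\<integral>z. (?f z - integral\<^sup>L ?P ?f)\<^sup>2 \<partial>?P"
  have E0: "0 \<le> ?E" by (intro integral_nonneg_AE AE_I2 sum_of_squares_pos)
  have V0: "0 \<le> ?V" by (intro integral_nonneg_AE AE_I2) auto
  have "sqrt ?V \<le> sqrt (4 * \<kappa>) * sqrt ?E"
    using fb by (intro moment_constant_sqrt[OF mc prob_space_axioms fm]) auto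
  then have "sqrt ?V \<le> sqrt (4 * \<kappa> * ?E)" by (simp only: real_sqrt_mult)
  then have "?V \<le> 4 * \<kappa> * ?E" by simp
  also have "\<dots> \<le> 4 * \<kappa> * ((2 + 8 * \<gamma> * (real k * sqrt (real k))) / real M)"
    using E ka by (intro mult_left_mono) auto
  finally show ?thesis .
qed

text \<open>Stone's property and the moment inequality are stated on \<open>{1..M}\<close>, whereas
  the samples \<open>W\<close> are arbitrary subsets. The increasing enumeration preserves the order
  of the indices and with it the tie-breaking.\<close>

lemma loo_reindex_integral:
  fixes F :: "real \<Rightarrow> real"
  assumes W: "finite W" "W \<subseteq> I" "W \<noteq> {}" and F: "F \<in> borel_measurable borel"
  shows "(\<integral>z. F (loo k W z) \<partial>law I) = (\<integral>z. F (loo k {1..card W} z) \<partial>law {1..card W})"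
proof -
  let ?M = "card W" and ?D = "{1..card W}"
  obtain f0 where f0: "bij_betw f0 {..<?M} W" "\<And>i j. i < ?M \<Longrightarrow> j < ?M \<Longrightarrow> real (f0 i) < real (f0 j) \<longleftrightarrow> i < j"
    using order_enumeration[OF W(1), of real] by (auto simp: inj_on_def)
  \<comment> \<open>The enumeration \<open>f0\<close> counts from 0, the sample
    \<open>{1..card W}\<close> from 1.\<close>
  define f where "f i = f0 (i - 1)" for i
  have pred: "bij_betw (\<lambda>i. i - 1) ?D {..<?M}"
    by (rule bij_betwI[where g = Suc]) auto
  have f: "bij_betw f ?D W"
    unfolding f_def using bij_betw_trans[OF pred f0(1)] by (simp add: comp_def)
  have fD: "f ` ?D = W" "inj_on f ?D" using f by (auto simp: bij_betw_def)
  have mono: "real (f i) < real (f j) \<longleftrightarrow> real i < real j" if "i \<in> ?D" "j \<in> ?D" for i j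
  proof -
    have "i - 1 < ?M" "j - 1 < ?M" using that by auto
    then have "real (f i) < real (f j) \<longleftrightarrow> i - 1 < j - 1" unfolding f_def by (rule f0(2))
    then show ?thesis using that by auto
  qed
  have er: "err k (f ` D) z x = err k D (\<lambda>i. z (f i)) x" if "D \<subseteq> ?D" for D x and z :: "nat \<Rightarrow> (real ^ 'd) \<times> nat"
  proof -
    have "votes real k (f ` D) r y = votes real k D (\<lambda>i. r (f i)) (\<lambda>i. y (f i))" for r y
    proof (rule votes_reindex)
      show "inj_on f D" using fD(2) that by (rule inj_on_subset)
      show "real (f i) < real (f j) \<longleftrightarrow> real i < real j" if "i \<in> D" "j \<in> D" for i j
        using mono that \<open>D \<subseteq> ?D\<close> by blast
    qed
    then show ?thesis by (simp add: err_def)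
  qed
  have lo: "loo k W z = loo k ?D (\<lambda>n\<in>?D. z (f n))" for z :: "nat \<Rightarrow> (real ^ 'd) \<times> nat"
  proof -
    have "(\<Sum>i\<in>W. err k (W - {i}) z (z i)) = (\<Sum>i\<in>?D. err k (W - {f i}) z (z (f i)))"
      using sum.reindex_bij_betw[OF f, of "\<lambda>i. err k (W - {i}) z (z i)"] by simp
    also have "\<dots> = (\<Sum>i\<in>?D. err k (?D - {i}) (\<lambda>n\<in>?D. z (f n)) ((\<lambda>n\<in>?D. z (f n)) i))"
    proof (rule sum.cong[OF refl])
      fix i assume i: "i \<in> ?D"
      have "W - {f i} = f ` (?D - {i})"
        using fD i by (simp add: inj_on_image_set_diff[of f ?D])
      then have "err k (W - {f i}) z (z (f i)) = err k (?D - {i}) (\<lambda>i. z (f i)) (z (f i))"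
        using er[of "?D - {i}"] by simp
      also have "\<dots> = err k (?D - {i}) (\<lambda>n\<in>?D. z (f n)) (z (f i))"
        by (rule err_cong) simp
      finally show "err k (W - {f i}) z (z (f i)) = err k (?D - {i}) (\<lambda>n\<in>?D. z (f n)) ((\<lambda>n\<in>?D. z (f n)) i)"
        using i by simp
    qed
    finally show ?thesis by (simp add: loo_def)
  qed
  have "?D \<noteq> {}" using W by (auto simp: Suc_le_eq card_gt_0_iff)
  then have "(\<lambda>z. F (loo k ?D z)) \<in> borel_measurable (law ?D)"
    using measurable_loo[of ?D ?D k] F by (auto intro: measurable_compose)
  then show ?thesis
    unfolding lo using reindex_integral[OF fD(2), of I "\<lambda>z. F (loo k ?D z)"] W(2) fD(1) by auto
qed

text \<open>Samples of equal size give identically distributed errors, and by convexity the squared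
  deviation of their average is at most the average squared deviation, however they depend on each
  other.\<close>

theorem held_out_variance:
  assumes stone: "stone_constant (distr \<nu> borel fst) \<gamma>" and mc: "moment_constant TYPE((real ^ 'd) \<times> nat) \<kappa>"
    and G: "finite G" "G \<subseteq> I" and k: "k \<ge> 1" "k \<le> m" and m: "m < card G"
  shows "(\<integral>z. (held_out k m G z - integral\<^sup>L (law I) (held_out k m G))\<^sup>2 \<partial>law I)
    \<le> 4 * \<kappa> * ((2 + 8 * \<gamma> * (real k * sqrt (real k))) / real (Suc m))"
proof -
  let ?S = "{W. W \<subseteq> G \<and> card W = Suc m}" and ?D = "{1..Suc m}"
  let ?V = "4 * \<kappa> * ((2 + 8 * \<gamma> * (real k * sqrt (real k))) / real (Suc m))"
  have fS: "finite ?S" using G(1) by simp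
  have cS: "card ?S = card G choose Suc m" by (rule n_subsets[OF G(1)])
  have pos: "0 < real (card ?S)" using m cS by simp
  have W: "finite W" "W \<subseteq> I" "W \<noteq> {}" "card W = Suc m" if "W \<in> ?S" for W
    using that G finite_subset[of W G] by auto
  have ho: "held_out k m G z = (\<Sum>W\<in>?S. loo k W z) / real (card ?S)" for z :: "nat \<Rightarrow> (real ^ 'd) \<times> nat"
    unfolding cS using m by (intro held_out_eq_loo_average[OF G(1)]) simp
  define \<mu> where "\<mu> = (\<integral>z. loo k ?D z \<partial>law ?D)"
  have mean: "(\<integral>z. loo k W z \<partial>law I) = \<mu>" if "W \<in> ?S" for W
    using loo_reindex_integral[of W I "\<lambda>x. x" k] W[OF that] by (simp add: \<mu>_def)
  have var: "(\<integral>z. (loo k W z - \<mu>)\<^sup>2 \<partial>law I) \<le> ?V" if "W \<in> ?S" for W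
  proof -
    have "(\<integral>z. (loo k W z - \<mu>)\<^sup>2 \<partial>law I) = (\<integral>z. (loo k ?D z - \<mu>)\<^sup>2 \<partial>law ?D)"
      using loo_reindex_integral[of W I "\<lambda>x. (x - \<mu>)\<^sup>2" k] W[OF that] by simp
    also have "\<dots> \<le> ?V" unfolding \<mu>_def using k by (intro loo_variance[OF stone mc]) auto
    finally show ?thesis .
  qed
  have li: "integrable (law I) (loo k W)" if "W \<in> ?S" for W
    using loo_bounds[OF W(1)[OF that] W(3)[OF that] W(2)[OF that]] W[OF that]
    by (intro law.integrable_bounded[of _ _ 1] measurable_loo) auto
  have \<mu>: "0 \<le> \<mu>" "\<mu> \<le> 1"
  proof -
    have b: "0 \<le> loo k ?D z" "loo k ?D z \<le> 1" if "z \<in> space (law ?D)" for z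
      using loo_bounds[OF _ _ _ that, of ?D k] by auto
    show "0 \<le> \<mu>" unfolding \<mu>_def using b by (intro integral_nonneg_AE AE_I2) auto
    have "\<mu> \<le> (\<integral>z. 1 \<partial>law ?D)" unfolding \<mu>_def
    proof (rule integral_mono_AE')
      show "integrable (law ?D) (\<lambda>_. 1 :: real)" by (rule law.integrable_const)
    qed (use b in auto)
    also have "\<dots> = 1" using law.prob_space by simp
    finally show "\<mu> \<le> 1" .
  qed
  have sqi: "integrable (law I) (\<lambda>z. (loo k W z - \<mu>)\<^sup>2)" if "W \<in> ?S" for W
  proof (rule law.integrable_bounded[of _ _ 1])
    show "(\<lambda>z. (loo k W z - \<mu>)\<^sup>2) \<in> borel_measurable (law I)"
      using borel_measurable_integrable[OF li[OF that]] by simp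
    fix z assume z: "z \<in> space (law I)"
    have "\<bar>loo k W z - \<mu>\<bar> \<le> 1"
      using loo_bounds[OF W(1)[OF that] W(3)[OF that] W(2)[OF that] z, of k] \<mu> by (auto simp: abs_le_iff)
    then show "\<bar>(loo k W z - \<mu>)\<^sup>2\<bar> \<le> 1" by (simp add: abs_square_le_1)
  qed
  have "integral\<^sup>L (law I) (held_out k m G) = (\<Sum>W\<in>?S. \<integral>z. loo k W z \<partial>law I) / real (card ?S)"
    unfolding ho[abs_def] using li by (simp add: Bochner_Integration.integral_sum)
  also have "\<dots> = \<mu>" using mean pos by simp
  finally have E: "integral\<^sup>L (law I) (held_out k m G) = \<mu>" .
  have jensen: "(held_out k m G z - \<mu>)\<^sup>2 \<le> (\<Sum>W\<in>?S. (loo k W z - \<mu>)\<^sup>2) / real (card ?S)" for z :: "nat \<Rightarrow> (real ^ 'd) \<times> nat"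
  proof -
    have "held_out k m G z - \<mu> = (\<Sum>W\<in>?S. loo k W z - \<mu>) / real (card ?S)"
      unfolding ho using pos by (simp add: sum_subtractf diff_divide_distrib)
    then have "(held_out k m G z - \<mu>)\<^sup>2 = (\<Sum>W\<in>?S. loo k W z - \<mu>)\<^sup>2 / (real (card ?S))\<^sup>2"
      by (simp only: power_divide)
    also have "\<dots> \<le> ((\<Sum>W\<in>?S. (loo k W z - \<mu>)\<^sup>2) * real (card ?S)) / (real (card ?S))\<^sup>2"
      by (intro divide_right_mono sum_squared_le_sum_of_squares) auto
    also have "\<dots> = (\<Sum>W\<in>?S. (loo k W z - \<mu>)\<^sup>2) / real (card ?S)"
      using pos by (simp add: power2_eq_square)
    finally show ?thesis .
  qed
  have "(\<integral>z. (held_out k m G z - \<mu>)\<^sup>2 \<partial>law I) \<le> (\<integral>z. (\<Sum>W\<in>?S. (loo k W z - \<mu>)\<^sup>2) / real (card ?S) \<partial>law I)"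
  proof (rule integral_mono_AE')
    show "integrable (law I) (\<lambda>z. (\<Sum>W\<in>?S. (loo k W z - \<mu>)\<^sup>2) / real (card ?S))"
      using sqi by (intro integrable_divide_zero Bochner_Integration.integrable_sum)
    show "AE z in law I. (held_out k m G z - \<mu>)\<^sup>2 \<le> (\<Sum>W\<in>?S. (loo k W z - \<mu>)\<^sup>2) / real (card ?S)"
      using jensen by simp
    show "AE z in law I. 0 \<le> (\<Sum>W\<in>?S. (loo k W z - \<mu>)\<^sup>2) / real (card ?S)"
      by (intro AE_I2 divide_nonneg_nonneg sum_nonneg) auto
  qed
  also have "\<dots> = (\<Sum>W\<in>?S. \<integral>z. (loo k W z - \<mu>)\<^sup>2 \<partial>law I) / real (card ?S)"
    using sqi by (simp add: Bochner_Integration.integral_sum)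
  also have "\<dots> \<le> (\<Sum>W\<in>?S. ?V) / real (card ?S)"
    using var by (intro divide_right_mono sum_mono) auto
  also have "\<dots> = ?V" using pos by simp
  finally show ?thesis unfolding E .
qed

end

section \<open>Averages over independent fair coins\<close>

abbreviation (input) coin :: "bool measure" where
  "coin \<equiv> measure_pmf (bernoulli_pmf (1/2))"

lemma coin_prob_space: "prob_space coin"
  by (rule measure_pmf.prob_space_axioms)

lemma coin_component_integral:
  fixes \<phi> :: "bool \<Rightarrow> real"
  assumes "t \<in> T"
  shows "(\<integral>c. \<phi> (c t) \<partial>PiM T (\<lambda>_. coin)) = (\<phi> True + \<phi> False) / 2"
proof -
  have "(\<integral>c. \<phi> (c t) \<partial>PiM T (\<lambda>_. coin)) = (\<integral>b. \<phi> b \<partial>distr (PiM T (\<lambda>_. coin)) coin (\<lambda>c. c t))"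
    by (rule integral_distr[symmetric, OF measurable_component_singleton[OF assms]]) simp
  also have "\<dots> = (\<integral>b. \<phi> b \<partial>coin)"
    using distr_PiM_component[of T "\<lambda>_. coin" t] coin_prob_space assms by simp
  finally show ?thesis by (simp add: add_divide_distrib)
qed

text \<open>The deviations \<open>d t\<close> are centred, uncorrelated and at most 1/2 in absolute
  value, so their average over \<open>N\<close> coins has variance at most
  \<open>1 / (4 * N)\<close>. About an arbitrary \<open>a\<close> the squared bias is added.\<close>

lemma coin_average:
  fixes \<phi> :: "'t \<Rightarrow> bool \<Rightarrow> real"
  assumes T: "finite T'" "T' \<subseteq> T" "T' \<noteq> {}" and \<phi>: "\<And>t b. \<phi> t b \<in> {0..1}"
  defines "\<mu> \<equiv> (\<Sum>t\<in>T'. (\<phi> t True + \<phi> t False) / 2) / real (card T')"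
  shows "(\<integral>c. (\<Sum>t\<in>T'. \<phi> t (c t)) / real (card T') \<partial>PiM T (\<lambda>_. coin)) = \<mu>"
    and "(\<integral>c. ((\<Sum>t\<in>T'. \<phi> t (c t)) / real (card T') - a)\<^sup>2 \<partial>PiM T (\<lambda>_. coin)) \<le> (\<mu> - a)\<^sup>2 + 1 / (4 * real (card T'))"
proof -
  let ?C = "PiM T (\<lambda>_. coin)" and ?N = "real (card T')"
  interpret C: prob_space ?C by (rule prob_space.prob_space_PiM_const[OF coin_prob_space])
  have N: "0 < ?N" using T by (simp add: card_gt_0_iff)
  define m where "m t = (\<phi> t True + \<phi> t False) / 2" for t
  define d where "d t b = \<phi> t b - m t" for t b
  have \<phi>': "0 \<le> \<phi> t b" "\<phi> t b \<le> 1" for t b using \<phi>[of t b] by auto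
  have db: "\<bar>d t b\<bar> \<le> 1 / 2" for t b
    unfolding d_def m_def using \<phi>'[of t True] \<phi>'[of t False] by (cases b) (auto simp: abs_le_iff field_simps)
  have cm: "(\<lambda>c. \<psi> (c t)) \<in> borel_measurable ?C" if "t \<in> T'" for \<psi> :: "bool \<Rightarrow> real" and t
  proof -
    have "(\<lambda>c. c t) \<in> measurable ?C coin"
      by (rule measurable_component_singleton) (use T(2) that in auto)
    moreover have "\<psi> \<in> borel_measurable coin" by simp
    ultimately show ?thesis by (rule measurable_compose)
  qed
  have i\<phi>: "integrable ?C (\<lambda>c. \<phi> t (c t))" if "t \<in> T'" for t
    using \<phi>' by (intro C.integrable_bounded[OF cm[OF that], where c = 1]) auto
  have id: "integrable ?C (\<lambda>c. d t (c t))" if "t \<in> T'" for t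
    using order_trans[OF db] by (intro C.integrable_bounded[OF cm[OF that], where c = 1]) auto
  have idd: "integrable ?C (\<lambda>c. d s (c s) * d t (c t))" if "s \<in> T'" "t \<in> T'" for s t
  proof (rule C.integrable_bounded[of _ 1])
    show "(\<lambda>c. d s (c s) * d t (c t)) \<in> borel_measurable ?C" using cm that by simp
    show "\<bar>d s (c s) * d t (c t)\<bar> \<le> 1" for c
      unfolding abs_mult using db[of s "c s"] db[of t "c t"] by (intro mult_le_one) auto
  qed
  have mean_d: "(\<integral>c. d t (c t) \<partial>?C) = 0" if "t \<in> T'" for t
    using coin_component_integral[of t T "d t"] T(2) that by (auto simp: d_def m_def)
  \<comment> \<open>Overwriting the coin \<open>s\<close> averages the first factor to 0 and leaves
    the second unchanged.\<close>
  have cross: "(\<integral>c. d s (c s) * d t (c t) \<partial>?C) = 0" if "s \<in> T'" "t \<in> T'" "s \<noteq> t" for s t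
  proof -
    have s: "s \<in> T" using that T(2) by blast
    have "(\<integral>c. d s (c s) * d t (c t) \<partial>?C) = (\<integral>c. (\<integral>v. d s ((c(s := v)) s) * d t ((c(s := v)) t) \<partial>coin) \<partial>?C)"
    proof (rule prob_space.resample_integral(2)[OF coin_prob_space s, of _ 1])
      show "(\<lambda>c. d s (c s) * d t (c t)) \<in> borel_measurable ?C" using cm that by simp
      show "\<bar>d s (c s) * d t (c t)\<bar> \<le> 1" for c
        unfolding abs_mult using db[of s "c s"] db[of t "c t"] by (intro mult_le_one) auto
    qed
    also have "\<dots> = (\<integral>c. 0 \<partial>?C)"
      using that(3) by (intro Bochner_Integration.integral_cong) (auto simp: d_def m_def field_simps)
    finally show ?thesis by simp
  qed
  have diag: "(\<integral>c. d t (c t) * d t (c t) \<partial>?C) \<le> 1 / 4" if "t \<in> T'" for t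
  proof -
    have "(\<integral>c. d t (c t) * d t (c t) \<partial>?C) \<le> (\<integral>c. 1 / 4 \<partial>?C)"
    proof (rule integral_mono[OF idd[OF that that]])
      show "d t (c t) * d t (c t) \<le> 1 / 4" for c
        using mult_mono[OF db[of t "c t"] db[of t "c t"]] by (simp add: abs_mult_self_eq flip: abs_mult)
    qed simp
    then show ?thesis using C.prob_space by simp
  qed
  have X: "(\<Sum>t\<in>T'. \<phi> t (c t)) / ?N - \<mu> = (\<Sum>t\<in>T'. d t (c t)) / ?N" for c
    unfolding \<mu>_def d_def m_def by (simp add: sum_subtractf diff_divide_distrib)
  show mean: "(\<integral>c. (\<Sum>t\<in>T'. \<phi> t (c t)) / ?N \<partial>?C) = \<mu>"
  proof -
    have "(\<integral>c. (\<Sum>t\<in>T'. \<phi> t (c t)) / ?N \<partial>?C) = (\<Sum>t\<in>T'. \<integral>c. \<phi> t (c t) \<partial>?C) / ?N"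
      using i\<phi> by (simp add: Bochner_Integration.integral_sum)
    also have "\<dots> = \<mu>"
      unfolding \<mu>_def using T(2)
      by (intro arg_cong2[where f = "(/)"] sum.cong refl) (auto simp: coin_component_integral)
    finally show ?thesis .
  qed
  have sq: "((\<Sum>t\<in>T'. \<phi> t (c t)) / ?N - a)\<^sup>2 = (\<mu> - a)\<^sup>2 + 2 * (\<mu> - a) * ((\<Sum>t\<in>T'. d t (c t)) / ?N)
      + (\<Sum>s\<in>T'. \<Sum>t\<in>T'. d s (c s) * d t (c t)) / ?N\<^sup>2" for c
  proof -
    have "((\<Sum>t\<in>T'. \<phi> t (c t)) / ?N - a) = (\<mu> - a) + (\<Sum>t\<in>T'. d t (c t)) / ?N" using X[of c] by linarith
    then have "((\<Sum>t\<in>T'. \<phi> t (c t)) / ?N - a)\<^sup>2 = (\<mu> - a)\<^sup>2 + 2 * (\<mu> - a) * ((\<Sum>t\<in>T'. d t (c t)) / ?N) + ((\<Sum>t\<in>T'. d t (c t)) / ?N)\<^sup>2"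
      by (simp only: power2_sum)
    then show ?thesis by (simp add: power_divide power2_eq_square sum_product)
  qed
  have i2: "integrable ?C (\<lambda>c. 2 * (\<mu> - a) * ((\<Sum>t\<in>T'. d t (c t)) / ?N))"
    using id by (intro integrable_mult_right integrable_divide_zero Bochner_Integration.integrable_sum)
  have e2: "(\<integral>c. 2 * (\<mu> - a) * ((\<Sum>t\<in>T'. d t (c t)) / ?N) \<partial>?C) = 0"
    using id mean_d by (simp add: Bochner_Integration.integral_sum)
  have i3: "integrable ?C (\<lambda>c. (\<Sum>s\<in>T'. \<Sum>t\<in>T'. d s (c s) * d t (c t)) / ?N\<^sup>2)"
    "(\<integral>c. (\<Sum>s\<in>T'. \<Sum>t\<in>T'. d s (c s) * d t (c t)) / ?N\<^sup>2 \<partial>?C) = (\<Sum>s\<in>T'. \<Sum>t\<in>T'. \<integral>c. d s (c s) * d t (c t) \<partial>?C) / ?N\<^sup>2"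
    by (rule integral_double_sum, rule idd, assumption+)+
  have "(\<integral>c. ((\<Sum>t\<in>T'. \<phi> t (c t)) / ?N - a)\<^sup>2 \<partial>?C) = (\<mu> - a)\<^sup>2 + (\<Sum>s\<in>T'. \<Sum>t\<in>T'. \<integral>c. d s (c s) * d t (c t) \<partial>?C) / ?N\<^sup>2"
  proof -
    have e1: "(\<integral>c. (\<mu> - a)\<^sup>2 \<partial>?C) = (\<mu> - a)\<^sup>2" using C.prob_space by simp
    show ?thesis
      unfolding sq
        Bochner_Integration.integral_add[OF Bochner_Integration.integrable_add[OF C.integrable_const i2] i3(1)]
        Bochner_Integration.integral_add[OF C.integrable_const i2] e1 e2 i3(2) by (simp only: add_0_right)
  qed
  also have "(\<Sum>s\<in>T'. \<Sum>t\<in>T'. \<integral>c. d s (c s) * d t (c t) \<partial>?C) \<le> (\<Sum>s\<in>T'. \<Sum>t\<in>T'. if s = t then 1 / 4 else 0)"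
    using cross diag by (intro sum_mono) auto
  also have "(\<Sum>s\<in>T'. \<Sum>t\<in>T'. if s = t then 1 / 4 else 0) = ?N / 4"
    using T(1) by simp
  also have "?N / 4 / ?N\<^sup>2 = 1 / (4 * ?N)" using N by (simp add: power2_eq_square)
  finally show "(\<integral>c. ((\<Sum>t\<in>T'. \<phi> t (c t)) / ?N - a)\<^sup>2 \<partial>?C) \<le> (\<mu> - a)\<^sup>2 + 1 / (4 * ?N)"
    by (simp add: divide_right_mono)
qed

section \<open>Tie-breaking variables and the leave-p-out estimator\<close>

lemma knn_cong:
  assumes "k \<ge> 1" "\<And>i. i \<in> e \<Longrightarrow> z i = z' i"
  shows "knn k e z b x = knn k e z' b x"
proof -
  have "votes real k e (\<lambda>i. dist (fst (z i)) x) (\<lambda>i. snd (z i)) = votes real k e (\<lambda>i. dist (fst (z' i)) x) (\<lambda>i. snd (z' i))"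
    using assms(2) by (intro votes_cong) auto
  then show ?thesis unfolding knn_votes[OF assms(1)] by simp
qed

text \<open>Each pair of a training set and a held-out point carries its own coin; indexing by pairs
  makes \<open>lpo_risk\<close> a single average over distinct coins.\<close>

definition test_pairs :: "nat \<Rightarrow> nat \<Rightarrow> (nat set \<times> nat) set" where
  "test_pairs n p = (SIGMA e:{e. e \<subseteq> {1..n} \<and> card e = n - p}. {1..n} - e)"

lemma finite_test_pairs: "finite (test_pairs n p)"
  unfolding test_pairs_def by (intro finite_SigmaI) auto

lemma test_pairs_subset: "test_pairs n p \<subseteq> tie_index n"
  by (auto simp: test_pairs_def tie_index_def)

lemma sum_test_pairs:
  fixes f :: "nat set \<Rightarrow> nat \<Rightarrow> real"
  shows "(\<Sum>e\<in>{e. e \<subseteq> {1..n} \<and> card e = n - p}. \<Sum>i\<in>{1..n} - e. f e i) = (\<Sum>t\<in>test_pairs n p. f (fst t) (snd t))"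
  unfolding test_pairs_def by (subst sum.Sigma) (auto simp: case_prod_unfold)

lemma card_test_pairs:
  assumes "p \<le> n"
  shows "card (test_pairs n p) = (n choose p) * p"
proof -
  have "card (test_pairs n p) = (\<Sum>e\<in>{e. e \<subseteq> {1..n} \<and> card e = n - p}. card ({1..n} - e))"
    unfolding test_pairs_def by (intro card_SigmaI) auto
  also have "\<dots> = (\<Sum>e\<in>{e. e \<subseteq> {1..n} \<and> card e = n - p}. p)"
    using assms by (intro sum.cong) (auto simp: card_Diff_subset finite_subset)
  also have "\<dots> = (n choose p) * p"
    using n_subsets[of "{1..n}" "n - p"] binomial_symmetric[OF assms] by simp
  finally show ?thesis .
qed

text \<open>Since \<open>(n choose p) * p = n * ((n - 1) choose (p - 1))\<close>, at least
  \<open>n\<close> coins are averaged, which keeps their variance at order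
  \<open>1 / n\<close>.\<close>

lemma card_test_pairs_ge:
  assumes "1 \<le> p" "p \<le> n"
  shows "n \<le> card (test_pairs n p)"
proof -
  have "(n choose p) * p = n * ((n - 1) choose (p - 1))"
    using times_binomial_minus1_eq[of p n] assms by (simp add: mult.commute)
  moreover have "1 \<le> (n - 1) choose (p - 1)" using assms by (simp add: Suc_le_eq zero_less_binomial)
  ultimately show ?thesis using card_test_pairs[OF assms(2)] by simp
qed

lemma lpo_risk_eq:
  assumes "p \<le> n"
  shows "lpo_risk k p n z c = (\<Sum>t\<in>test_pairs n p. of_bool (knn k (fst t) z (c t) (fst (z (snd t))) \<noteq> snd (z (snd t))))
     / real (card (test_pairs n p))"
  unfolding lpo_risk_def card_test_pairs[OF assms] sum_distrib_left[symmetric] sum_test_pairs by simp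

lemma lpo_risk_bounds:
  assumes "p \<le> n"
  shows "0 \<le> lpo_risk k p n z c" "lpo_risk k p n z c \<le> 1"
proof -
  let ?X = "\<Sum>t\<in>test_pairs n p. of_bool (knn k (fst t) z (c t) (fst (z (snd t))) \<noteq> snd (z (snd t))) :: real"
  show "0 \<le> lpo_risk k p n z c"
    unfolding lpo_risk_eq[OF assms] by (intro divide_nonneg_nonneg sum_nonneg) auto
  have "?X \<le> (\<Sum>t\<in>test_pairs n p. 1)" by (intro sum_mono) auto
  then show "lpo_risk k p n z c \<le> 1"
    unfolding lpo_risk_eq[OF assms] by (cases "card (test_pairs n p) = 0") (simp_all add: divide_le_eq_1)
qed

lemma lpo_risk_cong:
  assumes "k \<ge> 1" "p \<le> n" "\<And>i. i \<in> {1..n} \<Longrightarrow> z i = z' i" "\<And>t. t \<in> test_pairs n p \<Longrightarrow> c t = c' t"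
  shows "lpo_risk k p n z c = lpo_risk k p n z' c'"
  unfolding lpo_risk_eq[OF assms(2)]
proof (intro arg_cong2[where f = "(/)"] sum.cong refl)
  fix t assume t: "t \<in> test_pairs n p"
  then have "fst t \<subseteq> {1..n}" "snd t \<in> {1..n}" by (auto simp: test_pairs_def)
  then have "knn k (fst t) z b x = knn k (fst t) z' b x" "z (snd t) = z' (snd t)" for b x
    using assms(1,3) by (auto intro!: knn_cong)
  then show "of_bool (knn k (fst t) z (c t) (fst (z (snd t))) \<noteq> snd (z (snd t))) = of_bool (knn k (fst t) z' (c' t) (fst (z' (snd t))) \<noteq> snd (z' (snd t)))"
    using assms(4)[OF t] by simp
qed

context labelled_law
begin

abbreviation ties :: "nat \<Rightarrow> (nat set \<times> nat \<Rightarrow> bool) measure" where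
  "ties n \<equiv> PiM (tie_index n) (\<lambda>_. coin)"

lemma ties_prob_space: "prob_space (ties n)"
  by (rule prob_space.prob_space_PiM_const[OF coin_prob_space])

text \<open>For a fixed coin value the prediction is a function of the vote count, which takes
  countably many values; given the count, the error depends on one label only.\<close>

lemma measurable_knn_error:
  assumes "finite e" "e \<subseteq> I" "i \<in> I" "k \<ge> 1"
  shows "(\<lambda>z. of_bool (knn k e z b (fst (z i)) \<noteq> snd (z i)) :: real) \<in> borel_measurable (law I)"
  unfolding knn_votes[OF assms(4)]
proof (rule measurable_compose_countable[where
      f = "\<lambda>s z. of_bool ((if int k < 2 * int s then 1 else if 2 * int s < int k then 0 else of_bool b) \<noteq> snd (z i))"])
  show "(\<lambda>z. votes real k e (\<lambda>l. dist (fst (z l)) (fst (z i))) (\<lambda>l. snd (z l))) \<in> law I \<rightarrow>\<^sub>M count_space UNIV"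
  proof (rule measurable_votes[OF assms(1)])
    fix l assume "l \<in> e"
    then have l: "l \<in> I" using assms(2) by auto
    show "(\<lambda>z. dist (fst (z l)) (fst (z i))) \<in> borel_measurable (law I)"
      by (intro borel_measurable_dist measurable_compose[OF measurable_component_singleton[OF l] measurable_point]
          measurable_compose[OF measurable_component_singleton[OF assms(3)] measurable_point])
    show "(\<lambda>z. snd (z l)) \<in> law I \<rightarrow>\<^sub>M count_space UNIV"
      by (rule measurable_compose[OF measurable_component_singleton[OF l] measurable_label])
  qed simp
  show "(\<lambda>z. of_bool ((if int k < 2 * int s then 1 else if 2 * int s < int k then 0 else of_bool b) \<noteq> snd (z i)) :: real)
      \<in> borel_measurable (law I)" for s
    by (rule measurable_compose[OF measurable_compose[OF measurable_component_singleton[OF assms(3)] measurable_label]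
          borel_measurable_count_space])
qed

lemma measurable_knn_error_pair:
  assumes "finite e" "e \<subseteq> I" "i \<in> I" "k \<ge> 1" "t \<in> tie_index n"
  shows "(\<lambda>w. of_bool (knn k e (fst w) (snd w t) (fst (fst w i)) \<noteq> snd (fst w i)) :: real) \<in> borel_measurable (law I \<Otimes>\<^sub>M ties n)"
proof (rule measurable_compose_countable[where f = "\<lambda>b w. of_bool (knn k e (fst w) b (fst (fst w i)) \<noteq> snd (fst w i))"])
  show "(\<lambda>w. of_bool (knn k e (fst w) b (fst (fst w i)) \<noteq> snd (fst w i)) :: real) \<in> borel_measurable (law I \<Otimes>\<^sub>M ties n)" for b
    by (rule measurable_compose[OF measurable_fst measurable_knn_error[OF assms(1-4)]])
  have "(\<lambda>w. snd w t) \<in> law I \<Otimes>\<^sub>M ties n \<rightarrow>\<^sub>M coin"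
    by (rule measurable_compose[OF measurable_snd measurable_component_singleton[OF assms(5)]])
  then show "(\<lambda>w. snd w t) \<in> law I \<Otimes>\<^sub>M ties n \<rightarrow>\<^sub>M count_space UNIV"
    by (simp add: measurable_cong_sets)
qed

lemma measurable_lpo_risk:
  assumes "k \<ge> 1" "p \<le> n" "{1..n} \<subseteq> I"
  shows "(\<lambda>w. lpo_risk k p n (fst w) (snd w)) \<in> borel_measurable (law I \<Otimes>\<^sub>M ties n)"
  unfolding lpo_risk_eq[OF assms(2)]
proof (intro borel_measurable_divide borel_measurable_sum borel_measurable_const)
  fix t assume t: "t \<in> test_pairs n p"
  then have "finite (fst t)" "fst t \<subseteq> I" "snd t \<in> I"
    using assms(3) finite_subset[of "fst t" "{1..n}"] by (auto simp: test_pairs_def)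
  then show "(\<lambda>w. of_bool (knn k (fst t) (fst w) (snd w t) (fst (fst w (snd t))) \<noteq> snd (fst w (snd t))) :: real)
      \<in> borel_measurable (law I \<Otimes>\<^sub>M ties n)"
    using t test_pairs_subset assms(1) by (intro measurable_knn_error_pair) auto
qed

lemma lpo_risk_ties:
  assumes k: "k \<ge> 1" and p: "1 \<le> p" "p \<le> n" and I: "{1..n} \<subseteq> I" and z: "z \<in> space (law I)"
  shows "(\<integral>c. lpo_risk k p n z c \<partial>ties n) = held_out k (n - p) {1..n} z"
    and "(\<integral>c. (lpo_risk k p n z c - a)\<^sup>2 \<partial>ties n) \<le> (held_out k (n - p) {1..n} z - a)\<^sup>2 + 1 / (4 * real n)"
proof -
  define \<phi> where "\<phi> t b = (of_bool (knn k (fst t) z b (fst (z (snd t))) \<noteq> snd (z (snd t))) :: real)" for t b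
  have \<phi>: "\<phi> t b \<in> {0..1}" for t b by (simp add: \<phi>_def)
  have n1: "n \<le> card (test_pairs n p)" by (rule card_test_pairs_ge[OF p])
  have ne: "test_pairs n p \<noteq> {}" using n1 p by auto
  have lpo: "lpo_risk k p n z c = (\<Sum>t\<in>test_pairs n p. \<phi> t (c t)) / real (card (test_pairs n p))" for c
    unfolding lpo_risk_eq[OF p(2)] \<phi>_def ..
  have ho: "(\<Sum>t\<in>test_pairs n p. (\<phi> t True + \<phi> t False) / 2) / real (card (test_pairs n p)) = held_out k (n - p) {1..n} z"
  proof -
    have "(\<Sum>t\<in>test_pairs n p. (\<phi> t True + \<phi> t False) / 2) = (\<Sum>t\<in>test_pairs n p. err k (fst t) z (z (snd t)))"
    proof (rule sum.cong[OF refl])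
      fix t assume "t \<in> test_pairs n p"
      then have "snd t \<in> I" using I by (auto simp: test_pairs_def)
      then show "(\<phi> t True + \<phi> t False) / 2 = err k (fst t) z (z (snd t))"
        unfolding \<phi>_def using label[OF coordinate[OF z]] k by (intro err_knn) auto
    qed
    moreover have "real (card (test_pairs n p)) = real (card {1..n} choose (n - p)) * real (card {1..n} - (n - p))"
      using p by (simp add: card_test_pairs[OF p(2)] binomial_symmetric[OF p(2)])
    ultimately show ?thesis unfolding held_out_def sum_test_pairs by simp
  qed
  note avg = coin_average[where \<phi> = \<phi>, OF finite_test_pairs test_pairs_subset ne \<phi>, unfolded ho]
  show "(\<integral>c. lpo_risk k p n z c \<partial>ties n) = held_out k (n - p) {1..n} z"
    unfolding lpo by (rule avg(1))
  have "(\<integral>c. (lpo_risk k p n z c - a)\<^sup>2 \<partial>ties n) \<le> (held_out k (n - p) {1..n} z - a)\<^sup>2 + 1 / (4 * real (card (test_pairs n p)))"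
    unfolding lpo by (rule avg(2))
  also have "\<dots> \<le> (held_out k (n - p) {1..n} z - a)\<^sup>2 + 1 / (4 * real n)"
    using n1 p by (intro add_left_mono divide_left_mono) auto
  finally show "(\<integral>c. (lpo_risk k p n z c - a)\<^sup>2 \<partial>ties n) \<le> (held_out k (n - p) {1..n} z - a)\<^sup>2 + 1 / (4 * real n)" .
qed

text \<open>The function \<open>h\<close> is the constant \<open>R\<close> for the risk and
  \<open>lerr\<close> for the conditional error.\<close>

lemma lpo_risk_joint:
  assumes k: "k \<ge> 1" and p: "1 \<le> p" "p \<le> n" and I: "{1..n} \<subseteq> I"
    and h: "h \<in> borel_measurable (law I)" and hb: "\<And>z. z \<in> space (law I) \<Longrightarrow> 0 \<le> h z \<and> h z \<le> 1"
  shows "(\<integral>w. lpo_risk k p n (fst w) (snd w) \<partial>(law I \<Otimes>\<^sub>M ties n)) = (\<integral>z. held_out k (n - p) {1..n} z \<partial>law I)"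
    and "(\<integral>w. (lpo_risk k p n (fst w) (snd w) - h (fst w))\<^sup>2 \<partial>(law I \<Otimes>\<^sub>M ties n))
      \<le> (\<integral>z. (held_out k (n - p) {1..n} z - h z)\<^sup>2 \<partial>law I) + 1 / (4 * real n)"
proof -
  let ?Q = "law I \<Otimes>\<^sub>M ties n"
  interpret C: prob_space "ties n" by (rule ties_prob_space)
  interpret Q: pair_prob_space "law I" "ties n" by unfold_locales
  note m = measurable_lpo_risk[OF k p(2) I]
  note b = lpo_risk_bounds[OF p(2)]
  have i1: "integrable ?Q (\<lambda>w. lpo_risk k p n (fst w) (snd w))"
  proof (rule Q.integrable_bounded[OF m])
    show "\<bar>lpo_risk k p n (fst w) (snd w)\<bar> \<le> 1" for w
      using b(1)[of k "fst w" "snd w"] b(2)[of k "fst w" "snd w"] by simp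
  qed
  have "(\<integral>w. lpo_risk k p n (fst w) (snd w) \<partial>?Q) = (\<integral>z. (\<integral>c. lpo_risk k p n z c \<partial>ties n) \<partial>law I)"
    using Q.integral_fst[of "\<lambda>z c. lpo_risk k p n z c"] i1 by (simp add: case_prod_unfold)
  also have "\<dots> = (\<integral>z. held_out k (n - p) {1..n} z \<partial>law I)"
    by (intro Bochner_Integration.integral_cong refl lpo_risk_ties[OF k p I])
  finally show "(\<integral>w. lpo_risk k p n (fst w) (snd w) \<partial>?Q) = (\<integral>z. held_out k (n - p) {1..n} z \<partial>law I)" .
  have sqb: "\<bar>(x - y)\<^sup>2\<bar> \<le> 1" if "0 \<le> x" "x \<le> 1" "0 \<le> y \<and> y \<le> 1" for x y :: real
    using that by (auto simp: abs_square_le_1 abs_le_iff)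
  have i2: "integrable ?Q (\<lambda>w. (lpo_risk k p n (fst w) (snd w) - h (fst w))\<^sup>2)"
  proof (rule Q.integrable_bounded[of _ 1])
    show "(\<lambda>w. (lpo_risk k p n (fst w) (snd w) - h (fst w))\<^sup>2) \<in> borel_measurable ?Q"
      using m measurable_compose[OF measurable_fst h, of "ties n"] by simp
    show "\<bar>(lpo_risk k p n (fst w) (snd w) - h (fst w))\<^sup>2\<bar> \<le> 1" if "w \<in> space ?Q" for w
      using b hb[of "fst w"] that by (intro sqb) (auto simp: space_pair_measure)
  qed
  have i3: "integrable (law I) (\<lambda>z. (held_out k (n - p) {1..n} z - h z)\<^sup>2)"
  proof (rule law.integrable_bounded[of _ _ 1])
    show "(\<lambda>z. (held_out k (n - p) {1..n} z - h z)\<^sup>2) \<in> borel_measurable (law I)"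
      using measurable_held_out[of "{1..n}" I k "n - p"] I h by simp
    show "\<bar>(held_out k (n - p) {1..n} z - h z)\<^sup>2\<bar> \<le> 1" if "z \<in> space (law I)" for z
      using held_out_bounds[of "{1..n}" I "n - p" z k] hb[OF that] I p that by (intro sqb) auto
  qed
  have "(\<integral>w. (lpo_risk k p n (fst w) (snd w) - h (fst w))\<^sup>2 \<partial>?Q) = (\<integral>z. (\<integral>c. (lpo_risk k p n z c - h z)\<^sup>2 \<partial>ties n) \<partial>law I)"
    using Q.integral_fst[of "\<lambda>z c. (lpo_risk k p n z c - h z)\<^sup>2"] i2 by (simp add: case_prod_unfold)
  also have "\<dots> \<le> (\<integral>z. (held_out k (n - p) {1..n} z - h z)\<^sup>2 + 1 / (4 * real n) \<partial>law I)"
  proof (rule integral_mono)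
    show "integrable (law I) (\<lambda>z. \<integral>c. (lpo_risk k p n z c - h z)\<^sup>2 \<partial>ties n)"
      using Q.integrable_fst[of "\<lambda>z c. (lpo_risk k p n z c - h z)\<^sup>2"] i2 by (simp add: case_prod_unfold)
    show "integrable (law I) (\<lambda>z. (held_out k (n - p) {1..n} z - h z)\<^sup>2 + 1 / (4 * real n))"
      by (intro Bochner_Integration.integrable_add i3 law.integrable_const)
    show "(\<integral>c. (lpo_risk k p n z c - h z)\<^sup>2 \<partial>ties n) \<le> (held_out k (n - p) {1..n} z - h z)\<^sup>2 + 1 / (4 * real n)"
      if "z \<in> space (law I)" for z
      by (rule lpo_risk_ties(2)[OF k p I that])
  qed
  also have "\<dots> = (\<integral>z. (held_out k (n - p) {1..n} z - h z)\<^sup>2 \<partial>law I) + (\<integral>z. 1 / (4 * real n) \<partial>law I)"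
    by (rule Bochner_Integration.integral_add[OF i3 law.integrable_const])
  also have "(\<integral>z. 1 / (4 * real n) \<partial>law I) = 1 / (4 * real n)"
    using law.prob_space by simp
  finally show "(\<integral>w. (lpo_risk k p n (fst w) (snd w) - h (fst w))\<^sup>2 \<partial>?Q)
      \<le> (\<integral>z. (held_out k (n - p) {1..n} z - h z)\<^sup>2 \<partial>law I) + 1 / (4 * real n)" .
qed

text \<open>\<open>B\<close> stands for an event about the data. Averaging out the coin and then the
  fresh point 0 shows that \<open>lerr\<close> has the integrals characterising the conditional
  expectation.\<close>

lemma new_point_error:
  assumes k: "k \<ge> 1" and n: "n \<ge> 1" and B: "B \<in> sets (law {1..n})"
  shows "(\<integral>w. indicator B (restrict (fst w) {1..n}) *
        of_bool (knn k {1..n} (fst w) (snd w ({1..n}, 0)) (fst (fst w 0)) \<noteq> snd (fst w 0)) \<partial>(law {0..n} \<Otimes>\<^sub>M ties n))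
    = (\<integral>z. indicator B (restrict z {1..n}) * lerr k {1..n} z \<partial>law {0..n})"
proof -
  let ?P = "law {0..n}" and ?Q = "law {0..n} \<Otimes>\<^sub>M ties n" and ?G = "{1..n}"
  interpret C: prob_space "ties n" by (rule ties_prob_space)
  interpret Q: pair_prob_space ?P "ties n" by unfold_locales
  define X where "X z b = (of_bool (knn k ?G z b (fst (z 0)) \<noteq> snd (z 0)) :: real)" for z :: "nat \<Rightarrow> (real ^ 'd) \<times> nat" and b
  define J where "J z = (indicator B (restrict z ?G) :: real)" for z :: "nat \<Rightarrow> (real ^ 'd) \<times> nat"
  have t: "(?G, 0::nat) \<in> tie_index n" by (simp add: tie_index_def)
  have G: "finite ?G" "?G \<subseteq> {0..n}" "0 \<in> {0..n}" "0 \<notin> ?G" by auto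
  have Jm: "J \<in> borel_measurable ?P"
    unfolding J_def using B G(2) by (intro measurable_compose[OF measurable_restrict_subset borel_measurable_indicator])
  have J01: "J z \<in> {0, 1}" for z by (simp add: J_def indicator_def)
  have Xm: "(\<lambda>w. X (fst w) (snd w (?G, 0))) \<in> borel_measurable ?Q"
    unfolding X_def by (rule measurable_knn_error_pair[OF G(1-3) k t])
  have m: "(\<lambda>w. J (fst w) * X (fst w) (snd w (?G, 0))) \<in> borel_measurable ?Q"
    using measurable_compose[OF measurable_fst Jm, of "ties n"] Xm by simp
  have "integrable ?Q (\<lambda>w. J (fst w) * X (fst w) (snd w (?G, 0)))"
    using J01 by (intro Q.integrable_bounded[OF m, of 1]) (auto simp: X_def abs_mult J_def indicator_def)
  then have "(\<integral>w. J (fst w) * X (fst w) (snd w (?G, 0)) \<partial>?Q) = (\<integral>z. (\<integral>c. J z * X z (c (?G, 0)) \<partial>ties n) \<partial>?P)"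
    using Q.integral_fst[of "\<lambda>z c. J z * X z (c (?G, 0))"] by (simp add: case_prod_unfold)
  also have "\<dots> = (\<integral>z. J z * err k ?G z (z 0) \<partial>?P)"
  proof (rule Bochner_Integration.integral_cong[OF refl])
    fix z assume z: "z \<in> space ?P"
    have "(\<integral>c. X z (c (?G, 0)) \<partial>ties n) = (X z True + X z False) / 2"
      by (rule coin_component_integral[OF t])
    also have "\<dots> = err k ?G z (z 0)"
      unfolding X_def using label[OF coordinate[OF z G(3)]] k by (rule err_knn)
    finally show "(\<integral>c. J z * X z (c (?G, 0)) \<partial>ties n) = J z * err k ?G z (z 0)" by simp
  qed
  also have "\<dots> = (\<integral>z. (\<integral>v. J (z(0 := v)) * err k ?G (z(0 := v)) ((z(0 := v)) 0) \<partial>\<nu>) \<partial>?P)"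
  proof (rule resample_integral(2)[OF G(3), of _ 1])
    show "(\<lambda>z. J z * err k ?G z (z 0)) \<in> borel_measurable ?P"
      using Jm measurable_err[OF G(1-3), of k] by simp
    show "\<bar>J z * err k ?G z (z 0)\<bar> \<le> 1" if "z \<in> space ?P" for z
      using J01[of z] err_abs_le_1[OF label[OF coordinate[OF that G(3)]], of k ?G z] by (auto simp: abs_mult)
  qed
  also have "\<dots> = (\<integral>z. J z * lerr k ?G z \<partial>?P)"
  proof (rule Bochner_Integration.integral_cong[OF refl])
    fix z :: "nat \<Rightarrow> (real ^ 'd) \<times> nat"
    have "J (z(0 := v)) = J z" "err k ?G (z(0 := v)) ((z(0 := v)) 0) = err k ?G z v" for v
      unfolding J_def by (auto intro!: err_cong arg_cong[where f = "indicator B"])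
    then show "(\<integral>v. J (z(0 := v)) * err k ?G (z(0 := v)) ((z(0 := v)) 0) \<partial>\<nu>) = J z * lerr k ?G z"
      by (simp add: lerr_def)
  qed
  finally show ?thesis unfolding X_def J_def .
qed

end

section \<open>The main theorem\<close>

lemma sqrt_two_pi_le: "sqrt (2 * pi) \<le> 2.83"
  by (rule real_le_lsqrt) (use pi_less_4 in \<open>auto simp: power2_eq_square\<close>)

text \<open>The last claim amounts to \<open>5 * p - 5 \<le> n\<close>. The hypotheses give
  \<open>p + p * p \<le> n\<close>, and \<open>p * p - 4 * p + 5 = (p - 2)\<^sup>2 + 1\<close> is
  positive.\<close>

lemma sample_size_bounds:
  assumes p: "p \<ge> 1" and k: "k \<ge> 1" and pk: "real p \<le> sqrt (real k)" and kn: "sqrt (real k) + real k \<le> real n"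
  shows "k + p \<le> n" "real (Suc (n - p)) = real n - real p + 1" "1 / real (Suc (n - p)) \<le> 1.25 / real n"
proof -
  define s where "s = sqrt (real k)"
  have ks: "real k = s * s" by (simp add: s_def)
  have "real p + real k \<le> real n" using pk kn by simp
  then show kpn: "k + p \<le> n" by linarith
  then show eq: "real (Suc (n - p)) = real n - real p + 1" by (simp add: of_nat_diff)
  have "real p * real p \<le> s * s" using pk unfolding s_def[symmetric] by (intro mult_mono) auto
  then have "real p + real p * real p \<le> real n" using kn pk unfolding ks s_def[symmetric] by linarith
  moreover have "5 * real p - 5 \<le> real p + real p * real p"
    using zero_le_power2[of "real p - 2"] by (simp add: power2_eq_square algebra_simps)
  ultimately have "5 * real p - 5 \<le> real n" by (rule order_trans[rotated])
  then have "4 * real n \<le> 5 * real (Suc (n - p))" unfolding eq by simp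
  then show "1 / real (Suc (n - p)) \<le> 1.25 / real n"
    using kpn k by (simp add: field_simps)
qed

text \<open>Independence within each family gives two product laws; independence of the generated
  algebras multiplies them on rectangles. All expectations can then be computed on a canonical
  space.\<close>

lemma joint_distr:
  fixes n :: nat
  assumes "prob_space M"
    and Z: "prob_space.indep_vars M (\<lambda>_. N) Z {0..n}"
    and Zd: "\<And>i. i \<in> {0..n} \<Longrightarrow> distr M N (Z i) = distr M N (Z 0)"
    and c: "prob_space.indep_vars M (\<lambda>_. count_space UNIV) c T" and T: "T \<noteq> {}"
    and cd: "\<And>t. t \<in> T \<Longrightarrow> distr M (count_space UNIV) (c t) = coin"
    and ind: "prob_space.indep_set M (sets (generated_algebra M N Z {0..n})) (sets (generated_algebra M (count_space UNIV) c T))"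
  shows "(\<lambda>\<omega>. (\<lambda>i\<in>{0..n}. Z i \<omega>, \<lambda>t\<in>T. c t \<omega>)) \<in> measurable M (PiM {0..n} (\<lambda>_. N) \<Otimes>\<^sub>M PiM T (\<lambda>_. count_space UNIV))"
    and "distr M (PiM {0..n} (\<lambda>_. N) \<Otimes>\<^sub>M PiM T (\<lambda>_. count_space UNIV)) (\<lambda>\<omega>. (\<lambda>i\<in>{0..n}. Z i \<omega>, \<lambda>t\<in>T. c t \<omega>))
      = PiM {0..n} (\<lambda>_. distr M N (Z 0)) \<Otimes>\<^sub>M PiM T (\<lambda>_. coin)"
proof -
  interpret M: prob_space M by fact
  let ?Zv = "\<lambda>\<omega>. \<lambda>i\<in>{0..n}. Z i \<omega>" and ?cv = "\<lambda>\<omega>. \<lambda>t\<in>T. c t \<omega>"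
  let ?PZ = "PiM {0..n} (\<lambda>_. N)" and ?Pc = "PiM T (\<lambda>_. count_space UNIV :: bool measure)"
  have Zm: "Z i \<in> measurable M N" if "i \<in> {0..n}" for i
    using Z that unfolding M.indep_vars_def by blast
  have cm: "c t \<in> measurable M (count_space UNIV)" if "t \<in> T" for t
    using c that unfolding M.indep_vars_def by blast
  have m: "?Zv \<in> measurable M ?PZ" "?cv \<in> measurable M ?Pc"
    using Zm cm by (auto intro!: measurable_restrict)
  then show "(\<lambda>\<omega>. (?Zv \<omega>, ?cv \<omega>)) \<in> measurable M (?PZ \<Otimes>\<^sub>M ?Pc)" by (rule measurable_Pair)
  have "distr M ?PZ ?Zv = PiM {0..n} (\<lambda>i. distr M N (Z i))"
    by (rule M.indep_vars_iff_distr_eq_PiM'[THEN iffD1, OF _ Zm Z]) simp_all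
  also have "\<dots> = PiM {0..n} (\<lambda>_. distr M N (Z 0))"
    by (rule PiM_cong[OF refl Zd])
  finally have dZ: "distr M ?PZ ?Zv = PiM {0..n} (\<lambda>_. distr M N (Z 0))" .
  have "distr M ?Pc ?cv = PiM T (\<lambda>t. distr M (count_space UNIV) (c t))"
    by (rule M.indep_vars_iff_distr_eq_PiM'[THEN iffD1, OF T cm c])
  also have "\<dots> = PiM T (\<lambda>_. coin)"
    by (rule PiM_cong[OF refl cd])
  finally have dc: "distr M ?Pc ?cv = PiM T (\<lambda>_. coin)" .
  have "distr M ?PZ ?Zv \<Otimes>\<^sub>M distr M ?Pc ?cv = distr M (?PZ \<Otimes>\<^sub>M ?Pc) (\<lambda>\<omega>. (?Zv \<omega>, ?cv \<omega>))"
  proof (rule pair_measure_eqI)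
    show "sigma_finite_measure (distr M ?PZ ?Zv)" "sigma_finite_measure (distr M ?Pc ?cv)"
      by (rule prob_space_imp_sigma_finite[OF M.prob_space_distr[OF m(1)]],
          rule prob_space_imp_sigma_finite[OF M.prob_space_distr[OF m(2)]])
    show "sets (distr M ?PZ ?Zv \<Otimes>\<^sub>M distr M ?Pc ?cv) = sets (distr M (?PZ \<Otimes>\<^sub>M ?Pc) (\<lambda>\<omega>. (?Zv \<omega>, ?cv \<omega>)))"
      by (simp cong: sets_pair_measure_cong)
    fix A B assume A: "A \<in> sets (distr M ?PZ ?Zv)" and B: "B \<in> sets (distr M ?Pc ?cv)"
    let ?A = "?Zv -` A \<inter> space M" and ?B = "?cv -` B \<inter> space M"
    have "?A \<in> sets (generated_algebra M N Z {0..n})" "?B \<in> sets (generated_algebra M (count_space UNIV) c T)"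
      unfolding generated_algebra_def using A B in_vimage_algebra by simp_all
    from M.indep_setD[OF ind this] have "M.prob (?A \<inter> ?B) = M.prob ?A * M.prob ?B" .
    moreover have "(\<lambda>\<omega>. (?Zv \<omega>, ?cv \<omega>)) -` (A \<times> B) \<inter> space M = ?A \<inter> ?B" by auto
    ultimately show "emeasure (distr M ?PZ ?Zv) A * emeasure (distr M ?Pc ?cv) B = emeasure (distr M (?PZ \<Otimes>\<^sub>M ?Pc) (\<lambda>\<omega>. (?Zv \<omega>, ?cv \<omega>))) (A \<times> B)"
      using A B m measurable_Pair[OF m]
      by (simp add: emeasure_distr M.emeasure_eq_measure ennreal_mult)
  qed
  then show "distr M (?PZ \<Otimes>\<^sub>M ?Pc) (\<lambda>\<omega>. (?Zv \<omega>, ?cv \<omega>)) = PiM {0..n} (\<lambda>_. distr M N (Z 0)) \<Otimes>\<^sub>M PiM T (\<lambda>_. coin)"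
    unfolding dZ dc by simp
qed

lemma obs_space_coordinates:
  "fst \<in> borel_measurable (obs_space S)"
  "snd \<in> measurable (obs_space S) (count_space UNIV)"
  "x \<in> space (obs_space S) \<Longrightarrow> snd x \<in> {0, 1}"
proof -
  have "(\<lambda>x. x) \<in> measurable (restrict_space borel S) borel"
    by (rule measurable_restrict_space1) simp
  from measurable_compose[OF measurable_fst this] show "fst \<in> borel_measurable (obs_space S)"
    unfolding obs_space_def by simp
  have "(\<lambda>x. x) \<in> measurable (count_space {0, 1::nat}) (count_space UNIV)" by simp
  from measurable_compose[OF measurable_snd this] show "snd \<in> measurable (obs_space S) (count_space UNIV)"
    unfolding obs_space_def by simp
  show "x \<in> space (obs_space S) \<Longrightarrow> snd x \<in> {0, 1}"
    by (auto simp: obs_space_def space_pair_measure)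
qed

theorem theorem5p1:
  fixes M :: "'w measure"
    and S :: "(real ^ 'd) set"
    and Z :: "nat \<Rightarrow> 'w \<Rightarrow> (real ^ 'd) \<times> nat"
    and c :: "nat set \<times> nat \<Rightarrow> 'w \<Rightarrow> bool"
    and n p k :: nat
    and \<gamma> \<kappa> :: real
  assumes "prob_space M"
    and "prob_space.indep_vars M (\<lambda>_. obs_space S) Z {0..n}"
    and "\<And>i. i \<in> {0..n} \<Longrightarrow> distr M (obs_space S) (Z i) = distr M (obs_space S) (Z 0)"
    and "prob_space.indep_vars M (\<lambda>_. count_space UNIV) c (tie_index n)"
    and "\<And>t. t \<in> tie_index n \<Longrightarrow>
           distr M (count_space UNIV) (c t) = measure_pmf (bernoulli_pmf (1/2))"
    and "prob_space.indep_set M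
           (sets (generated_algebra M (obs_space S) Z {0..n}))
           (sets (generated_algebra M (count_space UNIV) c (tie_index n)))"
    and "stone_constant (distr M borel (\<lambda>\<omega>. fst (Z 0 \<omega>))) \<gamma>"
    and "moment_constant TYPE((real ^ 'd) \<times> nat) \<kappa>"
    and "p \<ge> 1" and "k \<ge> 1"
    and "real p \<le> sqrt (real k)" and "sqrt (real k) + real k \<le> real n"
  defines "R_hat \<equiv> \<lambda>\<omega>. lpo_risk k p n (\<lambda>i. Z i \<omega>) (\<lambda>t. c t \<omega>)"
    and "L \<equiv> class_error M S Z n (knn_classifier k n Z c)"
    and "R \<equiv> class_risk M S Z n (knn_classifier k n Z c)"
  shows "\<bar>integral\<^sup>L M R_hat - R\<bar> \<le> 4 / sqrt (2 * pi) * (real p * sqrt (real k) / real n)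
    \<and> (\<integral>\<omega>. (R_hat \<omega> - R)\<^sup>2 \<partial>M) \<le>
        128 * \<kappa> * \<gamma> / sqrt (2 * pi) * (real k powr (3/2) / (real n - real p + 1))
        + 16 / (2 * pi) * ((real p)\<^sup>2 * real k / (real n)\<^sup>2)
    \<and> (\<integral>\<omega>. (R_hat \<omega> - L \<omega>)\<^sup>2 \<partial>M) \<le>
        2 * sqrt 2 / sqrt pi * ((2 * real p + 3) * sqrt (real k) / real n) + 1 / real n"
proof -
  let ?N = "obs_space S" and ?T = "tie_index n" and ?G = "{1..n}" and ?I = "{0..n}"
  \<comment> \<open>Taken on \<open>obs_space S\<close>, the law has only labels 0 and 1 in its
    space.\<close>
  define \<nu> where "\<nu> = distr M ?N (Z 0)"
  interpret M: prob_space M by fact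
  note indZ = assms(2) and k = \<open>k \<ge> 1\<close> and p = \<open>p \<ge> 1\<close>
  note size = sample_size_bounds[OF assms(9-12)]
  have pn: "p \<le> n" and km: "k \<le> n - p" and mG: "n - p < card ?G" and n1: "n \<ge> 1" using size(1) p k by auto
  have Zm: "Z i \<in> measurable M ?N" if "i \<in> ?I" for i
    using indZ that unfolding M.indep_vars_def by blast
  have s\<nu>: "sets \<nu> = sets ?N" "space \<nu> = space ?N" by (simp_all add: \<nu>_def)
  interpret nu: prob_space \<nu>
    unfolding \<nu>_def by (rule M.prob_space_distr[OF Zm]) simp
  interpret labelled_law \<nu>
  proof
    show "fst \<in> borel_measurable \<nu>" "snd \<in> measurable \<nu> (count_space UNIV)"
      using obs_space_coordinates(1,2)[of S] by (simp_all add: measurable_cong_sets[OF s\<nu>(1) refl])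
    show "x \<in> space \<nu> \<Longrightarrow> snd x \<in> {0, 1}" for x
      using obs_space_coordinates(3)[of x S] by (simp add: s\<nu>)
  qed
  have stone: "stone_constant (distr \<nu> borel fst) \<gamma>"
    using assms(7) unfolding \<nu>_def by (subst distr_distr[OF obs_space_coordinates(1) Zm]) (simp_all add: comp_def)
  \<comment> \<open>Restriction turns the families into points of the product spaces; the estimator
    and the classifier see only these coordinates.\<close>
  define Zv where "Zv \<omega> = (\<lambda>i\<in>?I. Z i \<omega>)" for \<omega>
  define cv where "cv \<omega> = (\<lambda>t\<in>?T. c t \<omega>)" for \<omega>
  let ?Q = "law ?I \<Otimes>\<^sub>M ties n"
  have t0: "(?G, 0) \<in> ?T" by (simp add: tie_index_def)
  then have Tne: "?T \<noteq> {}" by blast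
  note joint = joint_distr[OF assms(1-4) Tne assms(5,6)]
  have sQ: "sets (PiM ?I (\<lambda>_. ?N) \<Otimes>\<^sub>M PiM ?T (\<lambda>_. count_space UNIV)) = sets ?Q"
    by (intro sets_pair_measure_cong sets_PiM_cong) (simp_all add: s\<nu>)
  have ZCm: "(\<lambda>\<omega>. (Zv \<omega>, cv \<omega>)) \<in> measurable M ?Q"
    using joint(1) unfolding Zv_def cv_def by (simp add: measurable_cong_sets[OF refl sQ])
  have ZC: "distr M ?Q (\<lambda>\<omega>. (Zv \<omega>, cv \<omega>)) = ?Q"
    using joint(2) unfolding Zv_def cv_def \<nu>_def[symmetric] by (simp add: distr_cong[OF refl sQ])
  have transfer: "(\<integral>\<omega>. F (Zv \<omega>) (cv \<omega>) \<partial>M) = (\<integral>w. F (fst w) (snd w) \<partial>?Q)"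
    if "(\<lambda>w. F (fst w) (snd w)) \<in> borel_measurable ?Q" for F :: "_ \<Rightarrow> _ \<Rightarrow> real"
    using integral_distr[OF ZCm that] ZC by simp
  interpret C: prob_space "ties n" by (rule ties_prob_space)
  have Zvm: "Zv \<in> measurable M (law ?I)"
    using measurable_compose[OF ZCm measurable_fst] by simp
  have transferZ: "(\<integral>\<omega>. F (Zv \<omega>) \<partial>M) = (\<integral>z. F z \<partial>law ?I)" if "F \<in> borel_measurable (law ?I)" for F :: "_ \<Rightarrow> real"
  proof -
    have "distr M (law ?I) Zv = law ?I"
    proof -
      have "distr M (law ?I) Zv = distr (distr M ?Q (\<lambda>\<omega>. (Zv \<omega>, cv \<omega>))) (law ?I) fst"
        by (subst distr_distr[OF measurable_fst ZCm]) (simp add: comp_def)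
      then show ?thesis unfolding ZC C.distr_pair_fst .
    qed
    then show ?thesis using integral_distr[OF Zvm that] by simp
  qed
  have Rh: "R_hat \<omega> = lpo_risk k p n (Zv \<omega>) (cv \<omega>)" for \<omega>
    unfolding R_hat_def
    by (rule lpo_risk_cong[OF k pn]) (use test_pairs_subset[of n p] in \<open>auto simp: Zv_def cv_def\<close>)
  let ?ho = "held_out k (n - p) ?G" and ?le = "lerr k ?G"
  have G: "finite ?G" "?G \<subseteq> ?I" "0 \<in> ?I" "0 \<notin> ?G" by auto
  note lem = measurable_lerr[OF G(1,2), of k] and leb = lerr_bounds[OF G(1,2), of _ k]
  \<comment> \<open>\<open>lerr\<close> of the data is measurable for the algebra of the data and
    has the integrals of the error indicator over its events, so it is a version of
    \<open>L\<close>.\<close>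
  have L: "AE \<omega> in M. L \<omega> = ?le (Zv \<omega>)" and R: "R = (\<integral>z. ?le z \<partial>law ?I)"
  proof -
    let ?F = "generated_algebra M ?N Z ?G"
    let ?Zr = "\<lambda>\<omega>. \<lambda>i\<in>?G. Z i \<omega>"
    define f where "f \<omega> = (of_bool (knn_classifier k n Z c \<omega> (fst (Z 0 \<omega>)) \<noteq> snd (Z 0 \<omega>)) :: real)" for \<omega>
    have Zrm: "?Zr \<in> measurable M (PiM ?G (\<lambda>_. ?N))"
      using Zm by (intro measurable_restrict) auto
    have sF: "sets ?F = {?Zr -` B \<inter> space M | B. B \<in> sets (PiM ?G (\<lambda>_. ?N))}"
      unfolding generated_algebra_def using measurable_space[OF Zrm] by (intro sets_vimage_algebra2) auto
    have sub: "subalgebra M ?F"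
      unfolding subalgebra_def sF using measurable_sets[OF Zrm] by (auto simp: generated_algebra_def)
    interpret F: finite_measure_subalgebra M ?F by (unfold_locales, rule sub)
    have feq: "f \<omega> = of_bool (knn k ?G (Zv \<omega>) (cv \<omega> (?G, 0)) (fst (Zv \<omega> 0)) \<noteq> snd (Zv \<omega> 0))" for \<omega>
    proof -
      have "knn k ?G (\<lambda>i. Z i \<omega>) b x = knn k ?G (Zv \<omega>) b x" for b x
        by (rule knn_cong[OF k]) (auto simp: Zv_def)
      moreover have "cv \<omega> (?G, 0) = c (?G, 0) \<omega>" "Zv \<omega> 0 = Z 0 \<omega>" using t0 by (auto simp: cv_def Zv_def)
      ultimately show ?thesis unfolding f_def knn_classifier_def by simp
    qed
    have fm: "f \<in> borel_measurable M"
      unfolding feq[abs_def]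
      using measurable_compose[OF ZCm measurable_knn_error_pair[OF G(1-3) k t0]] by simp
    have gr: "?le (Zv \<omega>) = ?le (?Zr \<omega>)" for \<omega>
      by (rule lerr_cong) (auto simp: Zv_def)
    have ZrF: "?Zr \<in> measurable ?F (law ?G)"
    proof -
      have "?Zr \<in> measurable ?F (PiM ?G (\<lambda>_. ?N))"
        unfolding generated_algebra_def using measurable_space[OF Zrm] by (intro measurable_vimage_algebra1) auto
      moreover have "sets (PiM ?G (\<lambda>_. ?N)) = sets (law ?G)" by (intro sets_PiM_cong) (simp_all add: s\<nu>)
      from measurable_cong_sets[OF refl this] have "measurable ?F (PiM ?G (\<lambda>_. ?N)) = measurable ?F (law ?G)" .
      ultimately show ?thesis by simp
    qed
    have gF: "(\<lambda>\<omega>. ?le (Zv \<omega>)) \<in> borel_measurable ?F"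
      unfolding gr by (rule measurable_compose[OF ZrF measurable_lerr]) auto
    have gi: "integrable M (\<lambda>\<omega>. ?le (Zv \<omega>))"
    proof (rule M.integrable_bounded[of _ 1])
      show "(\<lambda>\<omega>. ?le (Zv \<omega>)) \<in> borel_measurable M" by (rule measurable_compose[OF Zvm lem])
      show "\<bar>?le (Zv \<omega>)\<bar> \<le> 1" if "\<omega> \<in> space M" for \<omega>
        using leb[OF measurable_space[OF Zvm that]] by simp
    qed
    have fi: "integrable M f" by (rule M.integrable_bounded[OF fm, of 1]) (simp add: f_def)
    have "AE \<omega> in M. real_cond_exp M ?F f \<omega> = ?le (Zv \<omega>)"
    proof (rule F.real_cond_exp_charact[OF _ fi gi gF])
      fix A assume "A \<in> sets ?F"
      then obtain B where B: "B \<in> sets (PiM ?G (\<lambda>_. ?N))" "A = ?Zr -` B \<inter> space M" unfolding sF by blast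
      have sG: "sets (PiM ?G (\<lambda>_. ?N)) = sets (law ?G)" by (intro sets_PiM_cong) (simp_all add: s\<nu>)
      then have B': "B \<in> sets (law ?G)" using B by simp
      have iA: "indicator A \<omega> = (indicator B (restrict (Zv \<omega>) ?G) :: real)" if "\<omega> \<in> space M" for \<omega>
      proof -
        have "restrict (Zv \<omega>) ?G = ?Zr \<omega>" by (auto simp: Zv_def restrict_def)
        then show ?thesis using that B(2) by (simp add: indicator_def)
      qed
      have Jm: "(\<lambda>z. indicator B (restrict z ?G) :: real) \<in> borel_measurable (law ?I)"
        by (rule measurable_compose[OF measurable_restrict_subset[OF G(2)] borel_measurable_indicator[OF B']])
      have "(\<integral>\<omega>\<in>A. f \<omega> \<partial>M) = (\<integral>\<omega>. indicator B (restrict (Zv \<omega>) ?G) * of_bool (knn k ?G (Zv \<omega>) (cv \<omega> (?G, 0)) (fst (Zv \<omega> 0)) \<noteq> snd (Zv \<omega> 0)) \<partial>M)"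
        unfolding set_lebesgue_integral_def by (intro Bochner_Integration.integral_cong refl) (simp add: iA feq)
      also have "\<dots> = (\<integral>w. indicator B (restrict (fst w) ?G) * of_bool (knn k ?G (fst w) (snd w (?G, 0)) (fst (fst w 0)) \<noteq> snd (fst w 0)) \<partial>?Q)"
        by (rule transfer) (intro borel_measurable_times measurable_compose[OF measurable_fst Jm] measurable_knn_error_pair[OF G(1-3) k t0])
      also have "\<dots> = (\<integral>z. indicator B (restrict z ?G) * ?le z \<partial>law ?I)"
        by (rule new_point_error[OF k n1 B'])
      also have "\<dots> = (\<integral>\<omega>. indicator B (restrict (Zv \<omega>) ?G) * ?le (Zv \<omega>) \<partial>M)"
        by (rule transferZ[symmetric]) (intro borel_measurable_times Jm lem)
      also have "\<dots> = (\<integral>\<omega>\<in>A. ?le (Zv \<omega>) \<partial>M)"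
        unfolding set_lebesgue_integral_def by (intro Bochner_Integration.integral_cong refl) (simp add: iA)
      finally show "(\<integral>\<omega>\<in>A. f \<omega> \<partial>M) = (\<integral>\<omega>\<in>A. ?le (Zv \<omega>) \<partial>M)" .
    qed
    then show L': "AE \<omega> in M. L \<omega> = ?le (Zv \<omega>)" unfolding L_def class_error_def f_def .
    have "R = (\<integral>\<omega>. L \<omega> \<partial>M)" unfolding R_def L_def class_risk_def ..
    also have "\<dots> = (\<integral>\<omega>. ?le (Zv \<omega>) \<partial>M)"
      using L' gi by (intro integral_cong_AE) (auto simp: L_def class_error_def)
    also have "\<dots> = (\<integral>z. ?le z \<partial>law ?I)" by (rule transferZ[OF lem])
    finally show "R = (\<integral>z. ?le z \<partial>law ?I)" .
  qed
  note lpo_m = measurable_lpo_risk[OF k pn G(2)]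
  have R01: "0 \<le> R" "R \<le> 1"
  proof -
    show "0 \<le> R" unfolding R using leb by (intro integral_nonneg_AE AE_I2) auto
    have "R \<le> (\<integral>z. 1 \<partial>law ?I)" unfolding R
      using leb by (intro integral_mono integrable_lerr G law.integrable_const) auto
    also have "\<dots> = 1" using law.prob_space by simp
    finally show "R \<le> 1" .
  qed
  define sk where "sk = sqrt (real k)"
  define q where "q = sqrt (2 * pi)"
  define x where "x = 1 / real (Suc (n - p))"
  have q: "0 < q" "q \<le> 2.83" unfolding q_def using sqrt_two_pi_le by auto
  have sk: "1 \<le> sk" unfolding sk_def using k by simp
  have n0: "0 < real n" using n1 by simp
  have x: "0 < x" "x \<le> 1.25 / real n" unfolding x_def using size(3) by auto
  \<comment> \<open>The bias takes only 1.25 of this; the third bound takes all of 1.41.\<close>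
  have q4: "1.41 \<le> 4 / q" using q by (simp add: field_simps)
  have ER: "integral\<^sup>L M R_hat = (\<integral>z. ?ho z \<partial>law ?I)"
  proof -
    have "integral\<^sup>L M R_hat = (\<integral>w. lpo_risk k p n (fst w) (snd w) \<partial>?Q)"
      unfolding Rh[abs_def] by (rule transfer[OF lpo_m])
    also have "\<dots> = (\<integral>z. ?ho z \<partial>law ?I)"
      using R01 by (intro lpo_risk_joint(1)[OF k p pn G(2), of "\<lambda>_. R"]) auto
    finally show ?thesis .
  qed
  have "\<bar>(\<integral>z. ?ho z \<partial>law ?I) - R\<bar> \<le> real (card ?G - (n - p)) * sqrt (real k) / real (Suc (n - p))"
    unfolding R by (rule held_out_bias[OF G k km mG])
  also have "\<dots> = real p * sk * x" using pn by (simp add: sk_def x_def)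
  also have "\<dots> \<le> real p * sk * (1.25 / real n)" using x sk by (intro mult_left_mono) auto
  also have "\<dots> = 1.25 * (real p * sk / real n)" by simp
  also have "\<dots> \<le> 4 / q * (real p * sk / real n)" using q4 sk n0 by (intro mult_right_mono) auto
  finally have bias: "\<bar>(\<integral>z. ?ho z \<partial>law ?I) - R\<bar> \<le> 4 / q * (real p * sk / real n)" .
  have part1: "\<bar>integral\<^sup>L M R_hat - R\<bar> \<le> 4 / sqrt (2 * pi) * (real p * sqrt (real k) / real n)"
    using bias unfolding ER q_def sk_def .
  have part2: "(\<integral>\<omega>. (R_hat \<omega> - R)\<^sup>2 \<partial>M) \<le>
        128 * \<kappa> * \<gamma> / sqrt (2 * pi) * (real k powr (3/2) / (real n - real p + 1))
        + 16 / (2 * pi) * ((real p)\<^sup>2 * real k / (real n)\<^sup>2)"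
  proof -
    define E where "E = (\<integral>z. ?ho z \<partial>law ?I)"
    define V where "V = (\<integral>z. (?ho z - E)\<^sup>2 \<partial>law ?I)"
    define y where "y = real k * sk"
    have hi: "integrable (law ?I) ?ho" by (rule integrable_held_out[OF G(1,2) mG])
    have hb: "0 \<le> ?ho z" "?ho z \<le> 1" if "z \<in> space (law ?I)" for z
      using held_out_bounds[OF G(1,2) mG that] by auto
    have hE: "integrable (law ?I) (\<lambda>z. (?ho z - E)\<^sup>2)"
    proof (rule law.integrable_bounded[of _ _ "(1 + \<bar>E\<bar>)\<^sup>2"])
      show "(\<lambda>z. (?ho z - E)\<^sup>2) \<in> borel_measurable (law ?I)" using borel_measurable_integrable[OF hi] by simp
      show "\<bar>(?ho z - E)\<^sup>2\<bar> \<le> (1 + \<bar>E\<bar>)\<^sup>2" if "z \<in> space (law ?I)" for z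
        using hb[OF that] by (auto simp: abs_le_square_iff[symmetric])
    qed
    \<comment> \<open>The cross term is \<open>2 * (E - R) * (?ho z - E)\<close>, written with its
      constant part apart; its integral is 0.\<close>
    have "(\<integral>z. (?ho z - R)\<^sup>2 \<partial>law ?I) = (\<integral>z. ((?ho z - E)\<^sup>2 + 2 * (E - R) * ?ho z) + ((E - R)\<^sup>2 - 2 * (E - R) * E) \<partial>law ?I)"
      by (intro Bochner_Integration.integral_cong refl) (simp add: power2_eq_square algebra_simps)
    also have "\<dots> = (V + 2 * (E - R) * E) + ((E - R)\<^sup>2 - 2 * (E - R) * E)"
    proof -
      have i: "integrable (law ?I) (\<lambda>z. 2 * (E - R) * ?ho z)" using hi by (rule integrable_mult_right)
      have c: "(\<integral>z. (E - R)\<^sup>2 - 2 * (E - R) * E \<partial>law ?I) = (E - R)\<^sup>2 - 2 * (E - R) * E" using law.prob_space by simp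
      have l: "(\<integral>z. 2 * (E - R) * ?ho z \<partial>law ?I) = 2 * (E - R) * E" by (simp add: E_def)
      show ?thesis
        unfolding Bochner_Integration.integral_add[OF Bochner_Integration.integrable_add[OF hE i] law.integrable_const]
          Bochner_Integration.integral_add[OF hE i] c l V_def ..
    qed
    also have "\<dots> = V + (E - R)\<^sup>2" by simp
    finally have dec: "(\<integral>z. (?ho z - R)\<^sup>2 \<partial>law ?I) = V + (E - R)\<^sup>2" .
    have "(\<integral>\<omega>. (R_hat \<omega> - R)\<^sup>2 \<partial>M) = (\<integral>w. (lpo_risk k p n (fst w) (snd w) - R)\<^sup>2 \<partial>?Q)"
      unfolding Rh[abs_def] using lpo_m by (intro transfer) simp
    also have "\<dots> \<le> (\<integral>z. (?ho z - R)\<^sup>2 \<partial>law ?I) + 1 / (4 * real n)"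
      using R01 by (intro lpo_risk_joint(2)[OF k p pn G(2), of "\<lambda>_. R"]) auto
    finally have tie_noise: "(\<integral>\<omega>. (R_hat \<omega> - R)\<^sup>2 \<partial>M) \<le> V + (E - R)\<^sup>2 + 1 / (4 * real n)" unfolding dec .
    have variance: "V \<le> 4 * \<kappa> * ((2 + 8 * \<gamma> * y) * x)"
      using held_out_variance[OF stone assms(8) G(1,2) k km mG] unfolding V_def E_def y_def sk_def x_def by simp
    have bias_sq: "(E - R)\<^sup>2 \<le> 16 / (2 * pi) * ((real p)\<^sup>2 * real k / (real n)\<^sup>2)"
    proof -
      have "(E - R)\<^sup>2 \<le> (4 / q * (real p * sk / real n))\<^sup>2"
        using power_mono[OF bias, of 2] unfolding E_def by simp
      also have "\<dots> = 16 / (2 * pi) * ((real p)\<^sup>2 * real k / (real n)\<^sup>2)"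
        by (simp add: power_mult_distrib power_divide q_def sk_def)
      finally show ?thesis .
    qed
    \<comment> \<open>As \<open>\<gamma> * y \<ge> 1\<close>, the terms 2 and
      \<open>8 * \<gamma> * y\<close> merge into \<open>10 * \<gamma> * y\<close>, which gives 40
      after the factor 4; the coin variance adds 4 because \<open>\<kappa> \<ge> 1 / 16\<close>. The
      total 44 is below \<open>128 / q\<close> as \<open>q \<le> 2.83\<close>.\<close>
    have constants: "4 * \<kappa> * ((2 + 8 * \<gamma> * y) * x) + 1 / (4 * real n) \<le> 128 * \<kappa> * \<gamma> / q * (y * x)"
    proof -
      have ka: "1 / 16 \<le> \<kappa>" by (rule moment_constant_ge[OF assms(8)])
      have ga: "1 \<le> \<gamma>" by (rule stone_constant_ge_1[OF stone])
      have y1: "1 \<le> y" unfolding y_def using sk k mult_mono[of 1 "real k" 1 sk] by simp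
      have gy: "1 \<le> \<gamma> * y" using mult_mono[OF ga y1] ga by simp
      have a: "(2 + 8 * \<gamma> * y) * x \<le> (10 * (\<gamma> * y)) * x"
        using gy x by (intro mult_right_mono) auto
      have "1 / real n \<le> x" unfolding x_def using p n0 pn by (intro divide_left_mono) auto
      then have "1 / (4 * real n) \<le> x / 4" by simp
      also have "\<dots> \<le> 4 * \<kappa> * x" using ka x mult_right_mono[of "1 / 4" "4 * \<kappa>" x] by simp
      also have "\<dots> \<le> 4 * \<kappa> * x * (\<gamma> * y)" using gy ka x mult_left_mono[of 1 "\<gamma> * y" "4 * \<kappa> * x"] by simp
      finally have b: "1 / (4 * real n) \<le> 4 * \<kappa> * x * (\<gamma> * y)" .
      have w: "0 \<le> \<kappa> * (\<gamma> * y) * x" using ka gy x by simp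
      have "4 * \<kappa> * ((2 + 8 * \<gamma> * y) * x) + 1 / (4 * real n) \<le> 4 * \<kappa> * ((10 * (\<gamma> * y)) * x) + 4 * \<kappa> * x * (\<gamma> * y)"
        using a b ka by (intro add_mono mult_left_mono) auto
      also have "\<dots> = 44 * (\<kappa> * (\<gamma> * y) * x)" by simp
      also have "\<dots> \<le> 128 / q * (\<kappa> * (\<gamma> * y) * x)"
        using w q by (intro mult_right_mono) (simp_all add: field_simps)
      also have "\<dots> = 128 * \<kappa> * \<gamma> / q * (y * x)" by simp
      finally show ?thesis .
    qed
    have yx: "y * x = real k powr (3/2) / (real n - real p + 1)"
    proof -
      have "real k powr (3/2) = real k powr (1 + 1/2)" by simp
      also have "\<dots> = real k * sk" unfolding powr_add sk_def using k by (simp add: powr_half_sqrt)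
      finally show ?thesis unfolding y_def x_def size(2) by simp
    qed
    have add4: "I \<le> C + B" if "I \<le> V' + S + N" "V' \<le> A" "S \<le> B" "A + N \<le> C" for I V' S N A B C :: real
      using that by linarith
    show ?thesis
      using add4[OF tie_noise variance bias_sq constants] unfolding yx q_def .
  qed
  have part3: "(\<integral>\<omega>. (R_hat \<omega> - L \<omega>)\<^sup>2 \<partial>M) \<le>
        2 * sqrt 2 / sqrt pi * ((2 * real p + 3) * sqrt (real k) / real n) + 1 / real n"
  proof -
    have q': "2 * sqrt 2 / sqrt pi = 4 / q"
      unfolding q_def real_sqrt_mult by (simp add: field_simps)
    have Lm: "L \<in> borel_measurable M" unfolding L_def class_error_def by simp
    have Rm: "R_hat \<in> borel_measurable M"
      unfolding Rh[abs_def] using measurable_compose[OF ZCm lpo_m] by simp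
    have lZm: "(\<lambda>\<omega>. ?le (Zv \<omega>)) \<in> borel_measurable M" by (rule measurable_compose[OF Zvm lem])
    have "(\<integral>\<omega>. (R_hat \<omega> - L \<omega>)\<^sup>2 \<partial>M) = (\<integral>\<omega>. (R_hat \<omega> - ?le (Zv \<omega>))\<^sup>2 \<partial>M)"
    proof (rule integral_cong_AE)
      show "AE \<omega> in M. (R_hat \<omega> - L \<omega>)\<^sup>2 = (R_hat \<omega> - ?le (Zv \<omega>))\<^sup>2"
        using L by eventually_elim simp
    qed (use Lm Rm lZm in auto)
    also have "\<dots> = (\<integral>w. (lpo_risk k p n (fst w) (snd w) - ?le (fst w))\<^sup>2 \<partial>?Q)"
      unfolding Rh[abs_def] using lpo_m measurable_compose[OF measurable_fst lem, of "ties n"]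
      by (intro transfer) simp
    also have "\<dots> \<le> (\<integral>z. (?ho z - ?le z)\<^sup>2 \<partial>law ?I) + 1 / (4 * real n)"
      using leb by (intro lpo_risk_joint(2)[OF k p pn G(2) lem]) auto
    also have "(\<integral>z. (?ho z - ?le z)\<^sup>2 \<partial>law ?I) \<le> 2 * ((real p - 1) * sk * x) + (1 + 6 * sk) / real n"
    proof -
      have "real (card ?G - 1 - (n - p)) = real p - 1" using p pn by (simp add: of_nat_diff)
      then show ?thesis
        using held_out_lerr_mse[OF G k km mG] unfolding sk_def x_def by simp
    qed
    also have "(real p - 1) * sk * x \<le> (real p - 1) * sk * (1.25 / real n)"
      using x sk p by (intro mult_left_mono) auto
    finally have "(\<integral>\<omega>. (R_hat \<omega> - L \<omega>)\<^sup>2 \<partial>M) \<le> 2 * ((real p - 1) * sk * (1.25 / real n)) + (1 + 6 * sk) / real n + 1 / (4 * real n)"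
      by linarith
    also have "\<dots> = (2.5 * (real p - 1) * sk + 6 * sk + 1/4) / real n + 1 / real n"
      using n0 by (simp add: field_simps)
    \<comment> \<open>With \<open>u = (p - 1) * sk\<close> this reads
      \<open>2.5 * u + 6 * sk + 1 / 4 \<le> 2.82 * u + 7.05 * sk\<close>; the 1/4 stems from the
      coins and is absorbed because \<open>sk \<ge> 1\<close>.\<close>
    also have "\<dots> \<le> (1.41 * ((2 * real p + 3) * sk)) / real n + 1 / real n"
    proof (intro add_right_mono divide_right_mono)
      define u where "u = (real p - 1) * sk"
      have "0 \<le> u" unfolding u_def using p sk by simp
      then have "2.5 * u + 6 * sk + 1/4 \<le> 1.41 * (2 * u + 5 * sk)" using sk by simp
      moreover have "2.5 * (real p - 1) * sk = 2.5 * u" "(2 * real p + 3) * sk = 2 * u + 5 * sk"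
        by (simp_all add: u_def algebra_simps)
      ultimately show "2.5 * (real p - 1) * sk + 6 * sk + 1/4 \<le> 1.41 * ((2 * real p + 3) * sk)" by simp
    qed (use n0 in simp)
    also have "\<dots> \<le> 4 / q * ((2 * real p + 3) * sk / real n) + 1 / real n"
    proof -
      have "1.41 * ((2 * real p + 3) * sk / real n) \<le> 4 / q * ((2 * real p + 3) * sk / real n)"
        using q4 sk n0 by (intro mult_right_mono) auto
      then show ?thesis by simp
    qed
    finally show ?thesis unfolding q' sk_def .
  qed
  show ?thesis using part1 part2 part3 by blast
qed

end
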